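(* Suppose that $(M,T)$ is a model of $\mathrm{PT}^- + \mathrm{INT}$. Then there exists $T'\subseteq M$ such that $(M,T')\models\mathrm{UTB}$.
   Context: Conventions. $\mathcal{L}_{\mathrm{PA}}$ is the language of Peano Arithmetic $\mathrm{PA}$ and $\mathcal{L}_T=\mathcal{L}_{\mathrm{PA}}\cup\{T\}$ with $T$ a new unary predicate. Syntax is arithmetized inside $\mathrm{PA}$, and symbols for syntactic operations on codes are suppressed. Inside arithmetic, $\phi,\psi$ range over codes of $\mathcal{L}_{\mathrm{PA}}$-sentences; $\phi(v)$ over codes of $\mathcal{L}_{\mathrm{PA}}$-formulae with at most one free variable; $s,t$ (also $t_0,\dots,t_n$) over codes of closed arithmetical terms; $v$ over codes of variables. $\underline{x}$ is (the code of) the standard numeral for $x$; $s^\circ$ is the value of the closed term coded by $s$. In the arithmetized language $\neg,\vee,\exists$ are primitive, and $\wedge,\forall$ are abbreviations. $\mathrm{PT}^-$ is the $\mathcal{L}_T$-theory consisting of $\mathrm{PA}$ (induction only for $\mathcal{L}_{\mathrm{PA}}$-formulae) and the axioms: (1a) $\forall s,t\,(T(s=t)\equiv s^\circ=t^\circ)$; (1b) $\forall s,t\,(T(\neg s=t)\equiv s^\circ\neq t^\circ)$; (2a) $\forall\phi,\psi\,(T(\phi\vee\psi)\equiv T(\phi)\vee T(\psi))$; (2b) $\forall\phi,\psi\,(T(\neg(\phi\vee\psi))\equiv T(\neg\phi)\wedge T(\neg\psi))$; (3a) $\forall v\forall\phi(v)\,(T(\exists v\phi)\equiv\exists x\,T(\phi(\underline{x})))$;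 (3b) $\forall v\forall\phi(v)\,(T(\neg\exists v\phi)\equiv\forall x\,T(\neg\phi(\underline{x})))$; (4) $\forall\phi\,(T(\neg\neg\phi)\equiv T(\phi))$; (5) $\forall\phi(v)\,\forall s,t\,(s^\circ=t^\circ\rightarrow(T(\phi(s))\equiv T(\phi(t))))$. $\mathrm{INT}$ is the $\mathcal{L}_T$-sentence $$\forall\phi(v)\Bigl[\forall x\,\bigl(T(\phi(\underline{x}))\rightarrow T(\phi(\underline{x+1}))\bigr)\rightarrow\bigl(T(\phi(0))\rightarrow\forall x\,T(\phi(\underline{x}))\bigr)\Bigr].$$ $\mathrm{UTB}$ is the $\mathcal{L}_T$-theory consisting of $\mathrm{PA}$, all instances of the induction scheme for $\mathcal{L}_T$-formulae, and, for every (standard) $\mathcal{L}_{\mathrm{PA}}$-formula $\phi(x_0,\dots,x_n)$, the sentence $\forall t_0\dots t_n\,\bigl(T(\ulcorner\phi(t_0,\dots,t_n)\urcorner)\equiv\phi(t_0^\circ,\dots,t_n^\circ)\bigr)$. In $(M,T')$ the symbol $T$ of $\mathrm{UTB}$ is interpreted by $T'$. *)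

theory Defs
  imports Main
begin

section \<open>Arithmetical languages and their semantics\<close>

datatype tm = Zer | Var nat | Sc tm | Add tm tm | Mul tm tm

text \<open>Formulae of the language with the truth predicate; those without \<open>Tr\<close> are the
  arithmetical ones.\<close>

datatype fm = Eq tm tm | Tr tm | Neg fm | Or fm fm | Exists nat fm

fun arithmetical :: "fm \<Rightarrow> bool" where
  "arithmetical (Eq s t) = True"
| "arithmetical (Tr t) = False"
| "arithmetical (Neg A) = arithmetical A"
| "arithmetical (Or A B) = (arithmetical A \<and> arithmetical B)"
| "arithmetical (Exists i A) = arithmetical A"

definition And :: "fm \<Rightarrow> fm \<Rightarrow> fm" where "And A B = Neg (Or (Neg A) (Neg B))"
definition Imp :: "fm \<Rightarrow> fm \<Rightarrow> fm" where "Imp A B = Or (Neg A) B"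
definition Iff :: "fm \<Rightarrow> fm \<Rightarrow> fm" where "Iff A B = And (Imp A B) (Imp B A)"
definition Forall :: "nat \<Rightarrow> fm \<Rightarrow> fm" where "Forall i A = Neg (Exists i (Neg A))"

fun tvars :: "tm \<Rightarrow> nat set" where
  "tvars Zer = {}"
| "tvars (Var i) = {i}"
| "tvars (Sc t) = tvars t"
| "tvars (Add s t) = tvars s \<union> tvars t"
| "tvars (Mul s t) = tvars s \<union> tvars t"

fun fvars :: "fm \<Rightarrow> nat set" where
  "fvars (Eq s t) = tvars s \<union> tvars t"
| "fvars (Tr t) = tvars t"
| "fvars (Neg A) = fvars A"
| "fvars (Or A B) = fvars A \<union> fvars B"
| "fvars (Exists i A) = fvars A - {i}"

text \<open>Substitution does not rename bound variables. It is used only with \<open>Zer\<close> or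
  \<open>Sc (Var v)\<close> in place of \<open>v\<close>, where no capture can occur.\<close>

fun subst_tm :: "nat \<Rightarrow> tm \<Rightarrow> tm \<Rightarrow> tm" where
  "subst_tm v r Zer = Zer"
| "subst_tm v r (Var i) = (if i = v then r else Var i)"
| "subst_tm v r (Sc t) = Sc (subst_tm v r t)"
| "subst_tm v r (Add s t) = Add (subst_tm v r s) (subst_tm v r t)"
| "subst_tm v r (Mul s t) = Mul (subst_tm v r s) (subst_tm v r t)"

fun subst_fm :: "nat \<Rightarrow> tm \<Rightarrow> fm \<Rightarrow> fm" where
  "subst_fm v r (Eq s t) = Eq (subst_tm v r s) (subst_tm v r t)"
| "subst_fm v r (Tr t) = Tr (subst_tm v r t)"
| "subst_fm v r (Neg A) = Neg (subst_fm v r A)"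
| "subst_fm v r (Or A B) = Or (subst_fm v r A) (subst_fm v r B)"
| "subst_fm v r (Exists i A) = (if i = v then Exists i A else Exists i (subst_fm v r A))"

text \<open>The universe of a structure is the whole type \<open>'a\<close>.\<close>

record 'a arith =
  zer :: 'a
  sc :: "'a \<Rightarrow> 'a"
  add :: "'a \<Rightarrow> 'a \<Rightarrow> 'a"
  mul :: "'a \<Rightarrow> 'a \<Rightarrow> 'a"

fun eval :: "'a arith \<Rightarrow> (nat \<Rightarrow> 'a) \<Rightarrow> tm \<Rightarrow> 'a" where
  "eval M e Zer = zer M"
| "eval M e (Var i) = e i"
| "eval M e (Sc t) = sc M (eval M e t)"
| "eval M e (Add s t) = add M (eval M e s) (eval M e t)"
| "eval M e (Mul s t) = mul M (eval M e s) (eval M e t)"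

fun sat :: "'a arith \<Rightarrow> 'a set \<Rightarrow> (nat \<Rightarrow> 'a) \<Rightarrow> fm \<Rightarrow> bool" where
  "sat M T e (Eq s t) = (eval M e s = eval M e t)"
| "sat M T e (Tr t) = (eval M e t \<in> T)"
| "sat M T e (Neg A) = (\<not> sat M T e A)"
| "sat M T e (Or A B) = (sat M T e A \<or> sat M T e B)"
| "sat M T e (Exists i A) = (\<exists>x. sat M T (e(i := x)) A)"

text \<open>Formulae with free variables stand for their universal closures.\<close>

definition models :: "'a arith \<Rightarrow> 'a set \<Rightarrow> fm set \<Rightarrow> bool" where
  "models M T \<Gamma> \<longleftrightarrow> (\<forall>A\<in>\<Gamma>. \<forall>e. sat M T e A)"


section \<open>Peano arithmetic\<close>

definition robinson :: "fm set" where
  "robinson =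
    {Neg (Eq (Sc (Var 0)) Zer),
     Imp (Eq (Sc (Var 0)) (Sc (Var 1))) (Eq (Var 0) (Var 1)),
     Eq (Add (Var 0) Zer) (Var 0),
     Eq (Add (Var 0) (Sc (Var 1))) (Sc (Add (Var 0) (Var 1))),
     Eq (Mul (Var 0) Zer) Zer,
     Eq (Mul (Var 0) (Sc (Var 1))) (Add (Mul (Var 0) (Var 1)) (Var 0))}"

definition ind_axiom :: "nat \<Rightarrow> fm \<Rightarrow> fm" where
  "ind_axiom v A =
    Imp (And (subst_fm v Zer A) (Forall v (Imp A (subst_fm v (Sc (Var v)) A)))) (Forall v A)"

definition PA :: "fm set" where
  "PA = robinson \<union> {ind_axiom v A | v A. arithmetical A}"


section \<open>Writing formulae with managed bound variables\<close>

text \<open>To define concrete formulae without choosing variable names by hand, a formula is given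
  as a function of a number \<open>n\<close> such that all variables in scope are below \<open>n\<close>; a quantifier
  binds the variable \<open>n\<close> and raises this bound. In particular, \<open>A 0\<close> is a sentence.\<close>

type_synonym sfm = "nat \<Rightarrow> fm"

definition s_eq :: "tm \<Rightarrow> tm \<Rightarrow> sfm" (infix "\<^bold>=" 50)
  where "(s \<^bold>= t) = (\<lambda>n. Eq s t)"
definition s_tr :: "tm \<Rightarrow> sfm" ("\<^bold>T")
  where "\<^bold>T t = (\<lambda>n. Tr t)"
definition s_not :: "sfm \<Rightarrow> sfm" ("\<^bold>\<not> _" [40] 40)
  where "(\<^bold>\<not> A) = (\<lambda>n. Neg (A n))"
definition s_and :: "sfm \<Rightarrow> sfm \<Rightarrow> sfm" (infixr "\<^bold>\<and>" 35)
  where "(A \<^bold>\<and> B) = (\<lambda>n. And (A n) (B n))"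
definition s_or :: "sfm \<Rightarrow> sfm \<Rightarrow> sfm" (infixr "\<^bold>\<or>" 30)
  where "(A \<^bold>\<or> B) = (\<lambda>n. Or (A n) (B n))"
definition s_imp :: "sfm \<Rightarrow> sfm \<Rightarrow> sfm" (infixr "\<^bold>\<longrightarrow>" 25)
  where "(A \<^bold>\<longrightarrow> B) = (\<lambda>n. Imp (A n) (B n))"
definition s_iff :: "sfm \<Rightarrow> sfm \<Rightarrow> sfm" (infixr "\<^bold>\<longleftrightarrow>" 25)
  where "(A \<^bold>\<longleftrightarrow> B) = (\<lambda>n. Iff (A n) (B n))"
definition s_ex :: "(tm \<Rightarrow> sfm) \<Rightarrow> sfm" (binder "\<^bold>\<exists>" 10)
  where "s_ex F = (\<lambda>n. Exists n (F (Var n) (Suc n)))"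
definition s_all :: "(tm \<Rightarrow> sfm) \<Rightarrow> sfm" (binder "\<^bold>\<forall>" 10)
  where "s_all F = (\<lambda>n. Forall n (F (Var n) (Suc n)))"


section \<open>Arithmetized syntax\<close>

text \<open>The pairing polynomial \<open>(x + y)\<^sup>2 + x\<close> is injective (not surjective) and is a term of the
  language, hence so are all code constructors below.\<close>

definition pr :: "tm \<Rightarrow> tm \<Rightarrow> tm" where
  "pr s t = Add (Mul (Add s t) (Add s t)) s"

fun numl :: "nat \<Rightarrow> tm" where
  "numl 0 = Zer"
| "numl (Suc n) = Sc (numl n)"

definition cZer :: tm where "cZer = pr (numl 0) (numl 0)"
definition cVar :: "tm \<Rightarrow> tm" where "cVar i = pr (numl 1) i"
definition cSc :: "tm \<Rightarrow> tm" where "cSc s = pr (numl 2) s"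
definition cAdd :: "tm \<Rightarrow> tm \<Rightarrow> tm" where "cAdd s t = pr (numl 3) (pr s t)"
definition cMul :: "tm \<Rightarrow> tm \<Rightarrow> tm" where "cMul s t = pr (numl 4) (pr s t)"
definition cEq :: "tm \<Rightarrow> tm \<Rightarrow> tm" where "cEq s t = pr (numl 5) (pr s t)"
definition cNeg :: "tm \<Rightarrow> tm" where "cNeg p = pr (numl 6) p"
definition cOr :: "tm \<Rightarrow> tm \<Rightarrow> tm" where "cOr p q = pr (numl 7) (pr p q)"
definition cEx :: "tm \<Rightarrow> tm \<Rightarrow> tm" where "cEx v p = pr (numl 8) (pr v p)"

definition Lt :: "tm \<Rightarrow> tm \<Rightarrow> sfm" where
  "Lt s t = (\<^bold>\<exists>z. Add s (Sc z) \<^bold>= t)"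

text \<open>The triple \<open>a, b, c\<close> codes the finite set of all \<open>x < c\<close> such that \<open>1 + (x + 1) b\<close>
  divides \<open>a\<close> (these are the moduli of Goedel's beta function).\<close>

definition Mem :: "tm \<Rightarrow> tm \<Rightarrow> tm \<Rightarrow> tm \<Rightarrow> sfm" where
  "Mem a b c x = (Lt x c \<^bold>\<and> (\<^bold>\<exists>q. a \<^bold>= Mul q (Sc (Mul (Sc x) b))))"

text \<open>Arithmetized inductive definitions: \<open>x\<close> belongs to some coded finite set each of whose
  elements is obtained from elements of this set by one clause of \<open>S\<close>. In all uses below the
  clauses pass from smaller to larger codes, so that such a set is a derivation of \<open>x\<close>.\<close>

definition Derivable :: "((tm \<Rightarrow> sfm) \<Rightarrow> tm \<Rightarrow> sfm) \<Rightarrow> tm \<Rightarrow> sfm" where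
  "Derivable S x =
    (\<^bold>\<exists>a. \<^bold>\<exists>b. \<^bold>\<exists>c. Mem a b c x \<^bold>\<and> (\<^bold>\<forall>y. Mem a b c y \<^bold>\<longrightarrow> S (Mem a b c) y))"

definition IsVar :: "tm \<Rightarrow> sfm" where
  "IsVar v = (\<^bold>\<exists>i. v \<^bold>= cVar i)"

definition IsTerm :: "tm \<Rightarrow> sfm" where
  "IsTerm = Derivable (\<lambda>D y.
      y \<^bold>= cZer \<^bold>\<or> IsVar y \<^bold>\<or> (\<^bold>\<exists>s. D s \<^bold>\<and> y \<^bold>= cSc s) \<^bold>\<or>
      (\<^bold>\<exists>s. \<^bold>\<exists>t. D s \<^bold>\<and> D t \<^bold>\<and> (y \<^bold>= cAdd s t \<^bold>\<or> y \<^bold>= cMul s t)))"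

definition IsClosedTerm :: "tm \<Rightarrow> sfm" where
  "IsClosedTerm = Derivable (\<lambda>D y.
      y \<^bold>= cZer \<^bold>\<or> (\<^bold>\<exists>s. D s \<^bold>\<and> y \<^bold>= cSc s) \<^bold>\<or>
      (\<^bold>\<exists>s. \<^bold>\<exists>t. D s \<^bold>\<and> D t \<^bold>\<and> (y \<^bold>= cAdd s t \<^bold>\<or> y \<^bold>= cMul s t)))"

definition IsFormula :: "tm \<Rightarrow> sfm" where
  "IsFormula = Derivable (\<lambda>D y.
      (\<^bold>\<exists>s. \<^bold>\<exists>t. IsTerm s \<^bold>\<and> IsTerm t \<^bold>\<and> y \<^bold>= cEq s t) \<^bold>\<or>
      (\<^bold>\<exists>p. D p \<^bold>\<and> y \<^bold>= cNeg p) \<^bold>\<or>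
      (\<^bold>\<exists>p. \<^bold>\<exists>q. D p \<^bold>\<and> D q \<^bold>\<and> y \<^bold>= cOr p q) \<^bold>\<or>
      (\<^bold>\<exists>v. \<^bold>\<exists>p. IsVar v \<^bold>\<and> D p \<^bold>\<and> y \<^bold>= cEx v p))"

definition OccursIn :: "tm \<Rightarrow> tm \<Rightarrow> sfm" where
  "OccursIn v = Derivable (\<lambda>D y.
      y \<^bold>= v \<^bold>\<or> (\<^bold>\<exists>s. D s \<^bold>\<and> y \<^bold>= cSc s) \<^bold>\<or>
      (\<^bold>\<exists>s. \<^bold>\<exists>t. (D s \<^bold>\<or> D t) \<^bold>\<and> (y \<^bold>= cAdd s t \<^bold>\<or> y \<^bold>= cMul s t)))"

definition FreeIn :: "tm \<Rightarrow> tm \<Rightarrow> sfm" where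
  "FreeIn v = Derivable (\<lambda>D y.
      (\<^bold>\<exists>s. \<^bold>\<exists>t. (OccursIn v s \<^bold>\<or> OccursIn v t) \<^bold>\<and> y \<^bold>= cEq s t) \<^bold>\<or>
      (\<^bold>\<exists>p. D p \<^bold>\<and> y \<^bold>= cNeg p) \<^bold>\<or>
      (\<^bold>\<exists>p. \<^bold>\<exists>q. (D p \<^bold>\<or> D q) \<^bold>\<and> y \<^bold>= cOr p q) \<^bold>\<or>
      (\<^bold>\<exists>w. \<^bold>\<exists>p. \<^bold>\<not> w \<^bold>= v \<^bold>\<and> D p \<^bold>\<and> y \<^bold>= cEx w p))"

definition IsSentence :: "tm \<Rightarrow> sfm" where
  "IsSentence p = (IsFormula p \<^bold>\<and> (\<^bold>\<forall>w. IsVar w \<^bold>\<longrightarrow> \<^bold>\<not> FreeIn w p))"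

text \<open>\<open>v\<close> is a variable and \<open>p\<close> is a formula with no free variable other than \<open>v\<close>.\<close>

definition IsFormula1 :: "tm \<Rightarrow> tm \<Rightarrow> sfm" where
  "IsFormula1 v p =
    (IsVar v \<^bold>\<and> IsFormula p \<^bold>\<and> (\<^bold>\<forall>w. IsVar w \<^bold>\<and> FreeIn w p \<^bold>\<longrightarrow> w \<^bold>= v))"

text \<open>Syntactic functions are represented by their graphs, as formulae about pairs.\<close>

definition Value :: "tm \<Rightarrow> tm \<Rightarrow> sfm" where
  "Value t x = Derivable (\<lambda>D y.
      y \<^bold>= pr cZer Zer \<^bold>\<or>
      (\<^bold>\<exists>s. \<^bold>\<exists>a. D (pr s a) \<^bold>\<and> y \<^bold>= pr (cSc s) (Sc a)) \<^bold>\<or>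
      (\<^bold>\<exists>s. \<^bold>\<exists>a. \<^bold>\<exists>r. \<^bold>\<exists>b. D (pr s a) \<^bold>\<and> D (pr r b) \<^bold>\<and>
        (y \<^bold>= pr (cAdd s r) (Add a b) \<^bold>\<or> y \<^bold>= pr (cMul s r) (Mul a b)))) (pr t x)"

definition Numeral :: "tm \<Rightarrow> tm \<Rightarrow> sfm" where
  "Numeral x t = Derivable (\<lambda>D y.
      y \<^bold>= pr Zer cZer \<^bold>\<or>
      (\<^bold>\<exists>a. \<^bold>\<exists>s. D (pr a s) \<^bold>\<and> y \<^bold>= pr (Sc a) (cSc s))) (pr x t)"

text \<open>Substitution of a closed term \<open>r\<close> for the variable \<open>v\<close>; the last argument is the result.\<close>

definition SubstTerm :: "tm \<Rightarrow> tm \<Rightarrow> tm \<Rightarrow> tm \<Rightarrow> sfm" where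
  "SubstTerm v r t t' = Derivable (\<lambda>D y.
      y \<^bold>= pr cZer cZer \<^bold>\<or> y \<^bold>= pr v r \<^bold>\<or>
      (\<^bold>\<exists>w. IsVar w \<^bold>\<and> \<^bold>\<not> w \<^bold>= v \<^bold>\<and> y \<^bold>= pr w w) \<^bold>\<or>
      (\<^bold>\<exists>s. \<^bold>\<exists>s'. D (pr s s') \<^bold>\<and> y \<^bold>= pr (cSc s) (cSc s')) \<^bold>\<or>
      (\<^bold>\<exists>s. \<^bold>\<exists>s'. \<^bold>\<exists>u. \<^bold>\<exists>u'. D (pr s s') \<^bold>\<and> D (pr u u') \<^bold>\<and>
        (y \<^bold>= pr (cAdd s u) (cAdd s' u') \<^bold>\<or> y \<^bold>= pr (cMul s u) (cMul s' u')))) (pr t t')"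

definition SubstFormula :: "tm \<Rightarrow> tm \<Rightarrow> tm \<Rightarrow> tm \<Rightarrow> sfm" where
  "SubstFormula v r p p' = Derivable (\<lambda>D y.
      (\<^bold>\<exists>s. \<^bold>\<exists>s'. \<^bold>\<exists>t. \<^bold>\<exists>t'. SubstTerm v r s s' \<^bold>\<and> SubstTerm v r t t' \<^bold>\<and>
        y \<^bold>= pr (cEq s t) (cEq s' t')) \<^bold>\<or>
      (\<^bold>\<exists>q. \<^bold>\<exists>q'. D (pr q q') \<^bold>\<and> y \<^bold>= pr (cNeg q) (cNeg q')) \<^bold>\<or>
      (\<^bold>\<exists>q. \<^bold>\<exists>q'. \<^bold>\<exists>u. \<^bold>\<exists>u'. D (pr q q') \<^bold>\<and> D (pr u u') \<^bold>\<and>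
        y \<^bold>= pr (cOr q u) (cOr q' u')) \<^bold>\<or>
      (\<^bold>\<exists>w. \<^bold>\<exists>q. \<^bold>\<exists>q'. IsVar w \<^bold>\<and> \<^bold>\<not> w \<^bold>= v \<^bold>\<and> D (pr q q') \<^bold>\<and>
        y \<^bold>= pr (cEx w q) (cEx w q')) \<^bold>\<or>
      (\<^bold>\<exists>q. IsFormula q \<^bold>\<and> y \<^bold>= pr (cEx v q) (cEx v q))) (pr p p')"


section \<open>The theory \<open>PT\<^sup>-\<close> and internal induction\<close>

text \<open>\<open>T(p(r))\<close> for a closed term \<open>r\<close>; \<open>T(p(x))\<close> and \<open>T(\<not> p(x))\<close> for the numeral of \<open>x\<close>.\<close>

definition TSubst :: "tm \<Rightarrow> tm \<Rightarrow> tm \<Rightarrow> sfm" where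
  "TSubst v p r = (\<^bold>\<exists>q. SubstFormula v r p q \<^bold>\<and> \<^bold>T q)"

definition TNum :: "tm \<Rightarrow> tm \<Rightarrow> tm \<Rightarrow> sfm" where
  "TNum v p x = (\<^bold>\<exists>r. \<^bold>\<exists>q. Numeral x r \<^bold>\<and> SubstFormula v r p q \<^bold>\<and> \<^bold>T q)"

definition TNegNum :: "tm \<Rightarrow> tm \<Rightarrow> tm \<Rightarrow> sfm" where
  "TNegNum v p x = (\<^bold>\<exists>r. \<^bold>\<exists>q. Numeral x r \<^bold>\<and> SubstFormula v r p q \<^bold>\<and> \<^bold>T (cNeg q))"

definition SameValue :: "tm \<Rightarrow> tm \<Rightarrow> sfm" where
  "SameValue s t = (\<^bold>\<exists>x. \<^bold>\<exists>y. Value s x \<^bold>\<and> Value t y \<^bold>\<and> x \<^bold>= y)"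

definition DifferentValue :: "tm \<Rightarrow> tm \<Rightarrow> sfm" where
  "DifferentValue s t = (\<^bold>\<exists>x. \<^bold>\<exists>y. Value s x \<^bold>\<and> Value t y \<^bold>\<and> \<^bold>\<not> x \<^bold>= y)"

definition PT1a :: sfm where
  "PT1a = (\<^bold>\<forall>s. \<^bold>\<forall>t. IsClosedTerm s \<^bold>\<and> IsClosedTerm t \<^bold>\<longrightarrow>
    (\<^bold>T (cEq s t) \<^bold>\<longleftrightarrow> SameValue s t))"

definition PT1b :: sfm where
  "PT1b = (\<^bold>\<forall>s. \<^bold>\<forall>t. IsClosedTerm s \<^bold>\<and> IsClosedTerm t \<^bold>\<longrightarrow>
    (\<^bold>T (cNeg (cEq s t)) \<^bold>\<longleftrightarrow> DifferentValue s t))"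

definition PT2a :: sfm where
  "PT2a = (\<^bold>\<forall>p. \<^bold>\<forall>q. IsSentence p \<^bold>\<and> IsSentence q \<^bold>\<longrightarrow>
    (\<^bold>T (cOr p q) \<^bold>\<longleftrightarrow> \<^bold>T p \<^bold>\<or> \<^bold>T q))"

definition PT2b :: sfm where
  "PT2b = (\<^bold>\<forall>p. \<^bold>\<forall>q. IsSentence p \<^bold>\<and> IsSentence q \<^bold>\<longrightarrow>
    (\<^bold>T (cNeg (cOr p q)) \<^bold>\<longleftrightarrow> \<^bold>T (cNeg p) \<^bold>\<and> \<^bold>T (cNeg q)))"

definition PT3a :: sfm where
  "PT3a = (\<^bold>\<forall>v. \<^bold>\<forall>p. IsFormula1 v p \<^bold>\<longrightarrow>
    (\<^bold>T (cEx v p) \<^bold>\<longleftrightarrow> (\<^bold>\<exists>x. TNum v p x)))"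

definition PT3b :: sfm where
  "PT3b = (\<^bold>\<forall>v. \<^bold>\<forall>p. IsFormula1 v p \<^bold>\<longrightarrow>
    (\<^bold>T (cNeg (cEx v p)) \<^bold>\<longleftrightarrow> (\<^bold>\<forall>x. TNegNum v p x)))"

definition PT4 :: sfm where
  "PT4 = (\<^bold>\<forall>p. IsSentence p \<^bold>\<longrightarrow> (\<^bold>T (cNeg (cNeg p)) \<^bold>\<longleftrightarrow> \<^bold>T p))"

definition PT5 :: sfm where
  "PT5 = (\<^bold>\<forall>v. \<^bold>\<forall>p. \<^bold>\<forall>s. \<^bold>\<forall>t. IsFormula1 v p \<^bold>\<and> IsClosedTerm s \<^bold>\<and> IsClosedTerm t \<^bold>\<longrightarrow>
    SameValue s t \<^bold>\<longrightarrow> (TSubst v p s \<^bold>\<longleftrightarrow> TSubst v p t))"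

definition PT_minus :: "fm set" where
  "PT_minus = PA \<union> {PT1a 0, PT1b 0, PT2a 0, PT2b 0, PT3a 0, PT3b 0, PT4 0, PT5 0}"

definition Int_Ind :: fm where
  "Int_Ind = (\<^bold>\<forall>v. \<^bold>\<forall>p. IsFormula1 v p \<^bold>\<longrightarrow>
    (\<^bold>\<forall>x. TNum v p x \<^bold>\<longrightarrow> TNum v p (Sc x)) \<^bold>\<longrightarrow>
    TSubst v p cZer \<^bold>\<longrightarrow> (\<^bold>\<forall>x. TNum v p x)) 0"


section \<open>The theory UTB\<close>

text \<open>The code of a (standard) term or formula in which each free variable \<open>i\<close> has been
  replaced by the term coded by \<open>\<sigma> i\<close>. The clause for \<open>Tr\<close> is a dummy: only arithmetical
  formulae are coded.\<close>

fun code_tm :: "(nat \<Rightarrow> tm) \<Rightarrow> tm \<Rightarrow> tm" where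
  "code_tm \<sigma> Zer = cZer"
| "code_tm \<sigma> (Var i) = \<sigma> i"
| "code_tm \<sigma> (Sc t) = cSc (code_tm \<sigma> t)"
| "code_tm \<sigma> (Add s t) = cAdd (code_tm \<sigma> s) (code_tm \<sigma> t)"
| "code_tm \<sigma> (Mul s t) = cMul (code_tm \<sigma> s) (code_tm \<sigma> t)"

fun code_fm :: "(nat \<Rightarrow> tm) \<Rightarrow> fm \<Rightarrow> tm" where
  "code_fm \<sigma> (Eq s t) = cEq (code_tm \<sigma> s) (code_tm \<sigma> t)"
| "code_fm \<sigma> (Tr t) = Zer"
| "code_fm \<sigma> (Neg A) = cNeg (code_fm \<sigma> A)"
| "code_fm \<sigma> (Or A B) = cOr (code_fm \<sigma> A) (code_fm \<sigma> B)"
| "code_fm \<sigma> (Exists i A) = cEx (cVar (numl i)) (code_fm (\<sigma>(i := cVar (numl i))) A)"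

text \<open>For \<open>A\<close> with free variables among \<open>x\<^sub>0, \<dots>, x\<^sub>n\<close> (the variables \<open>0, \<dots>, n\<close>), the
  variables \<open>n + 1, \<dots>, 2n + 1\<close> play the role of \<open>t\<^sub>0, \<dots>, t\<^sub>n\<close>, and \<open>x\<^sub>i\<close> is required to be
  the value of \<open>t\<^sub>i\<close>.\<close>

definition utb_instance :: "nat \<Rightarrow> fm \<Rightarrow> fm" where
  "utb_instance n A =
    foldr Forall [0..<2 * Suc n]
      (foldr (\<lambda>i. Imp ((IsClosedTerm (Var (Suc n + i)) \<^bold>\<and> Value (Var (Suc n + i)) (Var i))
                          (2 * Suc n)))
        [0..<Suc n]
        (Iff (Tr (code_fm (\<lambda>i. Var (Suc n + i)) A)) A))"

definition UTB :: "fm set" where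
  "UTB = PA \<union> {ind_axiom v A | v A. True} \<union>
    {utb_instance n A | n A. arithmetical A \<and> fvars A \<subseteq> {..n}}"

end

theory Submission imports Defs begin

text \<open>The idea is to let the given truth class \<open>T\<close> evaluate one arithmetical formula of nonstandard
length that iterates Tarski's truth definition, and to read \<open>T'\<close> off from it. Internal induction
is used twice: to find a level of the iteration at which \<open>T\<close> behaves classically, and to give
\<open>T'\<close> full induction.

The elementary fact about \<open>T\<close> is \<open>T_code_fm\<close>. Let \<open>h\<close> be a code, in the sense of the model \<open>M\<close>,
of a formula with one free variable, and replace \<open>Tr\<close> by \<open>h\<close> in a standard formula \<open>A\<close>. Then \<open>T\<close>
evaluates the result compositionally from the sets \<open>P\<close> of those \<open>x\<close> with \<open>T(h(x))\<close> and \<open>N\<close> of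
those with \<open>T(\<not> h(x))\<close>. As \<open>T\<close> is only positively compositional, \<open>P\<close> and \<open>N\<close> need not be
complementary; but if they are, this is ordinary satisfaction with \<open>Tr\<close> interpreted by \<open>P\<close>, and
\<open>INT\<close> becomes induction for every formula of the language with \<open>Tr\<close>.

Tarski's clauses turn a truth predicate for shallow formulae into one for formulae that are deeper
by one connective or quantifier. Written for pairs (level, sentence) they form a single standard
formula \<open>step_fm\<close>: membership of \<open>x\<close> at level \<open>w + 1\<close> is given by the clauses applied to level
\<open>w\<close> of \<open>Tr\<close>. Plugging \<open>h\<close> into it is an operation on codes that \<open>M\<close> can iterate \<open>n\<close> times for a
nonstandard \<open>n\<close>. The levels of the resulting formula are classical at every standard level, by
an external induction (\<open>classical_standard_level\<close>). Classicality at a level consists of totality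
and absence of gluts; the first is positive in \<open>T\<close>, the second is the negation of a positive
condition. So neither can separate the standard numbers from the others, since internal induction
would apply to the cut, and some nonstandard level \<open>c\<close> is classical
(\<open>nonstandard_classical_level\<close>).

Let \<open>T'\<close> be level \<open>c\<close>. One unfolding describes level \<open>c\<close> by Tarski's clauses over level \<open>c - 1\<close> of
the previous iterate, and the clause for negation shows that the latter level is classical as well.
So \<open>T'\<close> sits on top of a descending chain of Tarskian sets of any standard length, and a standard
formula only uses as many links as its depth (\<open>approx_correct\<close>). This gives the biconditionals; full
induction was explained above (\<open>level_induction\<close>). If \<open>M\<close> has no nonstandard element, induction is
free and \<open>T'\<close> is the limit of the finite levels (\<open>UTB_standard\<close>).

All of this needs the arithmetized syntax to behave as expected in \<open>M\<close>: existence and uniqueness of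
substitution results, numerals and values. These are proved by induction for definable predicates,
from one principle: a coded inductive definition satisfies its own clauses
(\<open>derivable_iff\<close>). That principle rests on comprehension for coded sets
(\<open>bounded_definable_coded\<close>).\<close>

section \<open>Parametrically definable predicates\<close>

lemma eval_cong: "(\<And>i. i \<in> tvars t \<Longrightarrow> e i = e' i) \<Longrightarrow> eval M e t = eval M e' t"
  by (induction t) auto

lemma sat_arithmetical: "arithmetical A \<Longrightarrow> sat M T e A = sat M T' e A"
  by (induction A arbitrary: e) auto

primrec rename_tm :: "(nat \<Rightarrow> nat) \<Rightarrow> tm \<Rightarrow> tm" where
  "rename_tm \<rho> Zer = Zer"
| "rename_tm \<rho> (Var i) = Var (\<rho> i)"
| "rename_tm \<rho> (Sc t) = Sc (rename_tm \<rho> t)"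
| "rename_tm \<rho> (Add s t) = Add (rename_tm \<rho> s) (rename_tm \<rho> t)"
| "rename_tm \<rho> (Mul s t) = Mul (rename_tm \<rho> s) (rename_tm \<rho> t)"

primrec rename_fm :: "(nat \<Rightarrow> nat) \<Rightarrow> fm \<Rightarrow> fm" where
  "rename_fm \<rho> (Eq s t) = Eq (rename_tm \<rho> s) (rename_tm \<rho> t)"
| "rename_fm \<rho> (Tr t) = Tr (rename_tm \<rho> t)"
| "rename_fm \<rho> (Neg A) = Neg (rename_fm \<rho> A)"
| "rename_fm \<rho> (Or A B) = Or (rename_fm \<rho> A) (rename_fm \<rho> B)"
| "rename_fm \<rho> (Exists i A) = Exists (\<rho> i) (rename_fm \<rho> A)"

lemma eval_rename: "eval M e (rename_tm \<rho> t) = eval M (\<lambda>i. e (\<rho> i)) t"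
  by (induction t) auto

lemma sat_rename:
  assumes "inj \<rho>"
  shows "sat M T e (rename_fm \<rho> A) = sat M T (\<lambda>i. e (\<rho> i)) A"
proof (induction A arbitrary: e)
  case (Exists j A)
  have "(\<lambda>i. (e(\<rho> j := x)) (\<rho> i)) = (\<lambda>i. e (\<rho> i))(j := x)" for x
    using assms by (auto simp: fun_eq_iff inj_eq)
  then show ?case by (simp add: Exists)
qed (auto simp: eval_rename)

lemma arithmetical_rename [simp]: "arithmetical (rename_fm \<rho> A) = arithmetical A"
  by (induction A) auto

text \<open>Definability is meant with parameters. A formula sees its first \<open>k\<close> variables as parameters and the
  environment behind them, so a bound variable can be introduced by using one of the parameter
  slots; this is why no renaming is needed for quantifiers in \<open>definable_ex\<close>.\<close>

definition penv :: "nat \<Rightarrow> (nat \<Rightarrow> 'a) \<Rightarrow> (nat \<Rightarrow> 'a) \<Rightarrow> nat \<Rightarrow> 'a" where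
  "penv k p e i = (if i < k then p i else e (i - k))"

definition definable_fn :: "'a arith \<Rightarrow> ((nat \<Rightarrow> 'a) \<Rightarrow> 'a) \<Rightarrow> bool" where
  "definable_fn M f \<longleftrightarrow> (\<exists>t p k. \<forall>e. f e = eval M (penv k p e) t)"

definition definable :: "'a arith \<Rightarrow> ((nat \<Rightarrow> 'a) \<Rightarrow> bool) \<Rightarrow> bool" where
  "definable M P \<longleftrightarrow> (\<exists>A p k. arithmetical A \<and> (\<forall>e. P e = sat M {} (penv k p e) A))"

text \<open>Two formulae can be given a common list of parameters: both are renamed injectively.\<close>

lemma penv_merge:
  obtains \<rho>1 \<rho>2 k and p :: "nat \<Rightarrow> 'a" where "inj \<rho>1" "inj \<rho>2"
    "\<And>e. (\<lambda>i. penv k p e (\<rho>1 i)) = penv k1 p1 e"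
    "\<And>e. (\<lambda>i. penv k p e (\<rho>2 i)) = penv k2 p2 e"
proof (rule that)
  let ?k = "k1 + k2" and ?p = "\<lambda>i. if i < k1 then p1 i else p2 (i - k1)"
  show "inj (\<lambda>i. if i < k1 then i else i + k2)" by (auto simp: inj_on_def split: if_splits)
  show "inj (\<lambda>i. i + k1)" by (auto simp: inj_on_def)
  show "(\<lambda>i. penv ?k ?p e (if i < k1 then i else i + k2)) = penv k1 p1 e" for e
    by (auto simp: penv_def fun_eq_iff)
  show "(\<lambda>i. penv ?k ?p e (i + k1)) = penv k2 p2 e" for e
    by (auto simp: penv_def fun_eq_iff)
qed

text \<open>The predicates are functions of de Bruijn environments: a quantifier turns \<open>e i\<close> into
  \<open>e (Suc i)\<close> and adds \<open>e 0\<close>. In this form the closure properties below are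
  introduction rules that prove definability of a HOL term by following its structure.\<close>

lemma definable_fn_var: "definable_fn M (\<lambda>e. e i)"
  unfolding definable_fn_def by (rule exI[of _ "Var i"], rule exI, rule exI[of _ 0]) (simp add: penv_def)

lemma definable_fn_const: "definable_fn M (\<lambda>e. c)"
  unfolding definable_fn_def
  by (rule exI[of _ "Var 0"], rule exI[of _ "\<lambda>_. c"], rule exI[of _ 1]) (simp add: penv_def)

lemma definable_fn_sc:
  assumes "definable_fn M f" shows "definable_fn M (\<lambda>e. sc M (f e))"
proof -
  obtain t p k where "\<forall>e. f e = eval M (penv k p e) t"
    using assms unfolding definable_fn_def by blast
  then have "\<forall>e. sc M (f e) = eval M (penv k p e) (Sc t)" by simp
  then show ?thesis unfolding definable_fn_def by blast
qed

lemma definable_fn_pair: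
  assumes "definable_fn M f" "definable_fn M g"
  obtains s t p k where "\<forall>e. f e = eval M (penv k p e) s" "\<forall>e. g e = eval M (penv k p e) t"
proof -
  obtain s p1 k1 where s: "\<forall>e. f e = eval M (penv k1 p1 e) s"
    using assms unfolding definable_fn_def by blast
  obtain t p2 k2 where t: "\<forall>e. g e = eval M (penv k2 p2 e) t"
    using assms unfolding definable_fn_def by blast
  obtain \<rho>1 \<rho>2 k p where "\<And>e. (\<lambda>i. penv k p e (\<rho>1 i)) = penv k1 p1 e"
    "\<And>e. (\<lambda>i. penv k p e (\<rho>2 i)) = penv k2 p2 e" using penv_merge by metis
  then have "\<forall>e. f e = eval M (penv k p e) (rename_tm \<rho>1 s)"
    "\<forall>e. g e = eval M (penv k p e) (rename_tm \<rho>2 t)" using s t by (auto simp: eval_rename)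
  then show thesis using that by blast
qed

lemma definable_fn_add:
  assumes "definable_fn M f" "definable_fn M g"
  shows "definable_fn M (\<lambda>e. add M (f e) (g e))"
proof -
  obtain s t p k where "\<forall>e. f e = eval M (penv k p e) s" "\<forall>e. g e = eval M (penv k p e) t"
    using definable_fn_pair[OF assms] .
  then have "\<forall>e. add M (f e) (g e) = eval M (penv k p e) (Add s t)" by simp
  then show ?thesis unfolding definable_fn_def by blast
qed

lemma definable_fn_mul:
  assumes "definable_fn M f" "definable_fn M g"
  shows "definable_fn M (\<lambda>e. mul M (f e) (g e))"
proof -
  obtain s t p k where "\<forall>e. f e = eval M (penv k p e) s" "\<forall>e. g e = eval M (penv k p e) t"
    using definable_fn_pair[OF assms] .
  then have "\<forall>e. mul M (f e) (g e) = eval M (penv k p e) (Mul s t)" by simp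
  then show ?thesis unfolding definable_fn_def by blast
qed

lemma definable_fn_shift:
  assumes "definable_fn M f" shows "definable_fn M (\<lambda>e. f (\<lambda>i. e (Suc i)))"
proof -
  obtain t p k where t: "\<forall>e. f e = eval M (penv k p e) t"
    using assms unfolding definable_fn_def by blast
  have "(\<lambda>i. penv k p e (if i < k then i else Suc i)) = penv k p (\<lambda>i. e (Suc i))" for e
    by (auto simp: penv_def fun_eq_iff Suc_diff_le)
  then have "\<forall>e. f (\<lambda>i. e (Suc i)) = eval M (penv k p e) (rename_tm (\<lambda>i. if i < k then i else Suc i) t)"
    using t by (simp add: eval_rename)
  then show ?thesis unfolding definable_fn_def by blast
qed

lemma definable_eq:
  assumes "definable_fn M f" "definable_fn M g"
  shows "definable M (\<lambda>e. f e = g e)"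
proof -
  obtain s t p k where "\<forall>e. f e = eval M (penv k p e) s" "\<forall>e. g e = eval M (penv k p e) t"
    using definable_fn_pair[OF assms] .
  then have "arithmetical (Eq s t) \<and> (\<forall>e. (f e = g e) = sat M {} (penv k p e) (Eq s t))" by simp
  then show ?thesis unfolding definable_def by blast
qed

lemma definable_not:
  assumes "definable M P" shows "definable M (\<lambda>e. \<not> P e)"
proof -
  obtain A p k where "arithmetical A \<and> (\<forall>e. P e = sat M {} (penv k p e) A)"
    using assms unfolding definable_def by blast
  then have "arithmetical (Neg A) \<and> (\<forall>e. (\<not> P e) = sat M {} (penv k p e) (Neg A))" by simp
  then show ?thesis unfolding definable_def by blast
qed

lemma definable_or:
  assumes "definable M P" "definable M Q" shows "definable M (\<lambda>e. P e \<or> Q e)"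
proof -
  obtain A p1 k1 where A: "arithmetical A \<and> (\<forall>e. P e = sat M {} (penv k1 p1 e) A)"
    using assms unfolding definable_def by blast
  obtain B p2 k2 where B: "arithmetical B \<and> (\<forall>e. Q e = sat M {} (penv k2 p2 e) B)"
    using assms unfolding definable_def by blast
  obtain \<rho>1 \<rho>2 k p where "inj \<rho>1" "inj \<rho>2" "\<And>e. (\<lambda>i. penv k p e (\<rho>1 i)) = penv k1 p1 e"
    "\<And>e. (\<lambda>i. penv k p e (\<rho>2 i)) = penv k2 p2 e" using penv_merge by metis
  then have "arithmetical (Or (rename_fm \<rho>1 A) (rename_fm \<rho>2 B)) \<and> (\<forall>e. (P e \<or> Q e) =
      sat M {} (penv k p e) (Or (rename_fm \<rho>1 A) (rename_fm \<rho>2 B)))"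
    using A B by (simp add: sat_rename)
  then show ?thesis unfolding definable_def by blast
qed

lemma definable_ex:
  assumes "definable M (\<lambda>e. P (e 0) (\<lambda>i. e (Suc i)))" shows "definable M (\<lambda>e. \<exists>y. P y e)"
proof -
  obtain A p k where A: "arithmetical A"
      "\<And>e. P (e 0) (\<lambda>i. e (Suc i)) = sat M {} (penv k p e) A"
    using assms unfolding definable_def by blast
  \<comment> \<open>The additional parameter slot \<open>k\<close> is a dummy whose value is overwritten by the quantifier.\<close>
  have "((penv (Suc k) p e)(k := y)) i = penv k p (case_nat y e) i" for e y i
    by (cases i k rule: linorder_cases) (auto simp: penv_def dest!: less_imp_Suc_add)
  then have "(penv (Suc k) p e)(k := y) = penv k p (case_nat y e)" for e y
    by blast
  moreover have "P y e = sat M {} (penv k p (case_nat y e)) A" for y e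
    using A(2)[of "case_nat y e"] by simp
  ultimately have "arithmetical (Exists k A) \<and> (\<forall>e. (\<exists>y. P y e) = sat M {} (penv (Suc k) p e) (Exists k A))"
    using A(1) by simp
  then show ?thesis unfolding definable_def by blast
qed

lemma definable_and:
  assumes "definable M P" "definable M Q" shows "definable M (\<lambda>e. P e \<and> Q e)"
  using definable_not[OF definable_or[OF definable_not[OF assms(1)] definable_not[OF assms(2)]]]
  by simp

lemma definable_imp:
  assumes "definable M P" "definable M Q" shows "definable M (\<lambda>e. P e \<longrightarrow> Q e)"
  using definable_or[OF definable_not[OF assms(1)] assms(2)] by simp

lemma definable_iff:
  assumes "definable M P" "definable M Q" shows "definable M (\<lambda>e. P e \<longleftrightarrow> Q e)"
  using definable_and[OF definable_imp[OF assms] definable_imp[OF assms(2,1)]]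
  by (simp add: iff_conv_conj_imp)

lemma definable_all:
  assumes "definable M (\<lambda>e. P (e 0) (\<lambda>i. e (Suc i)))" shows "definable M (\<lambda>e. \<forall>y. P y e)"
  using definable_not[OF definable_ex[OF definable_not[OF assms]]] by simp

lemmas definable_fn_intros = definable_fn_var definable_fn_sc definable_fn_add
  definable_fn_mul definable_fn_const
lemmas definable_intros = definable_ex definable_all definable_and definable_or definable_imp
  definable_iff definable_not definable_eq

lemma definable_subst:
  assumes "definable M (\<lambda>e. P (e 0))" "definable_fn M f"
  shows "definable M (\<lambda>e. P (f e))"
proof -
  have "definable M (\<lambda>e. \<exists>y. y = f e \<and> P y)"
    using assms definable_fn_shift[OF assms(2)]
    by (intro definable_ex definable_and definable_eq definable_fn_var)
  then show ?thesis by simp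
qed

section \<open>Algebra in a model of Peano arithmetic\<close>

lemma sat_And [simp]: "sat M T e (And A B) \<longleftrightarrow> sat M T e A \<and> sat M T e B"
  by (simp add: And_def)

lemma sat_Imp [simp]: "sat M T e (Imp A B) \<longleftrightarrow> (sat M T e A \<longrightarrow> sat M T e B)"
  by (simp add: Imp_def)

lemma sat_Iff [simp]: "sat M T e (Iff A B) \<longleftrightarrow> (sat M T e A \<longleftrightarrow> sat M T e B)"
  by (auto simp add: Iff_def)

lemma sat_Forall [simp]: "sat M T e (Forall i A) \<longleftrightarrow> (\<forall>x. sat M T (e(i := x)) A)"
  by (simp add: Forall_def)

lemma eval_subst: "eval M e (subst_tm v r t) = eval M (e(v := eval M e r)) t"
  by (induction t) auto

lemma sat_subst:
  assumes "tvars r \<subseteq> {v}"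
  shows "sat M T e (subst_fm v r A) = sat M T (e(v := eval M e r)) A"
proof (induction A arbitrary: e)
  case (Exists i A)
  have "eval M (e(i := x)) r = eval M e r" if "i \<noteq> v" for x
    using that assms by (intro eval_cong) auto
  then have "sat M T (e(i := x)) (subst_fm v r A) = sat M T (e(v := eval M e r, i := x)) A"
    if "i \<noteq> v" for x
    using that by (metis Exists fun_upd_twist)
  then show ?case
    by (cases "i = v") (simp_all only: subst_fm.simps sat.simps if_True if_False fun_upd_upd, simp_all)
qed (auto simp: eval_subst)

lemma sat_ind_axiom:
  "sat M T e (ind_axiom v A) \<longleftrightarrow>
    (sat M T (e(v := zer M)) A \<longrightarrow>
     (\<forall>x. sat M T (e(v := x)) A \<longrightarrow> sat M T (e(v := sc M x)) A) \<longrightarrow>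
     (\<forall>x. sat M T (e(v := x)) A))"
  by (auto simp: ind_axiom_def sat_subst)

locale pa_model =
  fixes M :: "'a arith"
  assumes pa: "models M {} PA"
begin

abbreviation zero_m ("\<zero>") where "\<zero> \<equiv> zer M"
abbreviation suc_m ("\<S>") where "\<S> \<equiv> sc M"
abbreviation add_m (infixl "\<oplus>" 65) where "x \<oplus> y \<equiv> add M x y"
abbreviation mul_m (infixl "\<otimes>" 70) where "x \<otimes> y \<equiv> mul M x y"
abbreviation one_m ("\<one>") where "\<one> \<equiv> \<S> \<zero>"

lemma robinson_axiom: "A \<in> robinson \<Longrightarrow> sat M {} e A"
  using pa by (auto simp: models_def PA_def)

lemma suc_not_zero [simp]: "\<S> x \<noteq> \<zero>" "\<zero> \<noteq> \<S> x"
  using robinson_axiom[of "Neg (Eq (Sc (Var 0)) Zer)" "\<lambda>_. x"] by (auto simp: robinson_def)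

lemma suc_inject [simp]: "\<S> x = \<S> y \<longleftrightarrow> x = y"
  using robinson_axiom[of "Imp (Eq (Sc (Var 0)) (Sc (Var 1))) (Eq (Var 0) (Var 1))" "(\<lambda>_. y)(0 := x)"]
  by (auto simp: robinson_def)

lemma add_zero_right [simp]: "x \<oplus> \<zero> = x"
  using robinson_axiom[of "Eq (Add (Var 0) Zer) (Var 0)" "\<lambda>_. x"] by (auto simp: robinson_def)

lemma add_suc_right [simp]: "x \<oplus> \<S> y = \<S> (x \<oplus> y)"
  using robinson_axiom[of "Eq (Add (Var 0) (Sc (Var 1))) (Sc (Add (Var 0) (Var 1)))" "(\<lambda>_. y)(0 := x)"]
  by (auto simp: robinson_def)

lemma mul_zero_right [simp]: "x \<otimes> \<zero> = \<zero>"
  using robinson_axiom[of "Eq (Mul (Var 0) Zer) Zer" "\<lambda>_. x"] by (auto simp: robinson_def)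

lemma mul_suc_right [simp]: "x \<otimes> \<S> y = x \<otimes> y \<oplus> x"
  using robinson_axiom[of "Eq (Mul (Var 0) (Sc (Var 1))) (Add (Mul (Var 0) (Var 1)) (Var 0))" "(\<lambda>_. y)(0 := x)"]
  by (auto simp: robinson_def)

text \<open>The induction scheme in its semantic form. Every later induction inside the model goes through
  this lemma, with definability discharged by the introduction rules.\<close>

lemma pa_induct:
  assumes "definable M (\<lambda>e. P (e 0))" "P \<zero>" "\<And>x. P x \<Longrightarrow> P (\<S> x)"
  shows "P x"
proof -
  obtain A p k where A: "arithmetical A" and P: "\<And>e. P (e 0) = sat M {} (penv k p e) A"
    using assms(1) unfolding definable_def by blast
  define e0 where "e0 = penv k p (\<lambda>_. \<zero>)"
  have "e0(k := x) = penv k p ((\<lambda>_. \<zero>)(0 := x))" for x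
    by (auto simp: e0_def penv_def fun_eq_iff)
  then have P': "P x = sat M {} (e0(k := x)) A" for x
    using P[of "(\<lambda>_. \<zero>)(0 := x)"] by simp
  have "ind_axiom k A \<in> PA" using A by (auto simp: PA_def)
  then have "sat M {} e0 (ind_axiom k A)" using pa by (auto simp: models_def)
  then show ?thesis using assms(2,3) unfolding sat_ind_axiom P'[symmetric] by blast
qed

lemma add_zero_left [simp]: "\<zero> \<oplus> x = x"
proof (rule pa_induct[of "\<lambda>x. \<zero> \<oplus> x = x"])
  show "definable M (\<lambda>e. \<zero> \<oplus> e 0 = e 0)" by (intro definable_intros definable_fn_intros)
qed auto

lemma add_suc_left [simp]: "\<S> x \<oplus> y = \<S> (x \<oplus> y)"
proof (rule pa_induct[of "\<lambda>y. \<S> x \<oplus> y = \<S> (x \<oplus> y)"])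
  show "definable M (\<lambda>e. \<S> x \<oplus> e 0 = \<S> (x \<oplus> e 0))" by (intro definable_intros definable_fn_intros)
qed auto

lemma add_commute: "x \<oplus> y = y \<oplus> x"
proof (rule pa_induct[of "\<lambda>y. x \<oplus> y = y \<oplus> x"])
  show "definable M (\<lambda>e. x \<oplus> e 0 = e 0 \<oplus> x)" by (intro definable_intros definable_fn_intros)
qed auto

lemma add_assoc: "x \<oplus> y \<oplus> z = x \<oplus> (y \<oplus> z)"
proof (rule pa_induct[of "\<lambda>z. x \<oplus> y \<oplus> z = x \<oplus> (y \<oplus> z)"])
  show "definable M (\<lambda>e. x \<oplus> y \<oplus> e 0 = x \<oplus> (y \<oplus> e 0))" by (intro definable_intros definable_fn_intros)
qed auto

lemma mul_zero_left [simp]: "\<zero> \<otimes> x = \<zero>"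
proof (rule pa_induct[of "\<lambda>x. \<zero> \<otimes> x = \<zero>"])
  show "definable M (\<lambda>e. \<zero> \<otimes> e 0 = \<zero>)" by (intro definable_intros definable_fn_intros)
qed auto

lemma mul_suc_left [simp]: "\<S> x \<otimes> y = x \<otimes> y \<oplus> y"
proof (rule pa_induct[of "\<lambda>y. \<S> x \<otimes> y = x \<otimes> y \<oplus> y"])
  show "definable M (\<lambda>e. \<S> x \<otimes> e 0 = x \<otimes> e 0 \<oplus> e 0)" by (intro definable_intros definable_fn_intros)
  show "\<S> x \<otimes> \<S> y = x \<otimes> \<S> y \<oplus> \<S> y" if "\<S> x \<otimes> y = x \<otimes> y \<oplus> y" for y
    using that by simp (metis add_assoc add_commute)
qed auto

lemma mul_commute: "x \<otimes> y = y \<otimes> x"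
proof (rule pa_induct[of "\<lambda>y. x \<otimes> y = y \<otimes> x"])
  show "definable M (\<lambda>e. x \<otimes> e 0 = e 0 \<otimes> x)" by (intro definable_intros definable_fn_intros)
qed auto

lemma distrib_left: "x \<otimes> (y \<oplus> z) = x \<otimes> y \<oplus> x \<otimes> z"
proof (rule pa_induct[of "\<lambda>z. x \<otimes> (y \<oplus> z) = x \<otimes> y \<oplus> x \<otimes> z"])
  show "definable M (\<lambda>e. x \<otimes> (y \<oplus> e 0) = x \<otimes> y \<oplus> x \<otimes> e 0)"
    by (intro definable_intros definable_fn_intros)
qed (auto simp: add_assoc)

lemma mul_assoc: "x \<otimes> y \<otimes> z = x \<otimes> (y \<otimes> z)"
proof (rule pa_induct[of "\<lambda>z. x \<otimes> y \<otimes> z = x \<otimes> (y \<otimes> z)"])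
  show "definable M (\<lambda>e. x \<otimes> y \<otimes> e 0 = x \<otimes> (y \<otimes> e 0))"
    by (intro definable_intros definable_fn_intros)
qed (auto simp: distrib_left)

lemma add_cancel: "z \<oplus> x = z \<oplus> y \<Longrightarrow> x = y"
proof (rule pa_induct[of "\<lambda>z. z \<oplus> x = z \<oplus> y \<longrightarrow> x = y", THEN mp])
  show "definable M (\<lambda>e. e 0 \<oplus> x = e 0 \<oplus> y \<longrightarrow> x = y)"
    by (intro definable_intros definable_fn_intros)
qed auto

lemma zero_or_suc: "x = \<zero> \<or> (\<exists>y. x = \<S> y)"
proof (rule pa_induct[of "\<lambda>x. x = \<zero> \<or> (\<exists>y. x = \<S> y)"])
  show "definable M (\<lambda>e. e 0 = \<zero> \<or> (\<exists>y. e 0 = \<S> y))"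
    by (intro definable_intros definable_fn_intros)
qed auto

lemma add_eq_zero [simp]: "x \<oplus> y = \<zero> \<longleftrightarrow> x = \<zero> \<and> y = \<zero>"
  using zero_or_suc[of y] by auto

text \<open>Together with truncated subtraction the model is a \<open>linordered_semidom\<close>, which makes the library on
  ordered semirings available for the calculations with pairs and moduli.\<close>

definition le_m (infix "\<preceq>" 50) where "x \<preceq> y \<longleftrightarrow> (\<exists>z. y = x \<oplus> z)"
definition lt_m (infix "\<prec>" 50) where "x \<prec> y \<longleftrightarrow> (\<exists>z. y = x \<oplus> \<S> z)"
definition minus_m (infixl "\<ominus>" 65) where
  "x \<ominus> y = (if y \<preceq> x then (THE z. x = y \<oplus> z) else \<zero>)"

lemma minus_add [simp]: "(x \<oplus> y) \<ominus> x = y"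
  unfolding minus_m_def le_m_def by (auto intro!: the_equality dest: add_cancel)

lemma le_total: "x \<preceq> y \<or> y \<preceq> x"
proof (rule pa_induct[of "\<lambda>x. x \<preceq> y \<or> y \<preceq> x"])
  show "definable M (\<lambda>e. e 0 \<preceq> y \<or> y \<preceq> e 0)"
    unfolding le_m_def by (intro definable_intros definable_fn_intros)
  show "\<zero> \<preceq> y \<or> y \<preceq> \<zero>" by (auto simp: le_m_def)
  show "\<S> x \<preceq> y \<or> y \<preceq> \<S> x" if "x \<preceq> y \<or> y \<preceq> x" for x
    using that
  proof
    assume "x \<preceq> y"
    then obtain z where z: "y = x \<oplus> z" by (auto simp: le_m_def)
    show ?thesis
    proof (cases "z = \<zero>")
      case True
      then have "\<S> x = y \<oplus> \<one>" using z by simp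
      then show ?thesis unfolding le_m_def by blast
    next
      case False
      then obtain w where "z = \<S> w" using zero_or_suc by blast
      then have "y = \<S> x \<oplus> w" using z by simp
      then show ?thesis unfolding le_m_def by blast
    qed
  next
    assume "y \<preceq> x"
    then obtain z where "x = y \<oplus> z" by (auto simp: le_m_def)
    then have "\<S> x = y \<oplus> \<S> z" by simp
    then show ?thesis unfolding le_m_def by blast
  qed
qed

lemma mul_eq_zero: "x \<otimes> y = \<zero> \<Longrightarrow> x = \<zero> \<or> y = \<zero>"
  using zero_or_suc[of x] zero_or_suc[of y] by auto

lemma le_antisym: "x \<preceq> y \<Longrightarrow> y \<preceq> x \<Longrightarrow> x = y"
proof -
  assume "x \<preceq> y" "y \<preceq> x"
  then obtain z w where "y = x \<oplus> z" "x = y \<oplus> w" by (auto simp: le_m_def)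
  then have "x \<oplus> \<zero> = x \<oplus> (z \<oplus> w)" using add_assoc add_zero_right by metis
  then have "z \<oplus> w = \<zero>" using add_cancel by metis
  then show "x = y" using \<open>y = x \<oplus> z\<close> by simp
qed

lemma lt_iff: "x \<prec> y \<longleftrightarrow> x \<preceq> y \<and> x \<noteq> y"
proof
  assume "x \<prec> y"
  then obtain z where z: "y = x \<oplus> \<S> z" by (auto simp: lt_m_def)
  then have "x \<noteq> y" using add_cancel[of x \<zero> "\<S> z"] by fastforce
  then show "x \<preceq> y \<and> x \<noteq> y" using z unfolding le_m_def by blast
next
  assume "x \<preceq> y \<and> x \<noteq> y"
  then show "x \<prec> y" unfolding le_m_def lt_m_def using zero_or_suc add_zero_right by metis
qed

lemma le_trans_m: "x \<preceq> y \<Longrightarrow> y \<preceq> z \<Longrightarrow> x \<preceq> z"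
  unfolding le_m_def by (metis add_assoc)

lemma add_left_mono_m: "x \<preceq> y \<Longrightarrow> z \<oplus> x \<preceq> z \<oplus> y"
  unfolding le_m_def by (metis add_assoc)

sublocale m: linordered_semidom "(\<oplus>)" "(\<ominus>)" "(\<preceq>)" "(\<prec>)" \<zero> "(\<otimes>)" \<one>
proof unfold_locales
  show "a \<ominus> b \<ominus> c = a \<ominus> (b \<oplus> c)" for a b c
  proof (cases "b \<oplus> c \<preceq> a")
    case True
    then show ?thesis unfolding le_m_def by (metis add_assoc minus_add)
  next
    case False
    have "a \<ominus> (b \<oplus> c) = \<zero>" using False by (simp add: minus_m_def)
    moreover have "a \<ominus> b \<ominus> c = \<zero>"
    proof (cases "b \<preceq> a")
      case True
      then obtain z where z: "a = b \<oplus> z" unfolding le_m_def by blast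
      then have "\<not> c \<preceq> z" using False by (auto simp: le_m_def add_assoc)
      then show ?thesis using z by (simp add: minus_m_def[of z])
    next
      case False
      then have "a \<ominus> b = \<zero>" by (simp add: minus_m_def)
      moreover have "\<zero> \<ominus> c = \<zero>"
      proof (cases "c = \<zero>")
        case True
        then show ?thesis using minus_add[of \<zero> \<zero>] by simp
      next
        case False
        then have "\<not> c \<preceq> \<zero>" by (metis le_m_def add_eq_zero)
        then show ?thesis by (simp add: minus_m_def)
      qed
      ultimately show ?thesis by simp
    qed
    ultimately show ?thesis by simp
  qed
  show "a \<otimes> (b \<ominus> c) = a \<otimes> b \<ominus> a \<otimes> c" for a b c
  proof (cases "c \<preceq> b")
    case True
    then show ?thesis unfolding le_m_def by (auto simp: distrib_left)
  next
    case False
    then obtain z where z: "c = b \<oplus> z" "z \<noteq> \<zero>"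
      using le_total unfolding le_m_def by (metis add_zero_right)
    have 1: "b \<ominus> c = \<zero>" using False by (simp add: minus_m_def)
    have "a \<otimes> b \<ominus> (a \<otimes> b \<oplus> a \<otimes> z) = \<zero>"
    proof (cases "a \<otimes> z = \<zero>")
      case True
      then show ?thesis using minus_add[of "a \<otimes> b" \<zero>] by simp
    next
      case nz: False
      have "\<not> a \<otimes> b \<oplus> a \<otimes> z \<preceq> a \<otimes> b"
      proof
        assume "a \<otimes> b \<oplus> a \<otimes> z \<preceq> a \<otimes> b"
        then obtain w where "a \<otimes> b \<oplus> \<zero> = a \<otimes> b \<oplus> (a \<otimes> z \<oplus> w)"
          unfolding le_m_def by (auto simp: add_assoc)
        then show False using add_cancel nz by (metis add_eq_zero)
      qed
      then show ?thesis by (simp add: minus_m_def)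
    qed
    then show ?thesis using 1 z by (simp add: distrib_left)
  qed
  show "a \<prec> b \<Longrightarrow> \<zero> \<prec> c \<Longrightarrow> c \<otimes> a \<prec> c \<otimes> b" for a b c
  proof -
    assume "a \<prec> b" "\<zero> \<prec> c"
    then obtain z w where "b = a \<oplus> \<S> z" "c = \<zero> \<oplus> \<S> w" unfolding lt_m_def by blast
    then have "c \<otimes> b = c \<otimes> a \<oplus> \<S> (c \<otimes> z \<oplus> w)"
      by (simp add: distrib_left add_assoc)
    then show ?thesis unfolding lt_m_def by blast
  qed
  show "a \<noteq> \<zero> \<Longrightarrow> b \<noteq> \<zero> \<Longrightarrow> a \<otimes> b \<noteq> \<zero>" for a b using mul_eq_zero by blast
  show "b \<preceq> a \<Longrightarrow> a \<ominus> b \<oplus> b = a" for a b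
    by (metis le_m_def minus_add add_commute)
  show "(x \<prec> y) = (x \<preceq> y \<and> \<not> y \<preceq> x)" for x y
    unfolding lt_iff using le_antisym le_total by blast
  show "x \<preceq> x" for x unfolding le_m_def by (metis add_zero_right)
  show "\<zero> \<prec> \<one>" unfolding lt_m_def by (metis add_zero_left)
  show "a \<oplus> b \<oplus> c = a \<oplus> (b \<oplus> c)" "a \<otimes> b \<otimes> c = a \<otimes> (b \<otimes> c)"
    "a \<oplus> b = b \<oplus> a" "a \<otimes> b = b \<otimes> a" for a b c
    using add_assoc mul_assoc add_commute mul_commute by auto
  show "a \<preceq> b \<Longrightarrow> c \<oplus> a \<preceq> c \<oplus> b" for a b c by (rule add_left_mono_m)
  show "(a \<oplus> b) \<otimes> c = a \<otimes> c \<oplus> b \<otimes> c" for a b c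
    using distrib_left mul_commute by metis
qed (auto simp: le_antisym le_total distrib_left intro: le_trans_m)

section \<open>Pairing and coded sets\<close>

lemma le_zero [simp]: "\<zero> \<preceq> x"
  by (auto simp: le_m_def)

lemma less_suc_self [simp]: "x \<prec> \<S> x"
  unfolding lt_m_def by (metis add_suc_right add_zero_right)

lemma less_suc_iff: "x \<prec> \<S> y \<longleftrightarrow> x \<preceq> y"
  unfolding lt_m_def le_m_def by auto

lemma suc_le_iff: "\<S> x \<preceq> y \<longleftrightarrow> x \<prec> y"
  unfolding lt_m_def le_m_def by auto

lemma le_add1 [simp]: "x \<preceq> x \<oplus> y" and le_add2 [simp]: "y \<preceq> x \<oplus> y"
  unfolding le_m_def using add_commute by blast+

definition pair :: "'a \<Rightarrow> 'a \<Rightarrow> 'a" where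
  "pair x y = (x \<oplus> y) \<otimes> (x \<oplus> y) \<oplus> x"

text \<open>The value of \<open>pair x y\<close> lies between the squares of \<open>x + y\<close> and \<open>x + y + 1\<close>, hence determines
  \<open>x + y\<close>, and then \<open>x\<close>.\<close>

lemma pair_less:
  assumes "x \<oplus> y \<prec> x' \<oplus> y'" shows "pair x y \<prec> pair x' y'"
proof -
  let ?s = "x \<oplus> y" and ?t = "x' \<oplus> y'"
  have "?s \<otimes> ?s \<oplus> x \<preceq> ?s \<otimes> ?s \<oplus> ?s" by (simp add: add_left_mono_m)
  also have "\<dots> \<prec> ?s \<otimes> ?s \<oplus> ?s \<oplus> \<S> ?s" unfolding lt_m_def by blast
  also have "\<dots> = \<S> ?s \<otimes> \<S> ?s" by simp
  also have "\<dots> \<preceq> ?t \<otimes> ?t" using assms by (intro m.mult_mono) (auto simp: suc_le_iff)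
  also have "\<dots> \<preceq> ?t \<otimes> ?t \<oplus> x'" by simp
  finally show ?thesis unfolding pair_def .
qed

lemma pair_inject [simp]: "pair x y = pair x' y' \<longleftrightarrow> x = x' \<and> y = y'"
proof
  assume eq: "pair x y = pair x' y'"
  then have s: "x \<oplus> y = x' \<oplus> y'"
    by (metis pair_less m.less_irrefl m.less_linear)
  then have "x = x'" using eq unfolding pair_def by simp
  then show "x = x' \<and> y = y'" using s by simp
qed simp

lemma le_pair1: "x \<preceq> pair x y"
  by (simp add: pair_def)

lemma le_square: "x \<preceq> x \<otimes> x"
  using zero_or_suc[of x] by (auto simp: suc_le_iff less_suc_iff)

lemma le_pair2: "y \<preceq> pair x y"
  unfolding pair_def by (meson le_add1 le_add2 le_square le_trans_m)

lemma less_pair2: "x \<noteq> \<zero> \<Longrightarrow> y \<prec> pair x y"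
proof -
  assume "x \<noteq> \<zero>"
  then obtain z where "x = \<S> z" using zero_or_suc by blast
  then have "(x \<oplus> y) \<otimes> (x \<oplus> y) \<prec> pair x y"
    unfolding pair_def lt_m_def by blast
  then show ?thesis by (meson le_add2 le_square le_trans_m m.le_less_trans)
qed

definition divs :: "'a \<Rightarrow> 'a \<Rightarrow> bool" where "divs d a \<longleftrightarrow> (\<exists>q. a = q \<otimes> d)"
definition modulus :: "'a \<Rightarrow> 'a \<Rightarrow> 'a" where "modulus b x = \<S> (\<S> x \<otimes> b)"
definition mem :: "'a \<Rightarrow> 'a \<Rightarrow> 'a \<Rightarrow> 'a \<Rightarrow> bool" where
  "mem a b c x \<longleftrightarrow> x \<prec> c \<and> divs (modulus b x) a"

lemma divs_diff: "divs d u \<Longrightarrow> divs d (u \<oplus> v) \<Longrightarrow> divs d v"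
proof -
  assume "divs d u" "divs d (u \<oplus> v)"
  then obtain q r where q: "u = q \<otimes> d" and r: "u \<oplus> v = r \<otimes> d" unfolding divs_def by blast
  from le_total[of q r] show ?thesis
  proof
    assume "q \<preceq> r"
    then obtain w where "r = q \<oplus> w" unfolding le_m_def by blast
    then have "u \<oplus> v = u \<oplus> w \<otimes> d" using q r by (simp add: m.distrib_right)
    then show ?thesis unfolding divs_def using add_cancel by blast
  next
    assume "r \<preceq> q"
    then obtain w where "q = r \<oplus> w" unfolding le_m_def by blast
    then have "u \<oplus> \<zero> = u \<oplus> (v \<oplus> w \<otimes> d)"
      using q r by (metis add_assoc add_zero_right m.distrib_right)
    then have "v = \<zero>" using add_cancel add_eq_zero by metis
    then show ?thesis unfolding divs_def by (metis mul_zero_left)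
  qed
qed

lemma divs_mult: "divs d a \<Longrightarrow> divs d (a \<otimes> x)" "divs d a \<Longrightarrow> divs d (x \<otimes> a)"
  unfolding divs_def by (metis mul_assoc mul_commute)+

lemma divs_self [simp]: "divs d d"
  unfolding divs_def by (metis m.mult_1_left)

text \<open>The modulus is congruent to 1 modulo \<open>b\<close>, so a factor \<open>b\<close> can be cancelled from what it divides.\<close>

lemma divs_modulus_mult_base:
  assumes "divs (modulus b y) (a \<otimes> b)" shows "divs (modulus b y) a"
proof (rule divs_diff)
  show "divs (modulus b y) (a \<otimes> b \<otimes> \<S> y)" using assms by (rule divs_mult)
  have "a \<otimes> b \<otimes> \<S> y \<oplus> a = a \<otimes> modulus b y"
    unfolding modulus_def by (metis mul_assoc mul_commute mul_suc_right)
  then show "divs (modulus b y) (a \<otimes> b \<otimes> \<S> y \<oplus> a)" unfolding divs_def by metis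
qed

text \<open>Goedel's moduli are pairwise coprime when their common base \<open>b\<close> is divisible by all differences
  of indices; the coprimality is used in the form that a modulus can be cancelled from a product
  that is divisible by another one.\<close>

lemma divs_modulus_cancel:
  assumes b: "\<And>z. z \<noteq> \<zero> \<Longrightarrow> z \<preceq> c \<Longrightarrow> divs z b"
    and "x \<preceq> c" "y \<preceq> c" "x \<noteq> y"
    and d: "divs (modulus b y) (a \<otimes> modulus b x)"
  shows "divs (modulus b y) a"
proof -
  let ?d = "modulus b y"
  have step: "divs ?d a" if w: "w \<noteq> \<zero>" "w \<preceq> c" and "divs ?d (a \<otimes> w \<otimes> b)" for w
  proof -
    have "divs ?d (a \<otimes> w)" using that(3) by (rule divs_modulus_mult_base)
    moreover obtain k where k: "b = k \<otimes> w" using b[OF w] unfolding divs_def by blast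
    ultimately have "divs ?d (a \<otimes> w \<otimes> k)" by (auto intro: divs_mult)
    then have "divs ?d (a \<otimes> b)" using k by (metis mul_assoc mul_commute)
    then show ?thesis by (rule divs_modulus_mult_base)
  qed
  \<comment> \<open>Two moduli differ by a multiple \<open>w b\<close>, where \<open>w\<close> is the distance of the indices and divides \<open>b\<close>.\<close>
  have modulus_add: "modulus b (u \<oplus> w) = modulus b u \<oplus> w \<otimes> b" for u w
    unfolding modulus_def
    by (metis add_commute add_suc_left add_suc_right m.distrib_right)
  from le_total[of x y] show ?thesis
  proof
    assume "x \<preceq> y"
    then obtain w where w: "y = x \<oplus> w" unfolding le_m_def by blast
    have "a \<otimes> modulus b y = a \<otimes> modulus b x \<oplus> a \<otimes> w \<otimes> b"
      using modulus_add[of x w] w by (simp add: distrib_left mul_assoc)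
    moreover have "divs ?d (a \<otimes> modulus b y)" by (simp add: divs_mult)
    ultimately have "divs ?d (a \<otimes> w \<otimes> b)" using d divs_diff by metis
    moreover have "w \<noteq> \<zero>" using w assms(4) by auto
    moreover have "w \<preceq> c" using w assms(2,3) le_add2 le_trans_m by blast
    ultimately show ?thesis by (intro step)
  next
    assume "y \<preceq> x"
    then obtain w where w: "x = y \<oplus> w" unfolding le_m_def by blast
    have "a \<otimes> modulus b x = a \<otimes> modulus b y \<oplus> a \<otimes> w \<otimes> b"
      using modulus_add[of y w] w by (simp add: distrib_left mul_assoc)
    moreover have "divs ?d (a \<otimes> modulus b y)" by (simp add: divs_mult)
    ultimately have "divs ?d (a \<otimes> w \<otimes> b)" using d divs_diff by metis
    moreover have "w \<noteq> \<zero>" using w assms(4) by auto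
    moreover have "w \<preceq> c" using w assms(2,3) le_add2 le_trans_m by blast
    ultimately show ?thesis by (intro step)
  qed
qed

lemma definable_fn_pair_m:
  "definable_fn M f \<Longrightarrow> definable_fn M g \<Longrightarrow> definable_fn M (\<lambda>e. pair (f e) (g e))"
  unfolding pair_def by (intro definable_fn_intros)

lemma definable_le: "definable_fn M f \<Longrightarrow> definable_fn M g \<Longrightarrow> definable M (\<lambda>e. f e \<preceq> g e)"
  unfolding le_m_def by (intro definable_ex definable_eq definable_fn_add definable_fn_var definable_fn_shift)

lemma definable_lt: "definable_fn M f \<Longrightarrow> definable_fn M g \<Longrightarrow> definable M (\<lambda>e. f e \<prec> g e)"
  unfolding lt_m_def
  by (intro definable_ex definable_eq definable_fn_add definable_fn_sc definable_fn_var definable_fn_shift)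

lemma definable_divs: "definable_fn M f \<Longrightarrow> definable_fn M g \<Longrightarrow> definable M (\<lambda>e. divs (f e) (g e))"
  unfolding divs_def
  by (intro definable_ex definable_eq definable_fn_mul definable_fn_var definable_fn_shift)

lemma definable_mem:
  "definable_fn M f \<Longrightarrow> definable_fn M g \<Longrightarrow> definable_fn M h \<Longrightarrow> definable_fn M k
    \<Longrightarrow> definable M (\<lambda>e. mem (f e) (g e) (h e) (k e))"
  unfolding mem_def modulus_def
  by (intro definable_and definable_lt definable_divs definable_fn_mul definable_fn_sc)

lemmas definable_rules = definable_ex definable_all definable_and definable_or
  definable_imp definable_iff definable_not definable_le definable_lt definable_divs definable_mem
  definable_eq definable_fn_pair_m definable_fn_var definable_fn_sc definable_fn_add
  definable_fn_mul definable_fn_const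

lemma strong_induct:
  assumes "definable M (\<lambda>e. P (e 0))" "\<And>x. (\<And>y. y \<prec> x \<Longrightarrow> P y) \<Longrightarrow> P x"
  shows "P x"
proof -
  have "\<forall>y. y \<prec> x \<longrightarrow> P y" for x
  proof (rule pa_induct[of "\<lambda>x. \<forall>y. y \<prec> x \<longrightarrow> P y"])
    show "definable M (\<lambda>e. \<forall>y. y \<prec> e 0 \<longrightarrow> P y)"
      by (intro definable_all definable_imp definable_lt definable_fn_var assms)
    show "\<forall>y. y \<prec> \<zero> \<longrightarrow> P y" by (auto simp: lt_m_def)
    show "\<forall>y. y \<prec> \<S> x \<longrightarrow> P y" if "\<forall>y. y \<prec> x \<longrightarrow> P y" for x
      using that assms(2) by (metis less_suc_iff m.le_less m.less_le_trans)
  qed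
  then show ?thesis using assms(2) by blast
qed

lemma common_multiple: "\<exists>b. b \<noteq> \<zero> \<and> (\<forall>z. z \<noteq> \<zero> \<and> z \<preceq> c \<longrightarrow> divs z b)"
proof (rule pa_induct[of "\<lambda>c. \<exists>b. b \<noteq> \<zero> \<and> (\<forall>z. z \<noteq> \<zero> \<and> z \<preceq> c \<longrightarrow> divs z b)"])
  show "definable M (\<lambda>e. \<exists>b. b \<noteq> \<zero> \<and> (\<forall>z. z \<noteq> \<zero> \<and> z \<preceq> e 0 \<longrightarrow> divs z b))"
    by (intro definable_rules)
  show "\<exists>b. b \<noteq> \<zero> \<and> (\<forall>z. z \<noteq> \<zero> \<and> z \<preceq> \<zero> \<longrightarrow> divs z b)"
    by (rule exI[of _ \<one>]) (metis le_antisym le_zero suc_not_zero(1))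
  fix c
  assume "\<exists>b. b \<noteq> \<zero> \<and> (\<forall>z. z \<noteq> \<zero> \<and> z \<preceq> c \<longrightarrow> divs z b)"
  then obtain b where b: "b \<noteq> \<zero>" "\<forall>z. z \<noteq> \<zero> \<and> z \<preceq> c \<longrightarrow> divs z b" by blast
  have "divs z (b \<otimes> \<S> c)" if "z \<noteq> \<zero>" "z \<preceq> \<S> c" for z
    using that b divs_mult divs_self by (metis less_suc_iff m.le_less)
  moreover have "b \<otimes> \<S> c \<noteq> \<zero>" using b(1) mul_eq_zero suc_not_zero by metis
  ultimately show "\<exists>b. b \<noteq> \<zero> \<and> (\<forall>z. z \<noteq> \<zero> \<and> z \<preceq> \<S> c \<longrightarrow> divs z b)" by blast
qed

text \<open>The product of the moduli of the elements of the set codes it, because a modulus divides the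
  product only if it is one of the factors.\<close>

lemma bounded_definable_coded:
  assumes "definable M (\<lambda>e. X (e 0))"
  shows "\<exists>a b. \<forall>x. mem a b c x \<longleftrightarrow> x \<prec> c \<and> X x"
proof -
  obtain b where b: "b \<noteq> \<zero>" "\<And>z. z \<noteq> \<zero> \<Longrightarrow> z \<preceq> c \<Longrightarrow> divs z b"
    using common_multiple by blast
  have not_unit: "\<not> divs (modulus b x) \<one>" for x
  proof
    assume "divs (modulus b x) \<one>"
    then obtain q where q: "\<one> = q \<otimes> modulus b x" unfolding divs_def by blast
    obtain w where "\<S> x \<otimes> b = \<S> w" using b(1) mul_eq_zero zero_or_suc suc_not_zero by metis
    then have "\<one> = q \<otimes> \<S> (\<S> w)" using q unfolding modulus_def by simp
    then show False using zero_or_suc[of q] by auto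
  qed
  have "\<exists>a. \<forall>x. x \<prec> c \<longrightarrow> (divs (modulus b x) a \<longleftrightarrow> X x \<and> x \<prec> n)" if "n \<preceq> c" for n
    using that
  proof (rule pa_induct[of "\<lambda>n. n \<preceq> c \<longrightarrow>
        (\<exists>a. \<forall>x. x \<prec> c \<longrightarrow> (divs (modulus b x) a \<longleftrightarrow> X x \<and> x \<prec> n))", THEN mp, rotated 3])
    show "definable M (\<lambda>e. e 0 \<preceq> c \<longrightarrow>
        (\<exists>a. \<forall>x. x \<prec> c \<longrightarrow> (divs (modulus b x) a \<longleftrightarrow> X x \<and> x \<prec> e 0)))"
      unfolding modulus_def by (intro definable_rules assms)
    show "\<zero> \<preceq> c \<longrightarrow> (\<exists>a. \<forall>x. x \<prec> c \<longrightarrow> (divs (modulus b x) a \<longleftrightarrow> X x \<and> x \<prec> \<zero>))"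
      using not_unit by (intro impI exI[of _ \<one>]) (auto simp: lt_m_def)
    fix n
    assume IH: "n \<preceq> c \<longrightarrow> (\<exists>a. \<forall>x. x \<prec> c \<longrightarrow> (divs (modulus b x) a \<longleftrightarrow> X x \<and> x \<prec> n))"
    show "\<S> n \<preceq> c \<longrightarrow> (\<exists>a. \<forall>x. x \<prec> c \<longrightarrow> (divs (modulus b x) a \<longleftrightarrow> X x \<and> x \<prec> \<S> n))"
    proof
      assume "\<S> n \<preceq> c"
      then have n: "n \<prec> c" by (simp add: suc_le_iff)
      then obtain a where a: "\<And>x. x \<prec> c \<Longrightarrow> divs (modulus b x) a \<longleftrightarrow> X x \<and> x \<prec> n"
        using IH by (meson m.less_imp_le)
      show "\<exists>a. \<forall>x. x \<prec> c \<longrightarrow> (divs (modulus b x) a \<longleftrightarrow> X x \<and> x \<prec> \<S> n)"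
      proof (cases "X n")
        case True
        have "divs (modulus b x) (a \<otimes> modulus b n) \<longleftrightarrow> X x \<and> x \<prec> \<S> n" if x: "x \<prec> c" for x
        proof (cases "x = n")
          case True
          then show ?thesis using \<open>X n\<close> by (simp add: divs_mult)
        next
          case False
          have "divs (modulus b x) a" if "divs (modulus b x) (a \<otimes> modulus b n)"
            using divs_modulus_cancel[of c b n x a] b(2) n x False that m.less_imp_le by metis
          then have "divs (modulus b x) (a \<otimes> modulus b n) \<longleftrightarrow> divs (modulus b x) a"
            by (auto intro: divs_mult)
          then show ?thesis using a[OF x] False by (auto simp: less_suc_iff m.le_less)
        qed
        then show ?thesis by blast
      next
        case False
        then have "X x \<and> x \<prec> n \<longleftrightarrow> X x \<and> x \<prec> \<S> n" for x
          by (auto simp: less_suc_iff m.le_less)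
        then show ?thesis using a by blast
      qed
    qed
  qed
  then obtain a where "\<forall>x. x \<prec> c \<longrightarrow> (divs (modulus b x) a \<longleftrightarrow> X x \<and> x \<prec> c)" by blast
  then show ?thesis unfolding mem_def by blast
qed

section \<open>Inductive definitions inside the model\<close>

definition derivable :: "(('a \<Rightarrow> bool) \<Rightarrow> 'a \<Rightarrow> bool) \<Rightarrow> 'a \<Rightarrow> bool" where
  "derivable \<Phi> x \<longleftrightarrow> (\<exists>a b c. mem a b c x \<and> (\<forall>y. mem a b c y \<longrightarrow> \<Phi> (mem a b c) y))"

text \<open>The clauses of the arithmetized definitions are monotone and use at most two premises, so that
  uniting two coded derivations is enough to apply a clause.\<close>

definition binary :: "(('a \<Rightarrow> bool) \<Rightarrow> bool) \<Rightarrow> bool" where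
  "binary Q \<longleftrightarrow> (\<forall>X. Q X \<longrightarrow> (\<exists>s t. \<forall>Y. (X s \<longrightarrow> Y s) \<longrightarrow> (X t \<longrightarrow> Y t) \<longrightarrow> Q Y))"

lemma binaryE:
  assumes "binary Q" "Q X"
  obtains s t where "\<And>Y. (X s \<longrightarrow> Y s) \<Longrightarrow> (X t \<longrightarrow> Y t) \<Longrightarrow> Q Y"
proof -
  have "\<exists>s t. \<forall>Y. (X s \<longrightarrow> Y s) \<longrightarrow> (X t \<longrightarrow> Y t) \<longrightarrow> Q Y"
    using assms(1) unfolding binary_def by (rule allE, elim impE) (rule assms(2))
  then show thesis
  proof (elim exE)
    fix s t assume "\<forall>Y. (X s \<longrightarrow> Y s) \<longrightarrow> (X t \<longrightarrow> Y t) \<longrightarrow> Q Y"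
    then have "Q Y" if "X s \<longrightarrow> Y s" "X t \<longrightarrow> Y t" for Y
      by (rule allE[of _ Y]) (use that in simp)
    then show thesis by (rule that)
  qed
qed

lemma binaryI: "(\<And>X. Q X \<Longrightarrow> \<exists>s t. \<forall>Y. (X s \<longrightarrow> Y s) \<longrightarrow> (X t \<longrightarrow> Y t) \<longrightarrow> Q Y) \<Longrightarrow> binary Q"
  unfolding binary_def by simp

lemma binary_or:
  assumes "binary P" "binary Q" shows "binary (\<lambda>X. P X \<or> Q X)"
proof (rule binaryI)
  fix X assume "P X \<or> Q X"
  then show "\<exists>s t. \<forall>Y. (X s \<longrightarrow> Y s) \<longrightarrow> (X t \<longrightarrow> Y t) \<longrightarrow> P Y \<or> Q Y"
    using binaryE[OF assms(1), of X] binaryE[OF assms(2), of X] by metis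
qed

lemma binary_ex:
  assumes "\<And>s. binary (Q s)" shows "binary (\<lambda>X. \<exists>s. Q s X)"
proof (rule binaryI)
  fix X assume "\<exists>s. Q s X"
  then obtain u where "Q u X" by blast
  then show "\<exists>s t. \<forall>Y. (X s \<longrightarrow> Y s) \<longrightarrow> (X t \<longrightarrow> Y t) \<longrightarrow> (\<exists>s. Q s Y)"
    using binaryE[OF assms, of u X] by metis
qed

lemma binary_and:
  assumes "binary Q" shows "binary (\<lambda>X. Q X \<and> B)" "binary (\<lambda>X. B \<and> Q X)"
proof -
  have "\<exists>s t. \<forall>Y. (X s \<longrightarrow> Y s) \<longrightarrow> (X t \<longrightarrow> Y t) \<longrightarrow> Q Y \<and> B" if "Q X" B for X
    using binaryE[OF assms that(1)] that(2) by metis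
  then show "binary (\<lambda>X. Q X \<and> B)" "binary (\<lambda>X. B \<and> Q X)"
    by (simp_all add: binary_def conj_commute)
qed

lemma binary_two: "binary (\<lambda>X. X s \<and> X t \<and> B)" "binary (\<lambda>X. (X s \<or> X t) \<and> B)"
  unfolding binary_def by auto

lemma binary_one: "binary (\<lambda>X. X s)" "binary (\<lambda>X. B)"
  unfolding binary_def by auto

lemmas binary_intros = binary_one(2) binary_two binary_or binary_ex binary_and binary_one

lemma binary_mono: "binary Q \<Longrightarrow> Q X \<Longrightarrow> (\<And>x. X x \<Longrightarrow> Y x) \<Longrightarrow> Q Y"
  by (metis binaryE)

lemma derivable_unfold:
  assumes "\<And>y. binary (\<lambda>X. \<Phi> X y)" "derivable \<Phi> x" shows "\<Phi> (derivable \<Phi>) x"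
proof -
  obtain a b c where "mem a b c x" "\<forall>y. mem a b c y \<longrightarrow> \<Phi> (mem a b c) y"
    using assms(2) unfolding derivable_def by blast
  then have "\<Phi> (mem a b c) x" "\<And>z. mem a b c z \<Longrightarrow> derivable \<Phi> z"
    unfolding derivable_def by blast+
  then show ?thesis using binary_mono[OF assms(1)] by blast
qed

lemma derivable_fold:
  assumes bin: "\<And>y. binary (\<lambda>X. \<Phi> X y)" and "\<Phi> (derivable \<Phi>) x" shows "derivable \<Phi> x"
proof -
  obtain s t where st: "\<And>Y. (derivable \<Phi> s \<longrightarrow> Y s) \<Longrightarrow> (derivable \<Phi> t \<longrightarrow> Y t) \<Longrightarrow> \<Phi> Y x"
  proof (rule binaryE[OF bin assms(2)])
    fix s t
    assume "\<And>Y. (derivable \<Phi> s \<longrightarrow> Y s) \<Longrightarrow> (derivable \<Phi> t \<longrightarrow> Y t) \<Longrightarrow> \<Phi> Y x"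
    then show thesis by (rule that)
  qed
  have coded: "\<exists>a b c. (derivable \<Phi> s \<longrightarrow> mem a b c s) \<and> (\<forall>y. mem a b c y \<longrightarrow> \<Phi> (mem a b c) y)" for s
  proof (cases "derivable \<Phi> s")
    case True
    then show ?thesis unfolding derivable_def by blast
  next
    case False
    have "\<not> mem \<zero> \<zero> \<zero> y" for y by (auto simp: mem_def lt_m_def)
    then show ?thesis using False by blast
  qed
  obtain a1 b1 c1 where s: "derivable \<Phi> s \<Longrightarrow> mem a1 b1 c1 s"
      "\<And>y. mem a1 b1 c1 y \<Longrightarrow> \<Phi> (mem a1 b1 c1) y" using coded[of s] by blast
  obtain a2 b2 c2 where t: "derivable \<Phi> t \<Longrightarrow> mem a2 b2 c2 t"
      "\<And>y. mem a2 b2 c2 y \<Longrightarrow> \<Phi> (mem a2 b2 c2) y" using coded[of t] by blast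
  let ?X = "\<lambda>y. mem a1 b1 c1 y \<or> mem a2 b2 c2 y \<or> y = x"
  let ?c = "c1 \<oplus> c2 \<oplus> \<S> x"
  have "definable M (\<lambda>e. ?X (e 0))" by (intro definable_rules)
  then obtain a b where ab: "\<And>y. mem a b ?c y \<longleftrightarrow> y \<prec> ?c \<and> ?X y"
    using bounded_definable_coded[of ?X ?c] by auto
  have "y \<prec> ?c" if "?X y" for y
    using that
  proof (elim disjE)
    assume "mem a1 b1 c1 y"
    then have "y \<prec> c1" by (simp add: mem_def)
    then show ?thesis by (metis le_add1 add_assoc m.less_le_trans)
  next
    assume "mem a2 b2 c2 y"
    then have "y \<prec> c2" by (simp add: mem_def)
    then show ?thesis by (metis le_add1 le_add2 le_trans_m m.less_le_trans)
  next
    assume "y = x"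
    then show ?thesis by (metis le_add2 less_suc_self m.less_le_trans)
  qed
  then have eq: "mem a b ?c y \<longleftrightarrow> ?X y" for y using ab by blast
  have "\<Phi> (mem a b ?c) y" if "mem a b ?c y" for y
  proof -
    have "?X y" using that eq by blast
    then show ?thesis
    proof (elim disjE)
      assume "mem a1 b1 c1 y"
      then show ?thesis using s(2) binary_mono[OF bin] eq by blast
    next
      assume "mem a2 b2 c2 y"
      then show ?thesis using t(2) binary_mono[OF bin] eq by blast
    next
      assume "y = x"
      moreover have "\<Phi> (mem a b ?c) x" using s(1) t(1) eq by (intro st) blast+
      ultimately show ?thesis by simp
    qed
  qed
  then show ?thesis unfolding derivable_def using eq by blast
qed

text \<open>With coded sets available for all bounded definable sets, the arithmetized inductive definitions
  are fixed points of their clauses. A derivation of the premises is turned into one of the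
  conclusion by coding the union and adding the conclusion.\<close>

lemma derivable_iff:
  "(\<And>y. binary (\<lambda>X. \<Phi> X y)) \<Longrightarrow> derivable \<Phi> x \<longleftrightarrow> \<Phi> (derivable \<Phi>) x"
  using derivable_fold derivable_unfold by blast

section \<open>Arithmetized syntax inside the model\<close>

text \<open>The codes are kept as abbreviations for pairs with a standard tag, so that their freeness follows
  from injectivity of \<open>pair\<close> and of \<open>num\<close> by rewriting alone.\<close>

primrec num :: "nat \<Rightarrow> 'a" where
  "num 0 = \<zero>"
| "num (Suc k) = \<S> (num k)"

declare num.simps [simp del] numl.simps [simp del]

lemma num_eq [simp]: "num j = num k \<longleftrightarrow> j = k"
proof (induction j arbitrary: k)
  case 0 then show ?case by (cases k) (auto simp: num.simps)
next
  case (Suc j) then show ?case by (cases k) (auto simp: num.simps)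
qed

lemma num_eq_zero [simp]: "num k = \<zero> \<longleftrightarrow> k = 0"
  by (cases k) (auto simp: num.simps)

abbreviation "czer \<equiv> pair (num 0) (num 0)"
abbreviation "cvar i \<equiv> pair (num (Suc 0)) i"
abbreviation "csc s \<equiv> pair (num 2) s"
abbreviation "cadd s t \<equiv> pair (num 3) (pair s t)"
abbreviation "cmul s t \<equiv> pair (num 4) (pair s t)"
abbreviation "ceq s t \<equiv> pair (num 5) (pair s t)"
abbreviation "cneg p \<equiv> pair (num 6) p"
abbreviation "cor p q \<equiv> pair (num 7) (pair p q)"
abbreviation "cex v p \<equiv> pair (num 8) (pair v p)"

definition is_var :: "'a \<Rightarrow> bool" where "is_var v \<longleftrightarrow> (\<exists>i. v = cvar i)"

definition term_step :: "('a \<Rightarrow> bool) \<Rightarrow> 'a \<Rightarrow> bool" where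
  "term_step D y \<longleftrightarrow> y = czer \<or> is_var y \<or> (\<exists>s. D s \<and> y = csc s) \<or>
    (\<exists>s t. D s \<and> D t \<and> (y = cadd s t \<or> y = cmul s t))"

definition closed_step :: "('a \<Rightarrow> bool) \<Rightarrow> 'a \<Rightarrow> bool" where
  "closed_step D y \<longleftrightarrow> y = czer \<or> (\<exists>s. D s \<and> y = csc s) \<or>
    (\<exists>s t. D s \<and> D t \<and> (y = cadd s t \<or> y = cmul s t))"

definition "is_term = derivable term_step"
definition "is_closed = derivable closed_step"

definition formula_step :: "('a \<Rightarrow> bool) \<Rightarrow> 'a \<Rightarrow> bool" where
  "formula_step D y \<longleftrightarrow> (\<exists>s t. is_term s \<and> is_term t \<and> y = ceq s t) \<or>
    (\<exists>p. D p \<and> y = cneg p) \<or> (\<exists>p q. D p \<and> D q \<and> y = cor p q) \<or>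
    (\<exists>v p. is_var v \<and> D p \<and> y = cex v p)"

definition "is_formula = derivable formula_step"

definition occurs_step :: "'a \<Rightarrow> ('a \<Rightarrow> bool) \<Rightarrow> 'a \<Rightarrow> bool" where
  "occurs_step v D y \<longleftrightarrow> y = v \<or> (\<exists>s. D s \<and> y = csc s) \<or>
    (\<exists>s t. (D s \<or> D t) \<and> (y = cadd s t \<or> y = cmul s t))"

definition "occurs_in v = derivable (occurs_step v)"

definition free_step :: "'a \<Rightarrow> ('a \<Rightarrow> bool) \<Rightarrow> 'a \<Rightarrow> bool" where
  "free_step v D y \<longleftrightarrow> (\<exists>s t. (occurs_in v s \<or> occurs_in v t) \<and> y = ceq s t) \<or>
    (\<exists>p. D p \<and> y = cneg p) \<or> (\<exists>p q. (D p \<or> D q) \<and> y = cor p q) \<or>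
    (\<exists>w p. w \<noteq> v \<and> D p \<and> y = cex w p)"

definition "free_in v = derivable (free_step v)"

definition is_sentence :: "'a \<Rightarrow> bool" where
  "is_sentence p \<longleftrightarrow> is_formula p \<and> (\<forall>w. is_var w \<longrightarrow> \<not> free_in w p)"

definition is_formula1 :: "'a \<Rightarrow> 'a \<Rightarrow> bool" where
  "is_formula1 v p \<longleftrightarrow> is_var v \<and> is_formula p \<and> (\<forall>w. is_var w \<and> free_in w p \<longrightarrow> w = v)"

definition value_step :: "('a \<Rightarrow> bool) \<Rightarrow> 'a \<Rightarrow> bool" where
  "value_step D y \<longleftrightarrow> y = pair czer \<zero> \<or>
    (\<exists>s a. D (pair s a) \<and> y = pair (csc s) (\<S> a)) \<or>
    (\<exists>s a r b. D (pair s a) \<and> D (pair r b) \<and>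
      (y = pair (cadd s r) (a \<oplus> b) \<or> y = pair (cmul s r) (a \<otimes> b)))"

definition "has_value t x = derivable value_step (pair t x)"

definition numeral_step :: "('a \<Rightarrow> bool) \<Rightarrow> 'a \<Rightarrow> bool" where
  "numeral_step D y \<longleftrightarrow> y = pair \<zero> czer \<or>
    (\<exists>a s. D (pair a s) \<and> y = pair (\<S> a) (csc s))"

definition "is_numeral x t = derivable numeral_step (pair x t)"

definition subst_term_step :: "'a \<Rightarrow> 'a \<Rightarrow> ('a \<Rightarrow> bool) \<Rightarrow> 'a \<Rightarrow> bool" where
  "subst_term_step v r D y \<longleftrightarrow> y = pair czer czer \<or> y = pair v r \<or>
    (\<exists>w. is_var w \<and> w \<noteq> v \<and> y = pair w w) \<or>
    (\<exists>s s'. D (pair s s') \<and> y = pair (csc s) (csc s')) \<or>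
    (\<exists>s s' u u'. D (pair s s') \<and> D (pair u u') \<and>
      (y = pair (cadd s u) (cadd s' u') \<or> y = pair (cmul s u) (cmul s' u')))"

definition "subst_term v r t t' = derivable (subst_term_step v r) (pair t t')"

definition subst_formula_step :: "'a \<Rightarrow> 'a \<Rightarrow> ('a \<Rightarrow> bool) \<Rightarrow> 'a \<Rightarrow> bool" where
  "subst_formula_step v r D y \<longleftrightarrow>
    (\<exists>s s' t t'. subst_term v r s s' \<and> subst_term v r t t' \<and> y = pair (ceq s t) (ceq s' t')) \<or>
    (\<exists>q q'. D (pair q q') \<and> y = pair (cneg q) (cneg q')) \<or>
    (\<exists>q q' u u'. D (pair q q') \<and> D (pair u u') \<and> y = pair (cor q u) (cor q' u')) \<or>
    (\<exists>w q q'. is_var w \<and> w \<noteq> v \<and> D (pair q q') \<and> y = pair (cex w q) (cex w q')) \<or>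
    (\<exists>q. is_formula q \<and> y = pair (cex v q) (cex v q))"

definition "subst_formula v r p p' = derivable (subst_formula_step v r) (pair p p')"

subsection \<open>The arithmetized notions express these predicates\<close>

lemma eval_numl [simp]: "eval M e (numl k) = num k"
  by (induction k) (auto simp: num.simps numl.simps)

lemma eval_pr [simp]: "eval M e (pr s t) = pair (eval M e s) (eval M e t)"
  by (simp add: pr_def pair_def)

text \<open>The side condition under which a formula written with managed bound variables does not capture
  the variables of its arguments.\<close>

definition below :: "tm \<Rightarrow> nat \<Rightarrow> bool" where "below t n \<longleftrightarrow> tvars t \<subseteq> {..<n}"

lemma below_simps [simp]:
  "below Zer n" "below (Var i) n \<longleftrightarrow> i < n" "below (Sc t) n \<longleftrightarrow> below t n"
  "below (Add s t) n \<longleftrightarrow> below s n \<and> below t n" "below (Mul s t) n \<longleftrightarrow> below s n \<and> below t n"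
  "below (pr s t) n \<longleftrightarrow> below s n \<and> below t n" "below (numl k) n"
proof -
  show "below (numl k) n" by (induction k) (auto simp: below_def numl.simps)
qed (auto simp: below_def pr_def)

lemma below_Suc [simp]: "below t n \<Longrightarrow> below t (Suc n)"
  by (auto simp: below_def)

lemma eval_upd_fresh [simp]: "below t n \<Longrightarrow> eval M (e(n := x)) t = eval M e t"
  by (rule eval_cong) (auto simp: below_def)

lemmas code_term_defs = cZer_def cVar_def cSc_def cAdd_def cMul_def cEq_def cNeg_def cOr_def cEx_def
lemmas s_defs = s_eq_def s_tr_def s_not_def s_and_def s_or_def s_imp_def s_iff_def s_ex_def s_all_def

lemma sat_Mem [simp]:
  "below a n \<Longrightarrow> below b n \<Longrightarrow> below c n \<Longrightarrow> below x n \<Longrightarrow>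
    sat M T e (Mem a b c x n) \<longleftrightarrow> mem (eval M e a) (eval M e b) (eval M e c) (eval M e x)"
proof -
  have "(\<exists>z. \<S> (x \<oplus> z) = y) \<longleftrightarrow> x \<prec> y" for x y by (auto simp: lt_m_def)
  then show "below a n \<Longrightarrow> below b n \<Longrightarrow> below c n \<Longrightarrow> below x n \<Longrightarrow> ?thesis"
    by (simp add: Mem_def Lt_def s_defs mem_def divs_def modulus_def)
qed

lemma sat_IsVar [simp]: "below v n \<Longrightarrow> sat M T e (IsVar v n) \<longleftrightarrow> is_var (eval M e v)"
  by (simp add: IsVar_def s_defs code_term_defs is_var_def)

lemma sat_IsTerm [simp]: "below t n \<Longrightarrow> sat M T e (IsTerm t n) \<longleftrightarrow> is_term (eval M e t)"
  by (simp add: IsTerm_def Derivable_def is_term_def derivable_def term_step_def s_defs code_term_defs)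

lemma sat_IsClosedTerm [simp]: "below t n \<Longrightarrow> sat M T e (IsClosedTerm t n) \<longleftrightarrow> is_closed (eval M e t)"
  by (simp add: IsClosedTerm_def Derivable_def is_closed_def derivable_def closed_step_def s_defs code_term_defs)

lemma sat_IsFormula [simp]: "below t n \<Longrightarrow> sat M T e (IsFormula t n) \<longleftrightarrow> is_formula (eval M e t)"
  by (simp add: IsFormula_def Derivable_def is_formula_def derivable_def formula_step_def s_defs code_term_defs)

lemma sat_OccursIn [simp]:
  "below v n \<Longrightarrow> below t n \<Longrightarrow> sat M T e (OccursIn v t n) \<longleftrightarrow> occurs_in (eval M e v) (eval M e t)"
  by (simp add: OccursIn_def Derivable_def occurs_in_def derivable_def occurs_step_def s_defs code_term_defs)

lemma sat_FreeIn [simp]: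
  "below v n \<Longrightarrow> below t n \<Longrightarrow> sat M T e (FreeIn v t n) \<longleftrightarrow> free_in (eval M e v) (eval M e t)"
  by (simp add: FreeIn_def Derivable_def free_in_def derivable_def free_step_def s_defs code_term_defs)

lemma sat_IsSentence [simp]: "below p n \<Longrightarrow> sat M T e (IsSentence p n) \<longleftrightarrow> is_sentence (eval M e p)"
  by (simp add: IsSentence_def is_sentence_def s_defs)

lemma sat_IsFormula1 [simp]:
  "below v n \<Longrightarrow> below p n \<Longrightarrow> sat M T e (IsFormula1 v p n) \<longleftrightarrow> is_formula1 (eval M e v) (eval M e p)"
  by (simp add: IsFormula1_def is_formula1_def s_defs)

lemma sat_Value [simp]:
  "below t n \<Longrightarrow> below x n \<Longrightarrow> sat M T e (Value t x n) \<longleftrightarrow> has_value (eval M e t) (eval M e x)"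
  by (simp add: Value_def Derivable_def has_value_def derivable_def value_step_def s_defs code_term_defs)

lemma sat_Numeral [simp]:
  "below x n \<Longrightarrow> below t n \<Longrightarrow> sat M T e (Numeral x t n) \<longleftrightarrow> is_numeral (eval M e x) (eval M e t)"
  by (simp add: Numeral_def Derivable_def is_numeral_def derivable_def numeral_step_def s_defs code_term_defs)

lemma sat_SubstTerm [simp]:
  "below v n \<Longrightarrow> below r n \<Longrightarrow> below p n \<Longrightarrow> below q n \<Longrightarrow> sat M T e (SubstTerm v r p q n) \<longleftrightarrow>
    subst_term (eval M e v) (eval M e r) (eval M e p) (eval M e q)"
  by (simp add: SubstTerm_def Derivable_def subst_term_def derivable_def subst_term_step_def s_defs code_term_defs)

lemma sat_SubstFormula [simp]:
  "below v n \<Longrightarrow> below r n \<Longrightarrow> below p n \<Longrightarrow> below q n \<Longrightarrow> sat M T e (SubstFormula v r p q n) \<longleftrightarrow>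
    subst_formula (eval M e v) (eval M e r) (eval M e p) (eval M e q)"
  by (simp add: SubstFormula_def Derivable_def subst_formula_def derivable_def subst_formula_step_def s_defs code_term_defs)

subsection \<open>Clauses of the inductive definitions\<close>

lemma is_term_iff:
  "is_term y \<longleftrightarrow> y = czer \<or> is_var y \<or> (\<exists>s. is_term s \<and> y = csc s) \<or>
    (\<exists>s t. is_term s \<and> is_term t \<and> (y = cadd s t \<or> y = cmul s t))"
proof -
  have "binary (\<lambda>X. term_step X y)" for y
    unfolding term_step_def by (intro binary_intros)
  from derivable_iff[of "term_step" "y", OF this] show ?thesis by (simp add: is_term_def term_step_def)
qed

lemma is_closed_iff:
  "is_closed y \<longleftrightarrow> y = czer \<or> (\<exists>s. is_closed s \<and> y = csc s) \<or>
    (\<exists>s t. is_closed s \<and> is_closed t \<and> (y = cadd s t \<or> y = cmul s t))"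
proof -
  have "binary (\<lambda>X. closed_step X y)" for y
    unfolding closed_step_def by (intro binary_intros)
  from derivable_iff[of "closed_step" "y", OF this] show ?thesis by (simp add: is_closed_def closed_step_def)
qed

lemma is_formula_iff:
  "is_formula y \<longleftrightarrow> (\<exists>s t. is_term s \<and> is_term t \<and> y = ceq s t) \<or>
    (\<exists>p. is_formula p \<and> y = cneg p) \<or> (\<exists>p q. is_formula p \<and> is_formula q \<and> y = cor p q) \<or>
    (\<exists>v p. is_var v \<and> is_formula p \<and> y = cex v p)"
proof -
  have "binary (\<lambda>X. formula_step X y)" for y
    unfolding formula_step_def by (intro binary_intros)
  from derivable_iff[of "formula_step" "y", OF this] show ?thesis by (simp add: is_formula_def formula_step_def)
qed

lemma occurs_in_iff:
  "occurs_in v y \<longleftrightarrow> y = v \<or> (\<exists>s. occurs_in v s \<and> y = csc s) \<or>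
    (\<exists>s t. (occurs_in v s \<or> occurs_in v t) \<and> (y = cadd s t \<or> y = cmul s t))"
proof -
  have "binary (\<lambda>X. occurs_step v X y)" for y
    unfolding occurs_step_def by (intro binary_intros)
  from derivable_iff[of "occurs_step v" "y", OF this] show ?thesis by (simp add: occurs_in_def occurs_step_def)
qed

lemma free_in_iff:
  "free_in v y \<longleftrightarrow> (\<exists>s t. (occurs_in v s \<or> occurs_in v t) \<and> y = ceq s t) \<or>
    (\<exists>p. free_in v p \<and> y = cneg p) \<or> (\<exists>p q. (free_in v p \<or> free_in v q) \<and> y = cor p q) \<or>
    (\<exists>w p. w \<noteq> v \<and> free_in v p \<and> y = cex w p)"
proof -
  have "binary (\<lambda>X. free_step v X y)" for y
    unfolding free_step_def by (intro binary_intros)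
  from derivable_iff[of "free_step v" "y", OF this] show ?thesis by (simp add: free_in_def free_step_def)
qed

lemma has_value_iff:
  "has_value t x \<longleftrightarrow> t = czer \<and> x = \<zero> \<or> (\<exists>s a. has_value s a \<and> t = csc s \<and> x = \<S> a) \<or>
    (\<exists>s a r b. has_value s a \<and> has_value r b \<and>
      (t = cadd s r \<and> x = a \<oplus> b \<or> t = cmul s r \<and> x = a \<otimes> b))"
proof -
  have "binary (\<lambda>X. value_step X y)" for y
    unfolding value_step_def by (intro binary_intros)
  from derivable_iff[of "value_step" "pair t x", OF this] show ?thesis by (simp add: has_value_def value_step_def)
qed

lemma is_numeral_iff:
  "is_numeral x t \<longleftrightarrow> x = \<zero> \<and> t = czer \<or> (\<exists>a s. is_numeral a s \<and> x = \<S> a \<and> t = csc s)"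
proof -
  have "binary (\<lambda>X. numeral_step X y)" for y
    unfolding numeral_step_def by (intro binary_intros)
  from derivable_iff[of "numeral_step" "pair x t", OF this] show ?thesis by (simp add: is_numeral_def numeral_step_def)
qed

lemma subst_term_iff:
  "subst_term v r t t' \<longleftrightarrow> t = czer \<and> t' = czer \<or> t = v \<and> t' = r \<or>
    (is_var t \<and> t \<noteq> v \<and> t' = t) \<or>
    (\<exists>s s'. subst_term v r s s' \<and> t = csc s \<and> t' = csc s') \<or>
    (\<exists>s s' u u'. subst_term v r s s' \<and> subst_term v r u u' \<and>
      (t = cadd s u \<and> t' = cadd s' u' \<or> t = cmul s u \<and> t' = cmul s' u'))"
proof -
  have "binary (\<lambda>X. subst_term_step v r X y)" for y
    unfolding subst_term_step_def by (intro binary_intros)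
  from derivable_iff[of "subst_term_step v r" "pair t t'", OF this] show ?thesis by (auto simp: subst_term_def subst_term_step_def)
qed

lemma subst_formula_iff:
  "subst_formula v r p p' \<longleftrightarrow>
    (\<exists>s s' t t'. subst_term v r s s' \<and> subst_term v r t t' \<and> p = ceq s t \<and> p' = ceq s' t') \<or>
    (\<exists>q q'. subst_formula v r q q' \<and> p = cneg q \<and> p' = cneg q') \<or>
    (\<exists>q q' u u'. subst_formula v r q q' \<and> subst_formula v r u u' \<and> p = cor q u \<and> p' = cor q' u') \<or>
    (\<exists>w q q'. is_var w \<and> w \<noteq> v \<and> subst_formula v r q q' \<and> p = cex w q \<and> p' = cex w q') \<or>
    (\<exists>q. is_formula q \<and> p = cex v q \<and> p' = cex v q)"
proof -
  have "binary (\<lambda>X. subst_formula_step v r X y)" for y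
    unfolding subst_formula_step_def by (intro binary_intros)
  from derivable_iff[of "subst_formula_step v r" "pair p p'", OF this] show ?thesis by (simp add: subst_formula_def subst_formula_step_def)
qed

lemma is_var_cvar [simp]: "is_var (cvar i)"
  by (auto simp: is_var_def)

lemma not_is_var [simp]: "k \<noteq> Suc 0 \<Longrightarrow> \<not> is_var (pair (num k) x)"
  by (auto simp: is_var_def)

lemma is_closed_simps [simp]:
  "is_closed czer" "is_closed (csc s) \<longleftrightarrow> is_closed s"
  "is_closed (cadd s t) \<longleftrightarrow> is_closed s \<and> is_closed t"
  "is_closed (cmul s t) \<longleftrightarrow> is_closed s \<and> is_closed t"
  by (auto simp: is_closed_iff[of czer] is_closed_iff[of "csc s"] is_closed_iff[of "cadd s t"]
      is_closed_iff[of "cmul s t"])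

lemma is_term_simps [simp]:
  "is_term czer" "is_term (csc s) \<longleftrightarrow> is_term s" "is_term (cvar i)"
  "is_term (cadd s t) \<longleftrightarrow> is_term s \<and> is_term t"
  "is_term (cmul s t) \<longleftrightarrow> is_term s \<and> is_term t"
  by (auto simp: is_term_iff[of czer] is_term_iff[of "csc s"] is_term_iff[of "cadd s t"]
      is_term_iff[of "cmul s t"] is_term_iff[of "cvar i"])

lemma is_formula_simps [simp]:
  "is_formula (ceq s t) \<longleftrightarrow> is_term s \<and> is_term t"
  "is_formula (cneg p) \<longleftrightarrow> is_formula p"
  "is_formula (cor p q) \<longleftrightarrow> is_formula p \<and> is_formula q"
  "is_formula (cex v p) \<longleftrightarrow> is_var v \<and> is_formula p"
  by (auto simp: is_formula_iff[of "ceq s t"] is_formula_iff[of "cneg p"]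
      is_formula_iff[of "cor p q"] is_formula_iff[of "cex v p"])

lemma occurs_in_simps [simp]:
  "is_var v \<Longrightarrow> \<not> occurs_in v czer"
  "is_var v \<Longrightarrow> occurs_in v (cvar i) \<longleftrightarrow> v = cvar i"
  "is_var v \<Longrightarrow> occurs_in v (csc s) \<longleftrightarrow> occurs_in v s"
  "is_var v \<Longrightarrow> occurs_in v (cadd s t) \<longleftrightarrow> occurs_in v s \<or> occurs_in v t"
  "is_var v \<Longrightarrow> occurs_in v (cmul s t) \<longleftrightarrow> occurs_in v s \<or> occurs_in v t"
  by (auto simp: is_var_def occurs_in_iff[of v czer] occurs_in_iff[of v "csc s"]
      occurs_in_iff[of v "cadd s t"] occurs_in_iff[of v "cmul s t"]
      occurs_in_iff[of v "cvar i"])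

lemma free_in_simps [simp]:
  "free_in v (ceq s t) \<longleftrightarrow> occurs_in v s \<or> occurs_in v t"
  "free_in v (cneg p) \<longleftrightarrow> free_in v p"
  "free_in v (cor p q) \<longleftrightarrow> free_in v p \<or> free_in v q"
  "free_in v (cex w p) \<longleftrightarrow> w \<noteq> v \<and> free_in v p"
  by (auto simp: free_in_iff[of v "ceq s t"] free_in_iff[of v "cneg p"]
      free_in_iff[of v "cor p q"] free_in_iff[of v "cex w p"])

lemma has_value_simps [simp]:
  "has_value czer x \<longleftrightarrow> x = \<zero>"
  "has_value (csc s) x \<longleftrightarrow> (\<exists>a. has_value s a \<and> x = \<S> a)"
  "has_value (cadd s t) x \<longleftrightarrow> (\<exists>a b. has_value s a \<and> has_value t b \<and> x = a \<oplus> b)"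
  "has_value (cmul s t) x \<longleftrightarrow> (\<exists>a b. has_value s a \<and> has_value t b \<and> x = a \<otimes> b)"
  by (auto simp: has_value_iff[of czer] has_value_iff[of "csc s"] has_value_iff[of "cadd s t"]
      has_value_iff[of "cmul s t"])

lemma is_numeral_simps [simp]:
  "is_numeral \<zero> t \<longleftrightarrow> t = czer"
  "is_numeral (\<S> x) t \<longleftrightarrow> (\<exists>s. is_numeral x s \<and> t = csc s)"
  by (auto simp: is_numeral_iff[of \<zero>] is_numeral_iff[of "\<S> x"])

lemma subst_term_simps [simp]:
  "is_var v \<Longrightarrow> subst_term v r czer t' \<longleftrightarrow> t' = czer"
  "is_var v \<Longrightarrow> subst_term v r (cvar i) t' \<longleftrightarrow> t' = (if v = cvar i then r else cvar i)"
  "is_var v \<Longrightarrow> subst_term v r (csc s) t' \<longleftrightarrow> (\<exists>s'. subst_term v r s s' \<and> t' = csc s')"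
  "is_var v \<Longrightarrow> subst_term v r (cadd s u) t' \<longleftrightarrow>
    (\<exists>s' u'. subst_term v r s s' \<and> subst_term v r u u' \<and> t' = cadd s' u')"
  "is_var v \<Longrightarrow> subst_term v r (cmul s u) t' \<longleftrightarrow>
    (\<exists>s' u'. subst_term v r s s' \<and> subst_term v r u u' \<and> t' = cmul s' u')"
  by (auto simp: is_var_def subst_term_iff[of v r czer] subst_term_iff[of v r "cvar i"]
      subst_term_iff[of v r "csc s"] subst_term_iff[of v r "cadd s u"]
      subst_term_iff[of v r "cmul s u"])

lemma subst_formula_simps [simp]:
  "subst_formula v r (ceq s t) p' \<longleftrightarrow>
    (\<exists>s' t'. subst_term v r s s' \<and> subst_term v r t t' \<and> p' = ceq s' t')"
  "subst_formula v r (cneg q) p' \<longleftrightarrow> (\<exists>q'. subst_formula v r q q' \<and> p' = cneg q')"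
  "subst_formula v r (cor q u) p' \<longleftrightarrow>
    (\<exists>q' u'. subst_formula v r q q' \<and> subst_formula v r u u' \<and> p' = cor q' u')"
  by (auto simp: subst_formula_iff[of v r "ceq s t"] subst_formula_iff[of v r "cneg q"]
      subst_formula_iff[of v r "cor q u"])

lemma subst_formula_ex_bound [simp]:
  "subst_formula v r (cex v q) p' \<longleftrightarrow> is_formula q \<and> p' = cex v q"
  by (auto simp: subst_formula_iff[of v r "cex v q"])

lemma subst_formula_ex_other [simp]:
  "w \<noteq> v \<Longrightarrow> subst_formula v r (cex w q) p' \<longleftrightarrow> is_var w \<and> (\<exists>q'. subst_formula v r q q' \<and> p' = cex w q')"
  by (auto simp: subst_formula_iff[of v r "cex w q"])

text \<open>Components of codes are smaller than the codes. Hence structural induction on codes of terms and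
  formulae is an instance of strong induction in the model.\<close>

lemma code_less [simp]:
  "k \<noteq> 0 \<Longrightarrow> s \<prec> pair (num k) s"
  "k \<noteq> 0 \<Longrightarrow> s \<prec> pair (num k) (pair s t)"
  "k \<noteq> 0 \<Longrightarrow> t \<prec> pair (num k) (pair s t)"
  using less_pair2[of "num k"] m.le_less_trans[OF le_pair1 less_pair2[of "num k"]]
    m.le_less_trans[OF le_pair2 less_pair2[of "num k"]] by auto

subsection \<open>Definability of the arithmetized notions\<close>

text \<open>Quantify over the two arguments one after the other; the auxiliary function is shifted past the
  new variables.\<close>

lemma definable_subst2:
  assumes R: "definable M (\<lambda>e. R (e 0) (e (Suc 0)))" and f: "definable_fn M f" and g: "definable_fn M g"
  shows "definable M (\<lambda>e. R (f e) (g e))"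
proof -
  have "definable M (\<lambda>e. \<exists>y. y = f (\<lambda>i. e (Suc i)) \<and> R y (e 0))"
  proof (rule definable_ex)
    have "definable_fn M (\<lambda>e. f (\<lambda>i. e (Suc (Suc i))))"
      using definable_fn_shift[OF definable_fn_shift[OF f]] .
    then show "definable M (\<lambda>e. e 0 = f (\<lambda>i. e (Suc (Suc i))) \<and> R (e 0) (e (Suc 0)))"
      using R by (intro definable_and definable_eq definable_fn_var)
  qed
  then have 1: "definable M (\<lambda>e. R (f (\<lambda>i. e (Suc i))) (e 0))" by simp
  have "definable M (\<lambda>e. \<exists>y. y = g e \<and> R (f e) y)"
    using 1 definable_fn_shift[OF g] by (intro definable_ex definable_and definable_eq definable_fn_var)
  then show ?thesis by simp
qed

lemma definable_is_var: "definable_fn M f \<Longrightarrow> definable M (\<lambda>e. is_var (f e))"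
  by (rule definable_subst[of M is_var]) (unfold is_var_def, intro definable_rules)

lemma definable_is_term: "definable_fn M f \<Longrightarrow> definable M (\<lambda>e. is_term (f e))"
  by (rule definable_subst[of M is_term])
    (unfold is_term_def derivable_def term_step_def, intro definable_is_var definable_rules)

lemma definable_is_closed: "definable_fn M f \<Longrightarrow> definable M (\<lambda>e. is_closed (f e))"
  by (rule definable_subst[of M is_closed])
    (unfold is_closed_def derivable_def closed_step_def, intro definable_rules)

lemma definable_is_formula: "definable_fn M f \<Longrightarrow> definable M (\<lambda>e. is_formula (f e))"
  by (rule definable_subst[of M is_formula])
    (unfold is_formula_def derivable_def formula_step_def,
     intro definable_is_var definable_is_term definable_rules)

lemma definable_occurs_in:
  "definable_fn M f \<Longrightarrow> definable_fn M g \<Longrightarrow> definable M (\<lambda>e. occurs_in (f e) (g e))"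
  by (rule definable_subst2[of occurs_in])
    (unfold occurs_in_def derivable_def occurs_step_def, intro definable_rules)

lemma definable_free_in:
  "definable_fn M f \<Longrightarrow> definable_fn M g \<Longrightarrow> definable M (\<lambda>e. free_in (f e) (g e))"
  by (rule definable_subst2[of free_in])
    (unfold free_in_def derivable_def free_step_def, intro definable_occurs_in definable_rules)

lemma definable_has_value:
  "definable_fn M f \<Longrightarrow> definable_fn M g \<Longrightarrow> definable M (\<lambda>e. has_value (f e) (g e))"
  by (rule definable_subst2[of has_value])
    (unfold has_value_def derivable_def value_step_def, intro definable_rules)

lemma definable_is_numeral:
  "definable_fn M f \<Longrightarrow> definable_fn M g \<Longrightarrow> definable M (\<lambda>e. is_numeral (f e) (g e))"
  by (rule definable_subst2[of is_numeral])
    (unfold is_numeral_def derivable_def numeral_step_def, intro definable_rules)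

lemma definable_subst_term:
  "definable_fn M f \<Longrightarrow> definable_fn M g \<Longrightarrow> definable M (\<lambda>e. subst_term v r (f e) (g e))"
  by (rule definable_subst2[of "subst_term v r"])
    (unfold subst_term_def derivable_def subst_term_step_def, intro definable_is_var definable_rules)

lemma definable_subst_formula:
  "definable_fn M f \<Longrightarrow> definable_fn M g \<Longrightarrow> definable M (\<lambda>e. subst_formula v r (f e) (g e))"
  by (rule definable_subst2[of "subst_formula v r"])
    (unfold subst_formula_def derivable_def subst_formula_step_def,
     intro definable_is_var definable_subst_term definable_is_formula definable_rules)

lemmas definable_syntax = definable_is_var definable_is_term definable_is_closed definable_is_formula
  definable_occurs_in definable_free_in definable_has_value definable_is_numeral
  definable_subst_term definable_subst_formula definable_rules

subsection \<open>Closed terms, values and numerals\<close>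

lemma is_term_induct [consumes 1, case_names zer var sc add mul]:
  assumes "is_term t" and def: "definable M (\<lambda>e. P (e 0))"
    and "P czer" and "\<And>i. P (cvar i)"
    and "\<And>s. is_term s \<Longrightarrow> P s \<Longrightarrow> P (csc s)"
    and "\<And>s t. is_term s \<Longrightarrow> is_term t \<Longrightarrow> P s \<Longrightarrow> P t \<Longrightarrow> P (cadd s t)"
    and "\<And>s t. is_term s \<Longrightarrow> is_term t \<Longrightarrow> P s \<Longrightarrow> P t \<Longrightarrow> P (cmul s t)"
  shows "P t"
proof -
  have "is_term t \<longrightarrow> P t"
  proof (rule strong_induct[of "\<lambda>t. is_term t \<longrightarrow> P t"])
    show "definable M (\<lambda>e. is_term (e 0) \<longrightarrow> P (e 0))"
      by (intro definable_imp definable_is_term definable_fn_var def)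
    fix t assume IH: "\<And>s. s \<prec> t \<Longrightarrow> is_term s \<longrightarrow> P s"
    show "is_term t \<longrightarrow> P t"
      using IH assms(3-) is_term_iff[of t] by (auto simp: is_var_def)
  qed
  then show ?thesis using assms(1) by blast
qed

lemma is_closed_induct [consumes 1, case_names zer sc add mul]:
  assumes "is_closed t" and def: "definable M (\<lambda>e. P (e 0))"
    and "P czer"
    and "\<And>s. is_closed s \<Longrightarrow> P s \<Longrightarrow> P (csc s)"
    and "\<And>s t. is_closed s \<Longrightarrow> is_closed t \<Longrightarrow> P s \<Longrightarrow> P t \<Longrightarrow> P (cadd s t)"
    and "\<And>s t. is_closed s \<Longrightarrow> is_closed t \<Longrightarrow> P s \<Longrightarrow> P t \<Longrightarrow> P (cmul s t)"
  shows "P t"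
proof -
  have "is_closed t \<longrightarrow> P t"
  proof (rule strong_induct[of "\<lambda>t. is_closed t \<longrightarrow> P t"])
    show "definable M (\<lambda>e. is_closed (e 0) \<longrightarrow> P (e 0))"
      by (intro definable_imp definable_is_closed definable_fn_var def)
    fix t assume IH: "\<And>s. s \<prec> t \<Longrightarrow> is_closed s \<longrightarrow> P s"
    show "is_closed t \<longrightarrow> P t"
      using IH assms(3-) is_closed_iff[of t] by (auto simp: is_var_def)
  qed
  then show ?thesis using assms(1) by blast
qed

lemma is_formula_induct [consumes 1, case_names eq neg or ex]:
  assumes "is_formula p" and def: "definable M (\<lambda>e. P (e 0))"
    and "\<And>s t. is_term s \<Longrightarrow> is_term t \<Longrightarrow> P (ceq s t)"
    and "\<And>p. is_formula p \<Longrightarrow> P p \<Longrightarrow> P (cneg p)"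
    and "\<And>p q. is_formula p \<Longrightarrow> is_formula q \<Longrightarrow> P p \<Longrightarrow> P q \<Longrightarrow> P (cor p q)"
    and "\<And>v p. is_var v \<Longrightarrow> is_formula p \<Longrightarrow> P p \<Longrightarrow> P (cex v p)"
  shows "P p"
proof -
  have "is_formula p \<longrightarrow> P p"
  proof (rule strong_induct[of "\<lambda>p. is_formula p \<longrightarrow> P p"])
    show "definable M (\<lambda>e. is_formula (e 0) \<longrightarrow> P (e 0))"
      by (intro definable_imp definable_is_formula definable_fn_var def)
    fix t assume IH: "\<And>s. s \<prec> t \<Longrightarrow> is_formula s \<longrightarrow> P s"
    show "is_formula t \<longrightarrow> P t"
      using IH assms(3-) is_formula_iff[of t] by (auto simp: is_var_def)
  qed
  then show ?thesis using assms(1) by blast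
qed

lemma is_closed_is_term:
  assumes "is_closed t" shows "is_term t"
  using assms
proof (rule is_closed_induct[of t is_term])
  show "definable M (\<lambda>e. is_term (e 0))" by (intro definable_syntax)
qed auto

lemma is_closed_not_occurs:
  assumes "is_closed t" "is_var v" shows "\<not> occurs_in v t"
  using assms(1)
proof (rule is_closed_induct[of t "\<lambda>t. \<not> occurs_in v t"])
  show "definable M (\<lambda>e. \<not> occurs_in v (e 0))" by (intro definable_syntax)
qed (use assms(2) in auto)

lemma value_unique:
  assumes "is_closed t" "has_value t x" "has_value t y" shows "x = y"
proof -
  have "\<forall>x y. has_value t x \<and> has_value t y \<longrightarrow> x = y"
    using assms(1)
  proof (rule is_closed_induct[of t "\<lambda>t. \<forall>x y. has_value t x \<and> has_value t y \<longrightarrow> x = y"])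
    show "definable M (\<lambda>e. \<forall>x y. has_value (e 0) x \<and> has_value (e 0) y \<longrightarrow> x = y)"
      by (intro definable_syntax)
  qed (simp_all; metis)+
  then show ?thesis using assms by blast
qed

lemma numeral_exists: "\<exists>t. is_numeral x t"
proof (rule pa_induct[of "\<lambda>x. \<exists>t. is_numeral x t"])
  show "definable M (\<lambda>e. \<exists>t. is_numeral (e 0) t)" by (intro definable_syntax)
qed auto

lemma numeral_unique: "is_numeral x s \<Longrightarrow> is_numeral x t \<Longrightarrow> s = t"
proof -
  have "\<forall>s t. is_numeral x s \<and> is_numeral x t \<longrightarrow> s = t"
  proof (rule pa_induct[of "\<lambda>x. \<forall>s t. is_numeral x s \<and> is_numeral x t \<longrightarrow> s = t"])
    show "definable M (\<lambda>e. \<forall>s t. is_numeral (e 0) s \<and> is_numeral (e 0) t \<longrightarrow> s = t)"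
      by (intro definable_syntax)
  qed auto
  then show "is_numeral x s \<Longrightarrow> is_numeral x t \<Longrightarrow> s = t" by blast
qed

lemma numeral_closed_value: "is_numeral x t \<Longrightarrow> is_closed t \<and> has_value t x"
proof -
  have "\<forall>t. is_numeral x t \<longrightarrow> is_closed t \<and> has_value t x"
  proof (rule pa_induct[of "\<lambda>x. \<forall>t. is_numeral x t \<longrightarrow> is_closed t \<and> has_value t x"])
    show "definable M (\<lambda>e. \<forall>t. is_numeral (e 0) t \<longrightarrow> is_closed t \<and> has_value t (e 0))"
      by (intro definable_syntax)
  qed auto
  then show "is_numeral x t \<Longrightarrow> is_closed t \<and> has_value t x" by blast
qed

subsection \<open>Substitution\<close>

lemma subst_term_exists:
  assumes "is_var v" "is_term t" shows "\<exists>t'. subst_term v r t t'"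
  using assms(2)
proof (rule is_term_induct[of t "\<lambda>t. \<exists>t'. subst_term v r t t'"])
  show "definable M (\<lambda>e. \<exists>t'. subst_term v r (e 0) t')" by (intro definable_syntax)
qed (use assms(1) in auto)

lemma subst_term_unique:
  assumes "is_var v" "is_term t" "subst_term v r t s" "subst_term v r t s'" shows "s = s'"
proof -
  have "\<forall>s s'. subst_term v r t s \<and> subst_term v r t s' \<longrightarrow> s = s'"
    using assms(2)
  proof (rule is_term_induct[of t "\<lambda>t. \<forall>s s'. subst_term v r t s \<and> subst_term v r t s' \<longrightarrow> s = s'"])
    show "definable M (\<lambda>e. \<forall>s s'. subst_term v r (e 0) s \<and> subst_term v r (e 0) s' \<longrightarrow> s = s')"
      by (intro definable_syntax)
  qed (use assms(1) in auto)
  then show ?thesis using assms by blast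
qed

text \<open>Substituting a closed term removes the variable and creates no other one.\<close>

lemma subst_term_term:
  assumes "is_var v" "is_closed r" "is_term t" "subst_term v r t s"
  shows "is_term s \<and> (\<forall>w. is_var w \<and> occurs_in w s \<longrightarrow> w \<noteq> v \<and> occurs_in w t)"
proof -
  have "\<forall>s. subst_term v r t s \<longrightarrow> is_term s \<and> (is_var w \<and> occurs_in w s \<longrightarrow> w \<noteq> v \<and> occurs_in w t)" for w
    using assms(3)
  proof (rule is_term_induct[of t "\<lambda>t. \<forall>s. subst_term v r t s \<longrightarrow>
        is_term s \<and> (is_var w \<and> occurs_in w s \<longrightarrow> w \<noteq> v \<and> occurs_in w t)"])
    show "definable M (\<lambda>e. \<forall>s. subst_term v r (e 0) s \<longrightarrow>
        is_term s \<and> (is_var w \<and> occurs_in w s \<longrightarrow> w \<noteq> v \<and> occurs_in w (e 0)))"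
      by (intro definable_syntax)
  qed (use assms(1,2) is_closed_is_term is_closed_not_occurs in auto)
  then show ?thesis using assms(4) by blast
qed

lemma subst_term_id:
  assumes "is_var v" "is_term t" "\<not> occurs_in v t" shows "subst_term v r t t"
proof -
  have "\<not> occurs_in v t \<longrightarrow> subst_term v r t t"
    using assms(2)
  proof (rule is_term_induct[of t "\<lambda>t. \<not> occurs_in v t \<longrightarrow> subst_term v r t t"])
    show "definable M (\<lambda>e. \<not> occurs_in v (e 0) \<longrightarrow> subst_term v r (e 0) (e 0))"
      by (intro definable_syntax)
  qed (use assms(1) in auto)
  then show ?thesis using assms(3) by blast
qed

lemma subst_formula_exists:
  assumes v: "is_var v" and "is_formula p" shows "\<exists>q. subst_formula v r p q"
  using assms(2)
proof (rule is_formula_induct[of p "\<lambda>p. \<exists>q. subst_formula v r p q"])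
  show "definable M (\<lambda>e. \<exists>q. subst_formula v r (e 0) q)" by (intro definable_syntax)
  show "\<exists>q. subst_formula v r (ceq s t) q" if st: "is_term s" "is_term t" for s t
  proof -
    obtain s' t' where "subst_term v r s s'" "subst_term v r t t'"
      using subst_term_exists[OF v] st by blast
    then have "subst_formula v r (ceq s t) (ceq s' t')" by simp
    then show ?thesis by blast
  qed
  show "\<exists>q. subst_formula v r (cex w p) q" if "is_var w" "is_formula p" "\<exists>q. subst_formula v r p q" for w p
    using that by (cases "w = v") auto
qed auto

text \<open>A quantifier clause applies according to whether the bound variable is the substituted one, so
  the clauses exclude each other.\<close>

lemma subst_formula_unique:
  assumes v: "is_var v" and "is_formula p" "subst_formula v r p q" "subst_formula v r p q'"
  shows "q = q'"
proof -
  have "\<forall>q q'. subst_formula v r p q \<and> subst_formula v r p q' \<longrightarrow> q = q'"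
    using assms(2)
  proof (rule is_formula_induct[of p "\<lambda>p. \<forall>q q'. subst_formula v r p q \<and> subst_formula v r p q' \<longrightarrow> q = q'"])
    show "definable M (\<lambda>e. \<forall>q q'. subst_formula v r (e 0) q \<and> subst_formula v r (e 0) q' \<longrightarrow> q = q')"
      by (intro definable_syntax)
    show "\<forall>q q'. subst_formula v r (ceq s t) q \<and> subst_formula v r (ceq s t) q' \<longrightarrow> q = q'"
      if "is_term s" "is_term t" for s t
      using subst_term_unique[OF v that(1)] subst_term_unique[OF v that(2)] by (simp, blast)
    show "\<forall>q q'. subst_formula v r (cex w p) q \<and> subst_formula v r (cex w p) q' \<longrightarrow> q = q'"
      if "\<forall>q q'. subst_formula v r p q \<and> subst_formula v r p q' \<longrightarrow> q = q'" for w p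
      using that by (cases "w = v") auto
  qed auto
  then show ?thesis using assms by blast
qed

lemma subst_formula_formula:
  assumes v: "is_var v" and r: "is_closed r" and "is_formula p" "subst_formula v r p q"
  shows "is_formula q \<and> (\<forall>w. is_var w \<and> free_in w q \<longrightarrow> w \<noteq> v \<and> free_in w p)"
proof -
  have "\<forall>q. subst_formula v r p q \<longrightarrow> is_formula q \<and> (is_var w \<and> free_in w q \<longrightarrow> w \<noteq> v \<and> free_in w p)" for w
    using assms(3)
  proof (rule is_formula_induct[of p "\<lambda>p. \<forall>q. subst_formula v r p q \<longrightarrow>
        is_formula q \<and> (is_var w \<and> free_in w q \<longrightarrow> w \<noteq> v \<and> free_in w p)"])
    show "definable M (\<lambda>e. \<forall>q. subst_formula v r (e 0) q \<longrightarrow>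
        is_formula q \<and> (is_var w \<and> free_in w q \<longrightarrow> w \<noteq> v \<and> free_in w (e 0)))"
      by (intro definable_syntax)
    show "\<forall>q. subst_formula v r (ceq s t) q \<longrightarrow>
        is_formula q \<and> (is_var w \<and> free_in w q \<longrightarrow> w \<noteq> v \<and> free_in w (ceq s t))"
      if "is_term s" "is_term t" for s t
    proof (intro allI impI)
      fix q assume "subst_formula v r (ceq s t) q"
      then obtain s' t' where "subst_term v r s s'" "subst_term v r t t'" "q = ceq s' t'" by auto
      then show "is_formula q \<and> (is_var w \<and> free_in w q \<longrightarrow> w \<noteq> v \<and> free_in w (ceq s t))"
        using subst_term_term[OF v r that(1)] subst_term_term[OF v r that(2)] by auto
    qed
    show "\<forall>q. subst_formula v r (cex u p) q \<longrightarrow>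
        is_formula q \<and> (is_var w \<and> free_in w q \<longrightarrow> w \<noteq> v \<and> free_in w (cex u p))"
      if "is_var u" "is_formula p" "\<forall>q. subst_formula v r p q \<longrightarrow> is_formula q \<and>
        (is_var w \<and> free_in w q \<longrightarrow> w \<noteq> v \<and> free_in w p)" for u p
      using that by (cases "u = v") auto
  qed auto
  then show ?thesis using assms(4) by blast
qed

lemma subst_formula_id:
  assumes v: "is_var v" and "is_formula p" "\<not> free_in v p" shows "subst_formula v r p p"
proof -
  have "\<not> free_in v p \<longrightarrow> subst_formula v r p p"
    using assms(2)
  proof (rule is_formula_induct[of p "\<lambda>p. \<not> free_in v p \<longrightarrow> subst_formula v r p p"])
    show "definable M (\<lambda>e. \<not> free_in v (e 0) \<longrightarrow> subst_formula v r (e 0) (e 0))"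
      by (intro definable_syntax)
    show "\<not> free_in v (cex u p) \<longrightarrow> subst_formula v r (cex u p) (cex u p)"
      if "is_var u" "is_formula p" "\<not> free_in v p \<longrightarrow> subst_formula v r p p" for u p
      using that by (cases "u = v") auto
  qed (auto intro: subst_term_id[OF v])
  then show ?thesis using assms(3) by blast
qed

section \<open>Codes of standard formulae with parameters\<close>

text \<open>The codes of a standard term or formula in which each free variable \<open>i\<close> is replaced by the code
  \<open>\<sigma> i\<close>, as elements of the model.\<close>

primrec code_tm_m :: "(nat \<Rightarrow> 'a) \<Rightarrow> tm \<Rightarrow> 'a" where
  "code_tm_m \<sigma> Zer = czer"
| "code_tm_m \<sigma> (Var i) = \<sigma> i"
| "code_tm_m \<sigma> (Sc t) = csc (code_tm_m \<sigma> t)"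
| "code_tm_m \<sigma> (Add s t) = cadd (code_tm_m \<sigma> s) (code_tm_m \<sigma> t)"
| "code_tm_m \<sigma> (Mul s t) = cmul (code_tm_m \<sigma> s) (code_tm_m \<sigma> t)"

abbreviation "v0 \<equiv> cvar (num 0)"

text \<open>The formula \<open>\<exists>v. v = t \<and> p\<close>. It is a substitution of \<open>t\<close> for \<open>v\<close> in \<open>p\<close> that can be written down
  for open terms \<open>t\<close> without looking into \<open>p\<close>, which may have nonstandard length.\<close>

definition let_code :: "'a \<Rightarrow> 'a \<Rightarrow> 'a \<Rightarrow> 'a" where
  "let_code v t p = cex v (cneg (cor (cneg (ceq v t)) (cneg p)))"

text \<open>The truth predicate is replaced by the formula coded by \<open>h\<close>, whose free variable is \<open>v0\<close>. The codes
  \<open>vr i\<close> used for the variables are a parameter: with \<open>vr i\<close> the code of variable \<open>i\<close> this is the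
  usual coding, but if \<open>Tr\<close> occurs, \<open>vr\<close> has to avoid \<open>v0\<close> to exclude capture.\<close>

primrec code_fm_m :: "(nat \<Rightarrow> 'a) \<Rightarrow> 'a \<Rightarrow> (nat \<Rightarrow> 'a) \<Rightarrow> fm \<Rightarrow> 'a" where
  "code_fm_m vr h \<sigma> (Eq s t) = ceq (code_tm_m \<sigma> s) (code_tm_m \<sigma> t)"
| "code_fm_m vr h \<sigma> (Tr t) = let_code v0 (code_tm_m \<sigma> t) h"
| "code_fm_m vr h \<sigma> (Neg A) = cneg (code_fm_m vr h \<sigma> A)"
| "code_fm_m vr h \<sigma> (Or A B) = cor (code_fm_m vr h \<sigma> A) (code_fm_m vr h \<sigma> B)"
| "code_fm_m vr h \<sigma> (Exists i A) = cex (vr i) (code_fm_m vr h (\<sigma>(i := vr i)) A)"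

lemma code_tm_m_cong: "(\<And>i. i \<in> tvars t \<Longrightarrow> \<sigma> i = \<sigma>' i) \<Longrightarrow> code_tm_m \<sigma> t = code_tm_m \<sigma>' t"
  by (induction t) auto

lemma code_fm_m_cong: "(\<And>i. i \<in> fvars A \<Longrightarrow> \<sigma> i = \<sigma>' i) \<Longrightarrow> code_fm_m vr h \<sigma> A = code_fm_m vr h \<sigma>' A"
proof (induction A arbitrary: \<sigma> \<sigma>')
  case (Eq s t)
  have "code_tm_m \<sigma> s = code_tm_m \<sigma>' s" by (rule code_tm_m_cong) (use Eq.prems in auto)
  moreover have "code_tm_m \<sigma> t = code_tm_m \<sigma>' t" by (rule code_tm_m_cong) (use Eq.prems in auto)
  ultimately show ?case by simp
next
  case (Tr t)
  have "code_tm_m \<sigma> t = code_tm_m \<sigma>' t" by (rule code_tm_m_cong) (use Tr.prems in auto)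
  then show ?case by simp
next
  case (Exists i A)
  have "code_fm_m vr h (\<sigma>(i := vr i)) A = code_fm_m vr h (\<sigma>'(i := vr i)) A"
    by (rule Exists.IH) (use Exists.prems in auto)
  then show ?case by simp
next
  case (Or A B)
  have "code_fm_m vr h \<sigma> A = code_fm_m vr h \<sigma>' A" by (rule Or.IH) (use Or.prems in auto)
  moreover have "code_fm_m vr h \<sigma> B = code_fm_m vr h \<sigma>' B" by (rule Or.IH) (use Or.prems in auto)
  ultimately show ?case by simp
next
  case (Neg A)
  have "code_fm_m vr h \<sigma> A = code_fm_m vr h \<sigma>' A" by (rule Neg.IH) (use Neg.prems in auto)
  then show ?case by simp
qed

lemma eval_code_tm: "eval M e (code_tm \<sigma> t) = code_tm_m (\<lambda>i. eval M e (\<sigma> i)) t"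
  by (induction t) (auto simp: code_term_defs)

lemma eval_code_fm:
  "arithmetical A \<Longrightarrow>
    eval M e (code_fm \<sigma> A) = code_fm_m (\<lambda>i. cvar (num i)) h (\<lambda>i. eval M e (\<sigma> i)) A"
proof (induction A arbitrary: \<sigma>)
  case (Exists i A)
  have "(\<lambda>j. eval M e ((\<sigma>(i := cVar (numl i))) j)) = (\<lambda>j. eval M e (\<sigma> j))(i := cvar (num i))"
    by (auto simp: code_term_defs)
  then show ?case using Exists by (simp add: code_term_defs del: fun_upd_apply)
qed (auto simp: eval_code_tm code_term_defs)

lemma code_tm_closed_value:
  assumes "\<And>i. is_closed (\<sigma> i) \<and> has_value (\<sigma> i) (e i)"
  shows "is_closed (code_tm_m \<sigma> t) \<and> has_value (code_tm_m \<sigma> t) (eval M e t)"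
  by (induction t) (use assms in auto)

lemma code_tm_term: "(\<And>i. is_term (\<sigma> i)) \<Longrightarrow> is_term (code_tm_m \<sigma> t)"
  by (induction t) auto

lemma code_tm_occurs: "is_var w \<Longrightarrow> occurs_in w (code_tm_m \<sigma> t) \<Longrightarrow> \<exists>i. occurs_in w (\<sigma> i)"
  by (induction t) auto

lemma code_tm_subst:
  assumes "is_var v" "\<And>i. subst_term v r (\<sigma> i) (\<sigma>' i)"
  shows "subst_term v r (code_tm_m \<sigma> t) (code_tm_m \<sigma>' t)"
  by (induction t) (use assms in auto)

lemma is_var_is_term: "is_var v \<Longrightarrow> is_term v"
  by (auto simp: is_var_def)

lemma occurs_in_var: "is_var w \<Longrightarrow> is_var v \<Longrightarrow> occurs_in w v \<longleftrightarrow> w = v"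
  by (auto simp: is_var_def)

lemma subst_term_var: "is_var v \<Longrightarrow> is_var w \<Longrightarrow> subst_term v r w t' \<longleftrightarrow> t' = (if w = v then r else w)"
  by (auto simp: is_var_def)

lemma let_code_formula [simp]: "is_formula (let_code v t p) \<longleftrightarrow> is_var v \<and> is_term t \<and> is_formula p"
  by (auto simp: let_code_def is_var_is_term)

lemma free_in_let_code [simp]:
  "is_var v \<Longrightarrow> is_var w \<Longrightarrow> free_in w (let_code v t p) \<longleftrightarrow> w \<noteq> v \<and> (occurs_in w t \<or> free_in w p)"
  by (auto simp: let_code_def occurs_in_var)

lemma code_fm_formula:
  assumes "is_formula h" "\<And>i. is_var (vr i)" "\<And>i. is_term (\<sigma> i)"
  shows "is_formula (code_fm_m vr h \<sigma> A)"
  using assms(3)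
proof (induction A arbitrary: \<sigma>)
  case (Exists i A)
  have "is_formula (code_fm_m vr h (\<sigma>(i := vr i)) A)"
    by (rule Exists.IH) (use Exists.prems assms(2) is_var_is_term in auto)
  then show ?case using assms(2) by simp
qed (auto simp: code_tm_term assms)

lemma code_fm_free:
  assumes "is_formula1 v0 h" "\<And>i. is_var (vr i)" "is_var w" "free_in w (code_fm_m vr h \<sigma> A)"
  shows "\<exists>i. occurs_in w (\<sigma> i)"
  using assms(4)
proof (induction A arbitrary: \<sigma>)
  case (Exists i A)
  then have "w \<noteq> vr i" "free_in w (code_fm_m vr h (\<sigma>(i := vr i)) A)" by auto
  then obtain j where "occurs_in w ((\<sigma>(i := vr i)) j)" using Exists.IH by blast
  then show ?case using \<open>w \<noteq> vr i\<close> occurs_in_var[OF assms(3,2)]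
    by (auto split: if_splits)
next
  case (Tr t)
  then have "w \<noteq> v0 \<and> (occurs_in w (code_tm_m \<sigma> t) \<or> free_in w h)"
    using assms(3) by simp
  then show ?case using assms(1,3) code_tm_occurs unfolding is_formula1_def by blast
qed (use code_tm_occurs[OF assms(3)] in auto)

text \<open>On codes of standard formulae, substitution in the model is replacement of a value of \<open>\<sigma>\<close>. Where
  \<open>h\<close> occurs it is not affected, since its only free variable \<open>v0\<close> is not among the \<open>vr i\<close>.\<close>

lemma code_fm_subst:
  assumes h: "is_formula1 v0 h" and vr: "\<And>i. is_var (vr i)" "inj vr"
    and A: "arithmetical A \<or> (\<forall>i. vr i \<noteq> v0)"
    and \<sigma>: "\<And>j. is_term (\<sigma> j)" "\<And>j. j \<noteq> i \<Longrightarrow> subst_term (vr i) r (\<sigma> j) (\<sigma> j)"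
      "subst_term (vr i) r (\<sigma> i) r'"
  shows "subst_formula (vr i) r (code_fm_m vr h \<sigma> A) (code_fm_m vr h (\<sigma>(i := r')) A)"
  using A \<sigma>
proof (induction A arbitrary: \<sigma> r')
  case (Eq s t)
  have "subst_term (vr i) r (\<sigma> j) ((\<sigma>(i := r')) j)" for j using Eq.prems by simp
  then show ?case using code_tm_subst[OF vr(1), of i r \<sigma> "\<sigma>(i := r')"]
    by (simp del: fun_upd_apply)
next
  case (Tr t)
  have "subst_term (vr i) r (\<sigma> j) ((\<sigma>(i := r')) j)" for j using Tr.prems by simp
  then have t: "subst_term (vr i) r (code_tm_m \<sigma> t) (code_tm_m (\<sigma>(i := r')) t)"
    using code_tm_subst[OF vr(1)] by blast
  have ne: "v0 \<noteq> vr i" using Tr.prems(1) by auto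
  have "subst_formula (vr i) r h h"
  proof (rule subst_formula_id)
    show "\<not> free_in (vr i) h" using h vr(1) ne unfolding is_formula1_def by metis
  qed (use h vr(1) in \<open>auto simp: is_formula1_def\<close>)
  then show ?case using t ne vr(1) by (simp add: let_code_def subst_term_var del: fun_upd_apply)
next
  case (Neg A)
  then show ?case by simp
next
  case (Or A B)
  then show ?case
    using Or.IH(1)[of \<sigma> r', OF _ Or.prems(2-4)] Or.IH(2)[of \<sigma> r', OF _ Or.prems(2-4)] Or.prems(1)
    by (auto simp del: fun_upd_apply)
next
  case (Exists j A)
  show ?case
  proof (cases "j = i")
    case True
    have "is_formula (code_fm_m vr h (\<sigma>(i := vr i)) A)"
      using h vr(1) Exists.prems is_var_is_term by (intro code_fm_formula) (auto simp: is_formula1_def)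
    then show ?thesis using True by (simp del: fun_upd_apply)
  next
    case False
    then have ne: "vr j \<noteq> vr i" using vr(2) by (auto dest: injD)
    have "subst_formula (vr i) r (code_fm_m vr h (\<sigma>(j := vr j)) A) (code_fm_m vr h (\<sigma>(j := vr j, i := r')) A)"
    proof (rule Exists.IH)
      show "arithmetical A \<or> (\<forall>i. vr i \<noteq> v0)" using Exists.prems(1) by simp
      show "is_term ((\<sigma>(j := vr j)) k)" for k using Exists.prems vr is_var_is_term by simp
      show "subst_term (vr i) r ((\<sigma>(j := vr j)) k) ((\<sigma>(j := vr j)) k)" if "k \<noteq> i" for k
        using Exists.prems that ne vr(1) by (simp add: subst_term_var)
      show "subst_term (vr i) r ((\<sigma>(j := vr j)) i) r'" using False Exists.prems by simp
    qed
    then show ?thesis using ne vr(1) False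
      by (simp add: fun_upd_twist del: fun_upd_apply)
  qed
qed

definition denotes :: "(nat \<Rightarrow> 'a) \<Rightarrow> (nat \<Rightarrow> 'a) \<Rightarrow> bool" where
  "denotes \<sigma> e \<longleftrightarrow> (\<forall>i. is_closed (\<sigma> i) \<and> has_value (\<sigma> i) (e i))"

lemma denotes_exists: "\<exists>\<sigma>. denotes \<sigma> e"
proof -
  have "\<forall>i. \<exists>t. is_closed t \<and> has_value t (e i)"
    using numeral_exists numeral_closed_value by blast
  then show ?thesis unfolding denotes_def by (rule choice)
qed

lemma denotes_upd: "denotes \<sigma> e \<Longrightarrow> is_numeral x r \<Longrightarrow> denotes (\<sigma>(i := r)) (e(i := x))"
  using numeral_closed_value by (auto simp: denotes_def)

end

section \<open>Evaluation with truth value gaps and gluts\<close>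

text \<open>\<open>P\<close> is the extension and \<open>N\<close> the antiextension of the truth predicate, and \<open>b\<close> says whether the
  formula is to be verified or falsified. Both may happen, or neither, unless \<open>N\<close> is the complement
  of \<open>P\<close>.\<close>

fun psat :: "'a arith \<Rightarrow> 'a set \<Rightarrow> 'a set \<Rightarrow> bool \<Rightarrow> (nat \<Rightarrow> 'a) \<Rightarrow> fm \<Rightarrow> bool" where
  "psat M P N b e (Eq s t) = ((eval M e s = eval M e t) = b)"
| "psat M P N b e (Tr t) = (eval M e t \<in> (if b then P else N))"
| "psat M P N b e (Neg A) = psat M P N (\<not> b) e A"
| "psat M P N b e (Or A B) = (if b then psat M P N b e A \<or> psat M P N b e B
     else psat M P N b e A \<and> psat M P N b e B)"
| "psat M P N b e (Exists i A) = (if b then \<exists>x. psat M P N b (e(i := x)) A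
     else \<forall>x. psat M P N b (e(i := x)) A)"

lemma psat_classical: "N = - P \<Longrightarrow> psat M P N b e A \<longleftrightarrow> sat M P e A = b"
  by (induction A arbitrary: b e) auto

lemma psat_arithmetical: "arithmetical A \<Longrightarrow> psat M P N b e A \<longleftrightarrow> sat M {} e A = b"
  by (induction A arbitrary: b e) auto

section \<open>Truth of standard formulae\<close>

locale pt_model =
  fixes M :: "'a arith" and T :: "'a set"
  assumes pt: "models M T (PT_minus \<union> {Int_Ind})"
begin

sublocale pa_model M
proof
  have "sat M {} e A" if "A \<in> PA" for A e
  proof -
    have "arithmetical (subst_fm v r A) \<longleftrightarrow> arithmetical A" for v r A
      by (induction A) auto
    then have "arithmetical A" using that
      by (auto simp: PA_def robinson_def Imp_def ind_axiom_def And_def Forall_def)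
    moreover have "sat M T e A" using pt that by (auto simp: models_def PT_minus_def)
    ultimately show ?thesis using sat_arithmetical by blast
  qed
  then show "models M {} PA" by (simp add: models_def)
qed

lemma pt_axiom: "A \<in> {PT1a 0, PT1b 0, PT2a 0, PT2b 0, PT3a 0, PT3b 0, PT4 0, Int_Ind} \<Longrightarrow> sat M T e A"
  using pt by (auto simp: models_def PT_minus_def)

text \<open>The semantic counterparts of \<open>TNum\<close> and \<open>TNegNum\<close>.\<close>

definition true_at :: "'a \<Rightarrow> 'a \<Rightarrow> 'a \<Rightarrow> bool" where
  "true_at v p x \<longleftrightarrow> (\<exists>r q. is_numeral x r \<and> subst_formula v r p q \<and> q \<in> T)"

definition false_at :: "'a \<Rightarrow> 'a \<Rightarrow> 'a \<Rightarrow> bool" where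
  "false_at v p x \<longleftrightarrow> (\<exists>r q. is_numeral x r \<and> subst_formula v r p q \<and> cneg q \<in> T)"

lemma sat_TNum [simp]:
  "below v n \<Longrightarrow> below p n \<Longrightarrow> below x n \<Longrightarrow>
    sat M T e (TNum v p x n) \<longleftrightarrow> true_at (eval M e v) (eval M e p) (eval M e x)"
  by (simp add: TNum_def s_defs true_at_def)

lemma sat_TNegNum [simp]:
  "below v n \<Longrightarrow> below p n \<Longrightarrow> below x n \<Longrightarrow>
    sat M T e (TNegNum v p x n) \<longleftrightarrow> false_at (eval M e v) (eval M e p) (eval M e x)"
  by (simp add: TNegNum_def s_defs false_at_def code_term_defs)

lemma T_eq:
  assumes "is_closed s" "has_value s x" "is_closed t" "has_value t y"
  shows "ceq s t \<in> T \<longleftrightarrow> x = y" "cneg (ceq s t) \<in> T \<longleftrightarrow> x \<noteq> y"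
proof -
  have "ceq s t \<in> T \<longleftrightarrow> (\<exists>x y. has_value s x \<and> has_value t y \<and> x = y)"
    using pt_axiom[of "PT1a 0" "\<lambda>_. \<zero>"] assms(1,3)
    by (simp add: PT1a_def s_defs SameValue_def code_term_defs)
  then show "ceq s t \<in> T \<longleftrightarrow> x = y" using assms value_unique by metis
  have "cneg (ceq s t) \<in> T \<longleftrightarrow> (\<exists>x y. has_value s x \<and> has_value t y \<and> x \<noteq> y)"
    using pt_axiom[of "PT1b 0" "\<lambda>_. \<zero>"] assms(1,3)
    by (simp add: PT1b_def s_defs DifferentValue_def code_term_defs)
  then show "cneg (ceq s t) \<in> T \<longleftrightarrow> x \<noteq> y" using assms value_unique by metis
qed

lemma T_or:
  assumes "is_sentence p" "is_sentence q"
  shows "cor p q \<in> T \<longleftrightarrow> p \<in> T \<or> q \<in> T" "cneg (cor p q) \<in> T \<longleftrightarrow> cneg p \<in> T \<and> cneg q \<in> T"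
  using pt_axiom[of "PT2a 0" "\<lambda>_. \<zero>"] pt_axiom[of "PT2b 0" "\<lambda>_. \<zero>"] assms
  by (simp_all add: PT2a_def PT2b_def s_defs code_term_defs)

lemma T_neg_neg: "is_sentence p \<Longrightarrow> cneg (cneg p) \<in> T \<longleftrightarrow> p \<in> T"
  using pt_axiom[of "PT4 0" "\<lambda>_. \<zero>"] by (simp add: PT4_def s_defs code_term_defs)

lemma T_ex:
  assumes "is_formula1 v p"
  shows "cex v p \<in> T \<longleftrightarrow> (\<exists>x. true_at v p x)" "cneg (cex v p) \<in> T \<longleftrightarrow> (\<forall>x. false_at v p x)"
  using pt_axiom[of "PT3a 0" "\<lambda>_. \<zero>"] pt_axiom[of "PT3b 0" "\<lambda>_. \<zero>"] assms
  by (simp_all add: PT3a_def PT3b_def s_defs code_term_defs)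

lemma true_at_iff:
  assumes "is_formula1 v p" "is_numeral x r" "subst_formula v r p q"
  shows "true_at v p x \<longleftrightarrow> q \<in> T" "false_at v p x \<longleftrightarrow> cneg q \<in> T"
proof -
  have "r' = r" if "is_numeral x r'" for r' using numeral_unique that assms(2) by blast
  moreover have "q' = q" if "subst_formula v r p q'" for q'
    using subst_formula_unique that assms unfolding is_formula1_def by blast
  ultimately show "true_at v p x \<longleftrightarrow> q \<in> T" "false_at v p x \<longleftrightarrow> cneg q \<in> T"
    unfolding true_at_def false_at_def using assms(2,3) by metis+
qed

lemma internal_induction:
  assumes "is_formula1 v p" "true_at v p \<zero>" "\<And>x. true_at v p x \<Longrightarrow> true_at v p (\<S> x)"
  shows "true_at v p x"
proof -
  have "sat M T (\<lambda>_. \<zero>) Int_Ind \<longleftrightarrow> (\<forall>v p. is_formula1 v p \<longrightarrow>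
      (\<forall>x. true_at v p x \<longrightarrow> true_at v p (\<S> x)) \<longrightarrow> (\<exists>q. subst_formula v czer p q \<and> q \<in> T) \<longrightarrow>
      (\<forall>x. true_at v p x))"
    by (simp add: Int_Ind_def TSubst_def s_defs code_term_defs)
  moreover have "sat M T (\<lambda>_. \<zero>) Int_Ind" by (rule pt_axiom) simp
  moreover have "\<exists>q. subst_formula v czer p q \<and> q \<in> T"
    using assms(2) unfolding true_at_def by auto
  ultimately show ?thesis using assms(1,3) by blast
qed

lemma subst_sentence:
  assumes "is_formula1 v p" "is_closed r" "subst_formula v r p q" shows "is_sentence q"
  using subst_formula_formula[of v r p q] assms
  unfolding is_formula1_def is_sentence_def by metis

lemma sentence_simps [simp]:
  "is_sentence (cneg p) \<longleftrightarrow> is_sentence p"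
  "is_sentence (cor p q) \<longleftrightarrow> is_sentence p \<and> is_sentence q"
  by (auto simp: is_sentence_def)

lemma sentence_eq: "is_closed s \<Longrightarrow> is_closed t \<Longrightarrow> is_sentence (ceq s t)"
  using is_closed_is_term is_closed_not_occurs by (auto simp: is_sentence_def)

text \<open>Equations are decided correctly by \<open>T\<close>, so \<open>v = t\<close> selects the value of \<open>t\<close> even if \<open>T\<close> has gaps
  or gluts on \<open>p\<close>.\<close>

lemma T_let_code:
  assumes p: "is_formula1 v p" and t: "is_closed t" "has_value t y"
  shows "let_code v t p \<in> T \<longleftrightarrow> true_at v p y" "cneg (let_code v t p) \<in> T \<longleftrightarrow> false_at v p y"
proof -
  let ?b = "cneg (cor (cneg (ceq v t)) (cneg p))"
  have v: "is_var v" using p by (simp add: is_formula1_def)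
  have b: "is_formula1 v ?b"
    using p t is_closed_is_term is_closed_not_occurs is_var_is_term occurs_in_var
    by (auto simp: is_formula1_def)
  have *: "(true_at v ?b x \<longleftrightarrow> x = y \<and> true_at v p x) \<and> (false_at v ?b x \<longleftrightarrow> x \<noteq> y \<or> false_at v p x)" for x
  proof -
    obtain r where r: "is_numeral x r" using numeral_exists by blast
    then have r': "is_closed r" "has_value r x" using numeral_closed_value by auto
    obtain q where q: "subst_formula v r p q" using subst_formula_exists p unfolding is_formula1_def by blast
    have "subst_term v r t t" using t v is_closed_is_term is_closed_not_occurs subst_term_id by blast
    then have b': "subst_formula v r ?b (cneg (cor (cneg (ceq r t)) (cneg q)))"
      using q v by (simp add: subst_term_var)
    have q': "is_sentence q" using subst_sentence[OF p r'(1) q] .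
    have eq: "is_sentence (ceq r t)" using sentence_eq r'(1) t(1) .
    have neg: "is_sentence (cneg (ceq r t))" "is_sentence (cneg q)" using q' eq by simp_all
    have or: "is_sentence (cor (cneg (ceq r t)) (cneg q))" using neg by simp
    show ?thesis
      unfolding true_at_iff[OF b r b'] true_at_iff[OF p r q] T_or[OF neg] T_neg_neg[OF or]
        T_neg_neg[OF eq] T_neg_neg[OF q'] T_eq[OF r' t] by blast
  qed
  have "(\<exists>x. true_at v ?b x) \<longleftrightarrow> (\<exists>x. x = y \<and> true_at v p x)"
    by (intro arg_cong[where f = Ex] ext) (rule *[THEN conjunct1])
  then show "let_code v t p \<in> T \<longleftrightarrow> true_at v p y" unfolding let_code_def T_ex[OF b] by simp
  have "(\<forall>x. false_at v ?b x) \<longleftrightarrow> (\<forall>x. x \<noteq> y \<or> false_at v p x)"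
    by (intro arg_cong[where f = All] ext) (rule *[THEN conjunct2])
  then show "cneg (let_code v t p) \<in> T \<longleftrightarrow> false_at v p y" unfolding let_code_def T_ex[OF b] by simp
qed

text \<open>All variables are moved up by one to keep \<open>v0\<close> free for the formula that replaces \<open>Tr\<close>.\<close>

definition vr :: "nat \<Rightarrow> 'a" where "vr i = cvar (num (Suc i))"

lemma vr_simps [simp]: "is_var (vr i)" "inj vr" "vr i = vr j \<longleftrightarrow> i = j" "vr i \<noteq> v0" "v0 \<noteq> vr i"
  by (auto simp: vr_def inj_def)

lemma code_fm_formula1:
  assumes h: "is_formula1 v0 h" and \<sigma>: "denotes \<sigma> e"
  shows "is_formula1 (vr i) (code_fm_m vr h (\<sigma>(i := vr i)) A)"
proof -
  have "is_formula (code_fm_m vr h (\<sigma>(i := vr i)) A)"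
    using h \<sigma> is_closed_is_term is_var_is_term
    by (intro code_fm_formula) (auto simp: is_formula1_def denotes_def)
  moreover have "w = vr i" if w: "is_var w" "free_in w (code_fm_m vr h (\<sigma>(i := vr i)) A)" for w
  proof -
    obtain j where "occurs_in w ((\<sigma>(i := vr i)) j)" using code_fm_free[OF h _ w] by auto
    then show ?thesis using \<sigma> is_closed_not_occurs w occurs_in_var
      by (auto simp: denotes_def split: if_splits)
  qed
  ultimately show ?thesis by (simp add: is_formula1_def)
qed

lemma code_fm_sentence:
  assumes h: "is_formula1 v0 h" and \<sigma>: "denotes \<sigma> e"
  shows "is_sentence (code_fm_m vr h \<sigma> A)"
proof -
  have "is_formula (code_fm_m vr h \<sigma> A)"
    using h \<sigma> is_closed_is_term by (intro code_fm_formula) (auto simp: is_formula1_def denotes_def)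
  moreover have False if w: "is_var w" "free_in w (code_fm_m vr h \<sigma> A)" for w
    using code_fm_free[OF h _ w] \<sigma> is_closed_not_occurs w by (auto simp: denotes_def)
  ultimately show ?thesis by (auto simp: is_sentence_def)
qed

lemma code_fm_subst_numeral:
  assumes h: "is_formula1 v0 h" and \<sigma>: "denotes \<sigma> e"
  shows "subst_formula (vr i) r (code_fm_m vr h (\<sigma>(i := vr i)) A) (code_fm_m vr h (\<sigma>(i := r)) A)"
proof -
  have "subst_formula (vr i) r (code_fm_m vr h (\<sigma>(i := vr i)) A)
      (code_fm_m vr h (\<sigma>(i := vr i, i := r)) A)"
    using h \<sigma> is_closed_is_term is_closed_not_occurs is_var_is_term subst_term_id
    by (intro code_fm_subst) (auto simp: denotes_def subst_term_var)
  then show ?thesis by simp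
qed

text \<open>The axioms are positive and negative Tarski clauses, and these are the clauses of \<open>psat\<close>. Truth and
  falsity have to be treated simultaneously because negation exchanges them.\<close>

lemma T_code_fm:
  assumes h: "is_formula1 v0 h" and "denotes \<sigma> e"
  shows "(code_fm_m vr h \<sigma> A \<in> T \<longleftrightarrow> psat M {x. true_at v0 h x} {x. false_at v0 h x} True e A) \<and>
    (cneg (code_fm_m vr h \<sigma> A) \<in> T \<longleftrightarrow> psat M {x. true_at v0 h x} {x. false_at v0 h x} False e A)"
  using assms(2)
proof (induction A arbitrary: \<sigma> e)
  case (Eq s t)
  then show ?case
    using T_eq[of "code_tm_m \<sigma> s" "eval M e s" "code_tm_m \<sigma> t" "eval M e t"]
      code_tm_closed_value[of \<sigma> e] by (auto simp: denotes_def)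
next
  case (Tr t)
  then show ?case
    using T_let_code[OF h, of "code_tm_m \<sigma> t" "eval M e t"] code_tm_closed_value[of \<sigma> e]
    by (auto simp: denotes_def)
next
  case (Neg A)
  then show ?case using code_fm_sentence[OF h Neg.prems, of A] T_neg_neg by simp
next
  case (Or A B)
  then show ?case
    using code_fm_sentence[OF h Or.prems, of A] code_fm_sentence[OF h Or.prems, of B] T_or by simp
next
  case (Exists i A)
  let ?p = "code_fm_m vr h (\<sigma>(i := vr i)) A"
  have p: "is_formula1 (vr i) ?p" using code_fm_formula1[OF h Exists.prems] .
  have "(true_at (vr i) ?p x \<longleftrightarrow> psat M {x. true_at v0 h x} {x. false_at v0 h x} True (e(i := x)) A) \<and>
    (false_at (vr i) ?p x \<longleftrightarrow> psat M {x. true_at v0 h x} {x. false_at v0 h x} False (e(i := x)) A)" for x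
  proof -
    obtain r where r: "is_numeral x r" using numeral_exists by blast
    show ?thesis
      unfolding true_at_iff[OF p r code_fm_subst_numeral[OF h Exists.prems]]
      using Exists.IH[OF denotes_upd[OF Exists.prems r]] .
  qed
  then show ?case using T_ex[OF p] by simp
qed

lemma true_at_code_fm:
  assumes h: "is_formula1 v0 h" and \<sigma>: "denotes \<sigma> e"
  shows "true_at (vr i) (code_fm_m vr h (\<sigma>(i := vr i)) A) x \<longleftrightarrow>
      psat M {x. true_at v0 h x} {x. false_at v0 h x} True (e(i := x)) A"
    "false_at (vr i) (code_fm_m vr h (\<sigma>(i := vr i)) A) x \<longleftrightarrow>
      psat M {x. true_at v0 h x} {x. false_at v0 h x} False (e(i := x)) A"
proof -
  obtain r where r: "is_numeral x r" using numeral_exists by blast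
  note * = true_at_iff[OF code_fm_formula1[OF h \<sigma>] r code_fm_subst_numeral[OF h \<sigma>]]
  show "true_at (vr i) (code_fm_m vr h (\<sigma>(i := vr i)) A) x \<longleftrightarrow>
      psat M {x. true_at v0 h x} {x. false_at v0 h x} True (e(i := x)) A"
    "false_at (vr i) (code_fm_m vr h (\<sigma>(i := vr i)) A) x \<longleftrightarrow>
      psat M {x. true_at v0 h x} {x. false_at v0 h x} False (e(i := x)) A"
    unfolding * using T_code_fm[OF h denotes_upd[OF \<sigma> r]] by blast+
qed

text \<open>Internal induction reaches every property that is expressed positively by a standard formula over \<open>h\<close>.\<close>

lemma psat_induct:
  assumes h: "is_formula1 v0 h"
    and S: "\<And>x. S x \<longleftrightarrow> psat M {x. true_at v0 h x} {x. false_at v0 h x} True (e(i := x)) A"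
    and "S \<zero>" "\<And>x. S x \<Longrightarrow> S (\<S> x)"
  shows "S x"
proof -
  obtain \<sigma> where \<sigma>: "denotes \<sigma> e" using denotes_exists by blast
  show ?thesis
    using internal_induction[OF code_fm_formula1[OF h \<sigma>], of i A x] assms(3,4)
    unfolding true_at_code_fm[OF h \<sigma>] S by blast
qed

text \<open>The standard formula \<open>A\<close> over \<open>h\<close>, as a formula in its variable 0 alone; the other variables are
  filled with closed terms. The variable is moved from \<open>vr 0\<close> back to \<open>v0\<close>, so that the result can
  take the place of \<open>h\<close> and the construction can be iterated.\<close>

definition compose :: "'a \<Rightarrow> (nat \<Rightarrow> 'a) \<Rightarrow> fm \<Rightarrow> 'a" where
  "compose h \<sigma> A = let_code (vr 0) v0 (code_fm_m vr h (\<sigma>(0 := vr 0)) A)"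

lemma compose:
  assumes h: "is_formula1 v0 h" and \<sigma>: "denotes \<sigma> e"
  shows "is_formula1 v0 (compose h \<sigma> A)"
    "true_at v0 (compose h \<sigma> A) x \<longleftrightarrow>
      psat M {x. true_at v0 h x} {x. false_at v0 h x} True (e(0 := x)) A"
    "false_at v0 (compose h \<sigma> A) x \<longleftrightarrow>
      psat M {x. true_at v0 h x} {x. false_at v0 h x} False (e(0 := x)) A"
proof -
  let ?p = "code_fm_m vr h (\<sigma>(0 := vr 0)) A"
  have p: "is_formula1 (vr 0) ?p" using code_fm_formula1[OF h \<sigma>] .
  then show c: "is_formula1 v0 (compose h \<sigma> A)"
    using occurs_in_var by (auto simp: is_formula1_def compose_def)
  obtain r where r: "is_numeral x r" using numeral_exists by blast
  then have r': "is_closed r" "has_value r x" using numeral_closed_value by auto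
  have "subst_formula v0 r ?p ?p"
  proof (rule subst_formula_id)
    show "\<not> free_in v0 ?p" using p is_var_cvar vr_simps(5) unfolding is_formula1_def by blast
  qed (use p in \<open>auto simp: is_formula1_def\<close>)
  then have "subst_formula v0 r (compose h \<sigma> A) (let_code (vr 0) r ?p)"
    by (simp add: compose_def let_code_def subst_term_var)
  note * = true_at_iff[OF c r this] T_let_code[OF p r'] true_at_code_fm[OF h \<sigma>]
  show "true_at v0 (compose h \<sigma> A) x \<longleftrightarrow>
      psat M {x. true_at v0 h x} {x. false_at v0 h x} True (e(0 := x)) A"
    "false_at v0 (compose h \<sigma> A) x \<longleftrightarrow>
      psat M {x. true_at v0 h x} {x. false_at v0 h x} False (e(0 := x)) A"
    unfolding * by (rule refl)+
qed

end

section \<open>A chain of truth predicates of nonstandard length\<close>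

context pa_model
begin

text \<open>Tarski's clauses, applied to a predicate with extension \<open>X\<close> and antiextension \<open>Y\<close>.\<close>

definition clause_true :: "'a set \<Rightarrow> 'a set \<Rightarrow> 'a \<Rightarrow> bool" where
  "clause_true X Y x \<longleftrightarrow>
    (\<exists>s t. is_closed s \<and> is_closed t \<and> x = ceq s t \<and> (\<exists>u. has_value s u \<and> has_value t u)) \<or>
    (\<exists>y. x = cneg y \<and> y \<in> Y) \<or>
    (\<exists>y z. x = cor y z \<and> (y \<in> X \<or> z \<in> X)) \<or>
    (\<exists>v y a r q. x = cex v y \<and> is_numeral a r \<and> subst_formula v r y q \<and> q \<in> X)"

definition clause_false :: "'a set \<Rightarrow> 'a set \<Rightarrow> 'a \<Rightarrow> bool" where
  "clause_false X Y x \<longleftrightarrow>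
    (\<forall>s t. is_closed s \<and> is_closed t \<and> x = ceq s t \<longrightarrow> \<not> (\<exists>u. has_value s u \<and> has_value t u)) \<and>
    (\<forall>y. x = cneg y \<longrightarrow> y \<in> X) \<and>
    (\<forall>y z. x = cor y z \<longrightarrow> y \<in> Y \<and> z \<in> Y) \<and>
    (\<forall>v y a r q. x = cex v y \<and> is_numeral a r \<and> subst_formula v r y q \<longrightarrow> q \<in> Y)"

abbreviation "clause X \<equiv> clause_true X (- X)"

lemma clause_false_classical: "clause_false X (- X) x \<longleftrightarrow> \<not> clause X x"
  unfolding clause_true_def clause_false_def by auto

lemma clause_neg [simp]:
  "clause_true X Y (cneg y) \<longleftrightarrow> y \<in> Y" "clause_false X Y (cneg y) \<longleftrightarrow> y \<in> X"
  unfolding clause_true_def clause_false_def by auto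

lemma clause_or: "clause_true X Y (cor y z) \<longleftrightarrow> y \<in> X \<or> z \<in> X"
  unfolding clause_true_def by auto

lemma clause_eq:
  "is_closed s \<Longrightarrow> is_closed t \<Longrightarrow> has_value s x \<Longrightarrow> has_value t y \<Longrightarrow> clause_true X Y (ceq s t) \<longleftrightarrow> x = y"
  unfolding clause_true_def by simp (metis value_unique)

lemma clause_ex:
  "clause_true X Y (cex v y) \<longleftrightarrow> (\<exists>a r q. is_numeral a r \<and> subst_formula v r y q \<and> q \<in> X)"
  unfolding clause_true_def by auto

primrec approx :: "nat \<Rightarrow> 'a set \<Rightarrow> bool" where
  "approx 0 X \<longleftrightarrow> True"
| "approx (Suc n) X \<longleftrightarrow> (\<exists>Y. approx n Y \<and> X = {x. clause Y x})"

primrec height :: "fm \<Rightarrow> nat" where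
  "height (Eq s t) = 0"
| "height (Tr t) = 0"
| "height (Neg A) = Suc (height A)"
| "height (Or A B) = Suc (max (height A) (height B))"
| "height (Exists i A) = Suc (height A)"

abbreviation "var_code \<equiv> \<lambda>i. cvar (num i)"
text \<open>The default in place of \<open>Tr\<close> for codes of arithmetical formulae, and the start of the iteration
  below.\<close>

abbreviation "top_code \<equiv> ceq czer czer"

lemma top_formula1: "is_var v \<Longrightarrow> is_formula1 v top_code"
  by (auto simp: is_formula1_def)

text \<open>Each connective or quantifier of \<open>A\<close> uses one link of the chain. In the quantifier case the numeral
  of the witness becomes a value of \<open>\<sigma>\<close>, so the induction has to run over all \<open>\<sigma>\<close>.\<close>

lemma approx_correct:
  assumes "arithmetical A" "approx n X" "height A < n" "denotes \<sigma> e"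
  shows "code_fm_m var_code top_code \<sigma> A \<in> X \<longleftrightarrow> sat M {} e A"
  using assms
proof (induction A arbitrary: n X \<sigma> e)
  case (Tr t)
  then show ?case by simp
next
  case (Eq s t)
  obtain m where "n = Suc m" using Eq.prems(3) by (cases n) auto
  then obtain Y where X: "X = {x. clause Y x}" using Eq.prems(2) by auto
  note cv = code_tm_closed_value[of \<sigma> e] 
  show ?case using Eq.prems(4) cv[of s] cv[of t] unfolding X denotes_def
    by (simp add: clause_eq)
next
  case (Neg A)
  obtain m where m: "n = Suc m" using Neg.prems(3) by (cases n) auto
  then obtain Y where Y: "approx m Y" "X = {x. clause Y x}" using Neg.prems(2) by auto
  then show ?case using Neg.IH[of m Y \<sigma> e] Neg.prems m by simp
next
  case (Or A B)
  obtain m where m: "n = Suc m" using Or.prems(3) by (cases n) auto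
  then obtain Y where Y: "approx m Y" "X = {x. clause Y x}" using Or.prems(2) by auto
  then show ?case using Or.IH(1)[of m Y \<sigma> e] Or.IH(2)[of m Y \<sigma> e] Or.prems m
    by (simp add: clause_or)
next
  case (Exists i A)
  obtain m where m: "n = Suc m" using Exists.prems(3) by (cases n) auto
  then obtain Y where Y: "approx m Y" "X = {x. clause Y x}" using Exists.prems(2) by auto
  let ?p = "code_fm_m var_code top_code (\<sigma>(i := var_code i)) A"
  have p: "is_formula ?p"
    using Exists.prems(4) is_closed_is_term by (intro code_fm_formula) (auto simp: denotes_def)
  have sub: "subst_formula (var_code i) r ?p q \<longleftrightarrow> q = code_fm_m var_code top_code (\<sigma>(i := r)) A" for r q
  proof -
    have "subst_formula (var_code i) r ?p
        (code_fm_m var_code top_code (\<sigma>(i := var_code i, i := r)) A)"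
    proof (rule code_fm_subst)
      show "inj var_code" by (auto simp: inj_def)
      show "is_formula1 v0 top_code" by (simp add: top_formula1)
      show "is_term ((\<sigma>(i := var_code i)) j)" for j
        using Exists.prems(4) is_closed_is_term by (auto simp: denotes_def)
      show "subst_term (var_code i) r ((\<sigma>(i := var_code i)) j) ((\<sigma>(i := var_code i)) j)" if "j \<noteq> i" for j
        using Exists.prems(4) is_closed_is_term is_closed_not_occurs subst_term_id that
        by (simp add: denotes_def)
    qed (use Exists.prems in auto)
    then have "subst_formula (var_code i) r ?p (code_fm_m var_code top_code (\<sigma>(i := r)) A)" by simp
    then show ?thesis using subst_formula_unique[OF _ p] is_var_cvar by blast
  qed
  have IH: "code_fm_m var_code top_code (\<sigma>(i := r)) A \<in> Y \<longleftrightarrow> sat M {} (e(i := a)) A" if "is_numeral a r" for a r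
    using Exists.IH[of m Y "\<sigma>(i := r)" "e(i := a)"] Exists.prems Y(1) m denotes_upd[OF _ that]
    by (simp del: fun_upd_apply)
  have "code_fm_m var_code top_code \<sigma> (Exists i A) \<in> X \<longleftrightarrow>
      (\<exists>a r. is_numeral a r \<and> code_fm_m var_code top_code (\<sigma>(i := r)) A \<in> Y)"
    by (simp add: Y(2) clause_ex sub)
  also have "\<dots> \<longleftrightarrow> (\<exists>a. sat M {} (e(i := a)) A)" using IH numeral_exists by blast
  finally show ?case by simp
qed

definition biconditionals :: "'a set \<Rightarrow> bool" where
  "biconditionals X \<longleftrightarrow> (\<forall>A \<sigma> e. arithmetical A \<and> denotes \<sigma> e \<longrightarrow>
    (code_fm_m var_code top_code \<sigma> A \<in> X \<longleftrightarrow> sat M {} e A))"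

lemma sat_cong: "(\<And>i. i \<in> fvars A \<Longrightarrow> e i = e' i) \<Longrightarrow> sat M X e A = sat M X e' A"
proof (induction A arbitrary: e e')
  case (Eq s t)
  have "eval M e s = eval M e' s" by (rule eval_cong) (use Eq in auto)
  moreover have "eval M e t = eval M e' t" by (rule eval_cong) (use Eq in auto)
  ultimately show ?case by simp
next
  case (Tr t)
  have "eval M e t = eval M e' t" by (rule eval_cong) (use Tr in auto)
  then show ?case by simp
next
  case (Neg A)
  have "sat M X e A = sat M X e' A" by (rule Neg.IH) (use Neg.prems in auto)
  then show ?case by simp
next
  case (Or A B)
  have "sat M X e A = sat M X e' A" by (rule Or.IH) (use Or.prems in auto)
  moreover have "sat M X e B = sat M X e' B" by (rule Or.IH) (use Or.prems in auto)
  ultimately show ?case by simp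
next
  case (Exists i A)
  have "sat M X (e(i := x)) A = sat M X (e'(i := x)) A" for x
    by (rule Exists.IH) (use Exists.prems in auto)
  then show ?case by simp
qed

lemma sat_foldr_Forall: "(\<And>e. sat M X e A) \<Longrightarrow> sat M X e (foldr Forall xs A)"
  by (induction xs arbitrary: e) auto

lemma sat_foldr_Imp:
  "sat M X e (foldr (\<lambda>i. Imp (G i)) xs A) \<longleftrightarrow> ((\<forall>i\<in>set xs. sat M X e (G i)) \<longrightarrow> sat M X e A)"
  by (induction xs) auto

lemma biconditionals_utb:
  assumes "biconditionals X" "arithmetical A" "fvars A \<subseteq> {..n}"
  shows "sat M X e (utb_instance n A)"
  unfolding utb_instance_def
proof (rule sat_foldr_Forall)
  fix e
  have guard: "sat M X e ((IsClosedTerm (Var (Suc n + i)) \<^bold>\<and> Value (Var (Suc n + i)) (Var i)) (2 * Suc n))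
      \<longleftrightarrow> is_closed (e (Suc n + i)) \<and> has_value (e (Suc n + i)) (e i)" if "i < Suc n" for i
    using that by (simp add: s_and_def)
  show "sat M X e (foldr (\<lambda>i. Imp ((IsClosedTerm (Var (Suc n + i)) \<^bold>\<and> Value (Var (Suc n + i)) (Var i))
      (2 * Suc n))) [0..<Suc n] (Iff (Tr (code_fm (\<lambda>i. Var (Suc n + i)) A)) A))"
    unfolding sat_foldr_Imp
  proof
    assume "\<forall>i\<in>set [0..<Suc n]. sat M X e ((IsClosedTerm (Var (Suc n + i)) \<^bold>\<and>
        Value (Var (Suc n + i)) (Var i)) (2 * Suc n))"
    then have *: "is_closed (e (Suc n + i)) \<and> has_value (e (Suc n + i)) (e i)" if "i \<le> n" for i
      using that guard[of i] by (simp del: upt_Suc)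
    \<comment> \<open>Only the variables up to \<open>n\<close> are known to carry closed terms; the others are given a default.\<close>
    define \<sigma> where "\<sigma> = (\<lambda>i. if i \<le> n then e (Suc n + i) else czer)"
    define e' where "e' = (\<lambda>i. if i \<le> n then e i else \<zero>)"
    have "denotes \<sigma> e'" using * by (auto simp: denotes_def \<sigma>_def e'_def)
    then have "code_fm_m var_code top_code \<sigma> A \<in> X \<longleftrightarrow> sat M {} e' A"
      using assms(1,2) unfolding biconditionals_def by blast
    moreover have "code_fm_m var_code top_code \<sigma> A = eval M e (code_fm (\<lambda>i. Var (Suc n + i)) A)"
      unfolding eval_code_fm[OF assms(2), of _ _ top_code]
      by (rule code_fm_m_cong) (use assms(3) in \<open>auto simp: \<sigma>_def\<close>)
    moreover have "sat M {} e' A = sat M X e A"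
      unfolding sat_arithmetical[OF assms(2), of M X e "{}"]
      by (rule sat_cong) (use assms(3) in \<open>auto simp: e'_def\<close>)
    ultimately show "sat M X e (Iff (Tr (code_fm (\<lambda>i. Var (Suc n + i)) A)) A)" by simp
  qed
qed

lemma models_UTB:
  assumes "biconditionals X" "\<And>v A e. sat M X e (ind_axiom v A)"
  shows "models M X UTB"
proof -
  have "sat M X e A" if "A \<in> robinson" for A e
    using that robinson_axiom[OF that, of e]
    by (auto simp: robinson_def)
  then show ?thesis
    using assms biconditionals_utb unfolding models_def UTB_def PA_def by blast
qed

definition std :: "'a \<Rightarrow> bool" where "std x \<longleftrightarrow> (\<exists>k. x = num k)"

lemma std_zero [simp]: "std \<zero>"
  unfolding std_def by (metis num.simps(1))

lemma std_suc [simp]: "std (\<S> x) \<longleftrightarrow> std x"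
proof
  assume "std (\<S> x)"
  then obtain k where "\<S> x = num k" unfolding std_def by blast
  then show "std x" by (cases k) (auto simp: num.simps std_def)
next
  assume "std x"
  then show "std (\<S> x)" unfolding std_def by (metis num.simps(2))
qed

lemma std_summand: "std (x \<oplus> y) \<Longrightarrow> std x"
proof -
  have "x \<oplus> y = num k \<Longrightarrow> std x" for k
  proof (induction k arbitrary: x)
    case 0
    then show ?case by (auto simp: num.simps)
  next
    case (Suc k)
    show ?case
    proof (cases "x = \<zero>")
      case False
      then obtain z where "x = \<S> z" using zero_or_suc by blast
      then show ?thesis using Suc by (simp add: num.simps)
    qed simp
  qed
  then show "std (x \<oplus> y) \<Longrightarrow> std x" unfolding std_def by blast
qed

lemma nonstd_suc: "\<not> std x \<Longrightarrow> \<exists>y. x = \<S> y \<and> \<not> std y"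
  using zero_or_suc[of x] by auto

text \<open>In the standard model, truth is the limit of the truth predicates of finite level.\<close>

lemma UTB_standard:
  assumes "\<And>x. std x" shows "\<exists>X. models M X UTB"
proof -
  define Xs where "Xs = rec_nat {} (\<lambda>_ Y. {x. clause Y x})"
  define X where "X = {x. \<exists>k. \<forall>j\<ge>k. x \<in> Xs j}"
  have approx: "approx n (Xs n)" for n
    by (induction n) (auto simp: Xs_def)
  have "biconditionals X"
    unfolding biconditionals_def
  proof (intro allI impI, elim conjE)
    fix A \<sigma> e assume A: "arithmetical A" "denotes \<sigma> e"
    have "code_fm_m var_code top_code \<sigma> A \<in> Xs j \<longleftrightarrow> sat M {} e A" if "j > height A" for j
      using approx_correct[OF A(1) approx that A(2)] .
    then show "code_fm_m var_code top_code \<sigma> A \<in> X \<longleftrightarrow> sat M {} e A"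
    proof -
      assume *: "\<And>j. j > height A \<Longrightarrow> code_fm_m var_code top_code \<sigma> A \<in> Xs j \<longleftrightarrow> sat M {} e A"
      have "code_fm_m var_code top_code \<sigma> A \<in> Xs (max k (Suc (height A))) \<longleftrightarrow> sat M {} e A" for k
        by (rule *) simp
      then have "sat M {} e A" if "\<forall>j\<ge>k. code_fm_m var_code top_code \<sigma> A \<in> Xs j" for k
        using that max.cobounded1 by blast
      then have "sat M {} e A" if "code_fm_m var_code top_code \<sigma> A \<in> X"
        using that unfolding X_def by blast
      moreover have "code_fm_m var_code top_code \<sigma> A \<in> X" if "sat M {} e A"
        using that * unfolding X_def by (auto intro!: exI[of _ "Suc (height A)"])
      ultimately show ?thesis by blast
    qed
  qed
  moreover have "sat M X e (ind_axiom v A)" for v A e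
    unfolding sat_ind_axiom
  proof (intro impI allI)
    fix x
    assume *: "sat M X (e(v := \<zero>)) A" "\<forall>x. sat M X (e(v := x)) A \<longrightarrow> sat M X (e(v := \<S> x)) A"
    have "sat M X (e(v := num k)) A" for k
      by (induction k) (use * in \<open>auto simp: num.simps simp del: fun_upd_apply\<close>)
    then show "sat M X (e(v := x)) A" using assms[of x] unfolding std_def by blast
  qed
  ultimately show ?thesis using models_UTB by blast
qed

end

text \<open>The variable 0 stands for a pair of a level and a sentence. The sentence is evaluated by Tarski's
  clauses with the truth predicate taken at the preceding level; at level \<open>0\<close> nothing is true.\<close>

definition step_fm :: fm where
  "step_fm = (\<^bold>\<exists>w. \<^bold>\<exists>x. Var 0 \<^bold>= pr (Sc w) x \<^bold>\<and>
    ((\<^bold>\<exists>s. \<^bold>\<exists>t. IsClosedTerm s \<^bold>\<and> IsClosedTerm t \<^bold>\<and> x \<^bold>= cEq s t \<^bold>\<and> (\<^bold>\<exists>u. Value s u \<^bold>\<and> Value t u)) \<^bold>\<or>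
     (\<^bold>\<exists>y. x \<^bold>= cNeg y \<^bold>\<and> (\<^bold>\<not> \<^bold>T (pr w y))) \<^bold>\<or>
     (\<^bold>\<exists>y. \<^bold>\<exists>z. x \<^bold>= cOr y z \<^bold>\<and> (\<^bold>T (pr w y) \<^bold>\<or> \<^bold>T (pr w z))) \<^bold>\<or>
     (\<^bold>\<exists>v. \<^bold>\<exists>y. \<^bold>\<exists>a. \<^bold>\<exists>r. \<^bold>\<exists>q. x \<^bold>= cEx v y \<^bold>\<and> Numeral a r \<^bold>\<and> SubstFormula v r y q \<^bold>\<and> \<^bold>T (pr w q)))) 1"

lemma psat_And [simp]:
  "psat M P N b e (And A B) \<longleftrightarrow> (if b then psat M P N b e A \<and> psat M P N b e B
     else psat M P N b e A \<or> psat M P N b e B)"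
  by (simp add: And_def)

context pa_model
begin

lemma arithmetical_Derivable_leaves:
  "arithmetical (IsClosedTerm t n)" "arithmetical (Value t u n)" "arithmetical (Numeral t u n)"
  "arithmetical (SubstFormula p q r u n)"
  by (simp_all add: IsClosedTerm_def Value_def Numeral_def SubstFormula_def SubstTerm_def IsVar_def
      IsFormula_def IsTerm_def Derivable_def Mem_def Lt_def s_defs And_def Imp_def Forall_def)

lemma psat_leaves [simp]:
  "below t n \<Longrightarrow> psat M P N b e (IsClosedTerm t n) \<longleftrightarrow> is_closed (eval M e t) = b"
  "below t n \<Longrightarrow> below u n \<Longrightarrow> psat M P N b e (Value t u n) \<longleftrightarrow> has_value (eval M e t) (eval M e u) = b"
  "below t n \<Longrightarrow> below u n \<Longrightarrow> psat M P N b e (Numeral t u n) \<longleftrightarrow> is_numeral (eval M e t) (eval M e u) = b"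
  "below v n \<Longrightarrow> below r n \<Longrightarrow> below p n \<Longrightarrow> below q n \<Longrightarrow> psat M P N b e (SubstFormula v r p q n) \<longleftrightarrow>
    subst_formula (eval M e v) (eval M e r) (eval M e p) (eval M e q) = b"
  by (simp_all add: psat_arithmetical arithmetical_Derivable_leaves)

lemma psat_step_true:
  "psat M P N True (e(0 := u)) step_fm \<longleftrightarrow>
    (\<exists>w x. u = pair (\<S> w) x \<and> clause_true {y. pair w y \<in> P} {y. pair w y \<in> N} x)"
  by (simp add: step_fm_def s_defs code_term_defs clause_true_def)

lemma psat_step_false:
  "psat M P N False (e(0 := u)) step_fm \<longleftrightarrow>
    (\<forall>w x. u = pair (\<S> w) x \<longrightarrow> clause_false {y. pair w y \<in> P} {y. pair w y \<in> N} x)"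
  by (simp add: step_fm_def s_defs code_term_defs clause_false_def) blast

end

context pt_model
begin

abbreviation "P_of h \<equiv> {x. true_at v0 h x}"
abbreviation "N_of h \<equiv> {x. false_at v0 h x}"

definition level :: "'a \<Rightarrow> 'a \<Rightarrow> 'a set" where "level h u = {x. true_at v0 h (pair u x)}"
definition antilevel :: "'a \<Rightarrow> 'a \<Rightarrow> 'a set" where "antilevel h u = {x. false_at v0 h (pair u x)}"
definition classical :: "'a \<Rightarrow> 'a \<Rightarrow> bool" where "classical h u \<longleftrightarrow> antilevel h u = - level h u"

definition next_code :: "'a \<Rightarrow> 'a" where "next_code h = compose h (\<lambda>_. czer) step_fm"

lemma denotes_zero: "denotes (\<lambda>_. czer) (\<lambda>_. \<zero>)"
  by (simp add: denotes_def)

lemma next_code_formula1: "is_formula1 v0 h \<Longrightarrow> is_formula1 v0 (next_code h)"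
  unfolding next_code_def using compose(1) denotes_zero by blast

lemma level_next:
  assumes "is_formula1 v0 h"
  shows "level (next_code h) \<zero> = {}" "antilevel (next_code h) \<zero> = UNIV"
    "level (next_code h) (\<S> w) = {x. clause_true (level h w) (antilevel h w) x}"
    "antilevel (next_code h) (\<S> w) = {x. clause_false (level h w) (antilevel h w) x}"
  unfolding level_def antilevel_def next_code_def compose(2,3)[OF assms denotes_zero]
    psat_step_true psat_step_false by simp_all

text \<open>Codes are built by pairing, so plugging \<open>h\<close> into a standard formula is a polynomial in \<open>h\<close>.\<close>

lemma definable_fn_code_fm:
  assumes "definable_fn M f"
  shows "definable_fn M (\<lambda>e. code_fm_m vr (f e) \<sigma> A)"
  by (induction A arbitrary: \<sigma>)
    (simp_all add: definable_fn_pair_m definable_fn_const assms let_code_def)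

lemma definable_next_code: "definable_fn M f \<Longrightarrow> definable_fn M (\<lambda>e. next_code (f e))"
  unfolding next_code_def compose_def let_code_def
  by (intro definable_fn_pair_m definable_fn_const definable_fn_code_fm)

text \<open>\<open>is_iterate k h\<close> says that \<open>h\<close> arises by \<open>k\<close> iterations of \<open>next_code\<close>. This is an inductive definition
  inside the model, so \<open>k\<close> may be nonstandard.\<close>

definition iterate_step :: "('a \<Rightarrow> bool) \<Rightarrow> 'a \<Rightarrow> bool" where
  "iterate_step D y \<longleftrightarrow> y = pair \<zero> top_code \<or>
    (\<exists>k h. D (pair k h) \<and> y = pair (\<S> k) (next_code h))"

definition "is_iterate k h = derivable iterate_step (pair k h)"

lemma is_iterate_iff:
  "is_iterate k h \<longleftrightarrow> k = \<zero> \<and> h = top_code \<or>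
    (\<exists>k' h'. is_iterate k' h' \<and> k = \<S> k' \<and> h = next_code h')"
proof -
  have "binary (\<lambda>X. iterate_step X y)" for y
    unfolding iterate_step_def by (intro binary_intros)
  from derivable_iff[of iterate_step "pair k h", OF this] show ?thesis
    by (simp add: is_iterate_def iterate_step_def)
qed

lemma is_iterate_simps [simp]:
  "is_iterate \<zero> h \<longleftrightarrow> h = top_code"
  "is_iterate (\<S> k) h \<longleftrightarrow> (\<exists>h'. is_iterate k h' \<and> h = next_code h')"
  by (auto simp: is_iterate_iff[of \<zero>] is_iterate_iff[of "\<S> k"])

lemma definable_is_iterate:
  "definable_fn M f \<Longrightarrow> definable_fn M g \<Longrightarrow> definable M (\<lambda>e. is_iterate (f e) (g e))"
  by (rule definable_subst2[of is_iterate])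
    (unfold is_iterate_def derivable_def iterate_step_def,
     intro definable_next_code definable_rules)

lemma iterate_exists: "\<exists>h. is_iterate k h"
proof (rule pa_induct[of "\<lambda>k. \<exists>h. is_iterate k h"])
  show "definable M (\<lambda>e. \<exists>h. is_iterate (e 0) h)" by (intro definable_is_iterate definable_rules)
qed auto

lemma iterate_formula1: "is_iterate k h \<Longrightarrow> is_formula1 v0 h"
proof -
  have "\<forall>h. is_iterate k h \<longrightarrow> is_formula1 v0 h"
  proof (rule pa_induct[of "\<lambda>k. \<forall>h. is_iterate k h \<longrightarrow> is_formula1 v0 h"])
    show "definable M (\<lambda>e. \<forall>h. is_iterate (e 0) h \<longrightarrow> is_formula1 v0 h)"
      unfolding is_formula1_def by (intro definable_is_iterate definable_syntax)
  qed (auto simp: top_formula1 next_code_formula1)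
  then show "is_iterate k h \<Longrightarrow> is_formula1 v0 h" by blast
qed

lemma nonstandard_iterate_cases:
  assumes "is_iterate n h" "\<not> std n"
  obtains n' h' where "is_iterate n' h'" "\<not> std n'" "h = next_code h'" "is_formula1 v0 h'"
  using assms nonstd_suc iterate_formula1 is_iterate_simps(2) by metis

lemma classical_next: "is_formula1 v0 h \<Longrightarrow> classical h w \<Longrightarrow>
    classical (next_code h) (\<S> w) \<and> level (next_code h) (\<S> w) = {x. clause (level h w) x}"
  unfolding classical_def by (auto simp: level_next clause_false_classical)

text \<open>External induction on the level: level \<open>0\<close> is empty, and Tarski's clauses preserve classicality.
  Each step uses up one iteration, of which a nonstandard number is available.\<close>

lemma classical_standard_level:
  "is_iterate n h \<Longrightarrow> \<not> std n \<Longrightarrow> classical h (num k)"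
proof (induction k arbitrary: n h)
  case 0
  then obtain h' where "h = next_code h'" "is_formula1 v0 h'"
    using nonstandard_iterate_cases by metis
  then show ?case by (simp add: classical_def level_next num.simps)
next
  case (Suc k)
  then obtain n' h' where "is_iterate n' h'" "\<not> std n'" "h = next_code h'" "is_formula1 v0 h'"
    using nonstandard_iterate_cases by metis
  then show ?case using Suc.IH classical_next by (simp add: num.simps)
qed

text \<open>A gap or a glut at \<open>y\<close> would reappear at the negation of \<open>y\<close> one level above.\<close>

lemma classical_previous:
  assumes "is_formula1 v0 h" "classical (next_code h) (\<S> w)" shows "classical h w"
proof -
  have "y \<in> antilevel h w \<longleftrightarrow> y \<notin> level h w" for y
  proof -
    have "cneg y \<in> antilevel (next_code h) (\<S> w) \<longleftrightarrow> cneg y \<notin> level (next_code h) (\<S> w)"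
      using assms(2) unfolding classical_def by simp
    then show ?thesis using assms(1) by (auto simp: level_next)
  qed
  then show ?thesis unfolding classical_def by blast
qed

text \<open>Below a nonstandard classical level the levels can be descended, together with the iterates, any
  standard number of times.\<close>

lemma nonstandard_level_approx:
  "is_iterate n h \<Longrightarrow> \<not> std n \<Longrightarrow> \<not> std c \<Longrightarrow> classical h c \<Longrightarrow> approx k (level h c)"
proof (induction k arbitrary: n h c)
  case (Suc k)
  obtain n' h' where h': "is_iterate n' h'" "\<not> std n'" "h = next_code h'" "is_formula1 v0 h'"
    using nonstandard_iterate_cases Suc.prems by metis
  obtain c' where c': "c = \<S> c'" "\<not> std c'" using nonstd_suc Suc.prems(3) by blast
  have "classical h' c'" using classical_previous h' c' Suc.prems(4) by blast
  then show ?case using Suc.IH[of n' h' c'] h' c' classical_next by auto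
qed simp

section \<open>Overspill with internal induction\<close>

text \<open>Totality of all levels up to the variable 0, and existence of a glut at a level whose sum with the
  variable 0 is at most the variable 1.\<close>

definition total_fm :: fm where
  "total_fm = Forall 1 (Forall 2 (Imp (Exists 3 (Eq (Add (Var 1) (Var 3)) (Var 0)))
    (Or (Tr (pr (Var 1) (Var 2))) (Neg (Tr (pr (Var 1) (Var 2)))))))"

definition glut_fm :: fm where
  "glut_fm = Exists 2 (Exists 3 (Exists 4 (And (Eq (Add (Add (Var 2) (Var 0)) (Var 3)) (Var 1))
    (And (Tr (pr (Var 2) (Var 4))) (Neg (Tr (pr (Var 2) (Var 4))))))))"

lemma psat_total:
  "psat M (P_of h) (N_of h) True (e(0 := u)) total_fm \<longleftrightarrow>
    (\<forall>w z. w \<oplus> z = u \<longrightarrow> level h w \<union> antilevel h w = UNIV)"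
  by (auto simp: total_fm_def Forall_def Imp_def level_def antilevel_def)

lemma psat_glut:
  "psat M (P_of h) (N_of h) True ((\<lambda>_. c)(0 := u)) glut_fm \<longleftrightarrow>
    (\<exists>w z. w \<oplus> u \<oplus> z = c \<and> level h w \<inter> antilevel h w \<noteq> {})"
  by (auto simp: glut_fm_def level_def antilevel_def)

text \<open>Totality up to a level is positive, hence subject to internal induction. It holds at all standard
  levels; if it held only there, it would define the standard cut.\<close>

lemma nonstandard_total_level:
  assumes n: "is_iterate n h" "\<not> std n"
  shows "\<exists>c. \<not> std c \<and> (\<forall>w z. w \<oplus> z = c \<longrightarrow> level h w \<union> antilevel h w = UNIV)"
proof (rule ccontr)
  let ?S = "\<lambda>u. \<forall>w z. w \<oplus> z = u \<longrightarrow> level h w \<union> antilevel h w = UNIV"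
  assume "\<not> ?thesis"
  then have std: "std u" if "?S u" for u using that by blast
  have total: "?S u" if u: "std u" for u
  proof (intro allI impI)
    fix w z assume "w \<oplus> z = u"
    then obtain k where "w = num k" using u std_summand unfolding std_def by blast
    then show "level h w \<union> antilevel h w = UNIV"
      using classical_standard_level[OF n] unfolding classical_def by blast
  qed
  have "?S n"
  proof (rule psat_induct[OF iterate_formula1[OF n(1)], of ?S "\<lambda>_. \<zero>" 0 total_fm])
    show "?S x \<longleftrightarrow> psat M (P_of h) (N_of h) True ((\<lambda>_. \<zero>)(0 := x)) total_fm" for x
      by (rule psat_total[symmetric])
    show "?S \<zero>" using total std_zero by blast
    show "?S (\<S> x)" if "?S x" for x using total std that std_suc by blast
  qed
  then show False using std n(2) by blast
qed

text \<open>Consistency is not a positive condition. Therefore the argument is turned around: counting down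
  from a level \<open>c\<close> up to which all levels are total, there would be a glut at all nonstandard levels
  and at none of the standard ones. The set of those \<open>u\<close> for which there is a glut at a level at most
  \<open>c - u\<close> would then be closed under successor, although it does not contain \<open>c + 1\<close>.\<close>

lemma nonstandard_classical_level:
  assumes n: "is_iterate n h" "\<not> std n"
  shows "\<exists>c. \<not> std c \<and> classical h c"
proof (rule ccontr)
  assume none: "\<not> ?thesis"
  obtain c where c: "\<not> std c" "\<And>w z. w \<oplus> z = c \<Longrightarrow> level h w \<union> antilevel h w = UNIV"
    using nonstandard_total_level[OF n] by blast
  let ?S = "\<lambda>u. \<exists>w z. w \<oplus> u \<oplus> z = c \<and> level h w \<inter> antilevel h w \<noteq> {}"
  have glut: "level h w \<inter> antilevel h w \<noteq> {}" if "\<not> std w" "w \<oplus> z = c" for w z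
  proof
    assume "level h w \<inter> antilevel h w = {}"
    then have "classical h w" using c(2)[OF that(2)] unfolding classical_def by blast
    then show False using none that(1) by blast
  qed
  have nonstd: "\<not> std w" if "level h w \<inter> antilevel h w \<noteq> {}" for w
    using that classical_standard_level[OF n] unfolding classical_def std_def by auto
  have "?S (\<S> c)"
  proof (rule psat_induct[OF iterate_formula1[OF n(1)], of ?S "\<lambda>_. c" 0 glut_fm])
    show "?S x \<longleftrightarrow> psat M (P_of h) (N_of h) True ((\<lambda>_. c)(0 := x)) glut_fm" for x
      by (rule psat_glut[symmetric])
    show "?S \<zero>" using glut[OF c(1), of \<zero>] by (intro exI[of _ c] exI[of _ \<zero>]) simp
    fix x assume "?S x"
    then obtain w z where w: "w \<oplus> x \<oplus> z = c" "level h w \<inter> antilevel h w \<noteq> {}" by blast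
    then obtain w' where w': "w = \<S> w'" "\<not> std w'" using nonstd nonstd_suc by blast
    then have "w' \<oplus> \<S> x \<oplus> z = c" using w(1) by simp
    then show "?S (\<S> x)" using glut[OF w'(2)] add_assoc by metis
  qed
  then obtain w z where "w \<oplus> \<S> c \<oplus> z = c" by blast
  then have "c \<oplus> \<S> (w \<oplus> z) = c \<oplus> \<zero>"
    by (metis add_assoc add_commute add_suc_right add_zero_right)
  then show False using add_cancel suc_not_zero by metis
qed

section \<open>Full induction for the truth predicate\<close>

text \<open>At a classical level the gappy evaluation is satisfaction with \<open>Tr\<close> interpreted by this level, so
  internal induction is full induction. The level \<open>c\<close> enters the formula \<open>g\<close> as a closed term.\<close>

lemma level_induction:
  assumes h: "is_formula1 v0 h" and c: "classical h c"
  shows "sat M (level h c) e (ind_axiom v A)"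
proof -
  obtain \<sigma> where \<sigma>: "denotes \<sigma> (\<lambda>_. c)" using denotes_exists by blast
  define g where "g = compose h \<sigma> (Tr (pr (Var 1) (Var 0)))"
  have g: "is_formula1 v0 g" unfolding g_def using compose(1)[OF h \<sigma>] .
  have P: "P_of g = level h c" and "N_of g = antilevel h c"
    unfolding g_def compose(2,3)[OF h \<sigma>] by (auto simp: level_def antilevel_def)
  then have N: "N_of g = - level h c" using c by (simp add: classical_def)
  have "sat M (level h c) (e(v := x)) A" 
    if "sat M (level h c) (e(v := \<zero>)) A" 
      "\<And>x. sat M (level h c) (e(v := x)) A \<Longrightarrow> sat M (level h c) (e(v := \<S> x)) A" for x
  proof (rule psat_induct[OF g, of "\<lambda>x. sat M (level h c) (e(v := x)) A" e v A])
    show "sat M (level h c) (e(v := x)) A \<longleftrightarrow> psat M (P_of g) (N_of g) True (e(v := x)) A" for x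
      unfolding P by (simp add: psat_classical[OF N])
  qed (rule that)+
  then show ?thesis unfolding sat_ind_axiom by blast
qed

lemma exists_UTB: "\<exists>X. models M X UTB"
proof (cases "\<forall>x. std x")
  case True
  then show ?thesis using UTB_standard by blast
next
  case False
  then obtain n where n: "\<not> std n" by blast
  obtain h where h: "is_iterate n h" using iterate_exists by blast
  obtain c where c: "\<not> std c" "classical h c" using nonstandard_classical_level[OF h n] by blast
  have "biconditionals (level h c)"
    unfolding biconditionals_def
    using approx_correct[OF _ nonstandard_level_approx[OF h n c] lessI] by blast
  then show ?thesis using models_UTB level_induction[OF iterate_formula1[OF h] c(2)] by blast
qed

end

theorem theorem20:
  fixes M :: "'a arith" and T :: "'a set"
  assumes "models M T (PT_minus \<union> {Int_Ind})"
  shows "\<exists>T' :: 'a set. models M T' UTB"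
proof -
  interpret pt_model M T by unfold_locales (rule assms)
  show ?thesis by (rule exists_UTB)
qed

end
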